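(* Let $M$ be a compact, connected, orientable smooth surface (without boundary) and let $\mathbf{x}:M\to\mathbb{R}^3$ be a smooth immersion with nonconstant mean curvature $H$, meaning that $dH\neq 0$ on a dense open subset of $M$. Suppose that the set $\mathcal{D}$ of umbilic points of $\mathbf{x}$ is a discrete subset of $M$. Then: (1) If the restriction of $\mathbf{x}$ to $M\setminus\mathcal{D}$ is isothermic, i.e. $\Delta g=0$ identically on $M\setminus\mathcal{D}$, then $\mathbf{x}$ has no Bonnet mate. (2) If $\mathbf{x}$ is totally nonisothermic, i.e. $\Delta g\neq 0$ at every point of some connected, open, dense subset of $M\setminus\mathcal{D}$, then $\mathbf{x}$ has no Bonnet mate. (The function $\Delta g$ on $M\setminus\mathcal{D}$ and the notion of Bonnet mate are defined in the context.)
   Context: Conventions. $M$ is a connected orientable surface with a fixed orientation. For a smooth immersion $\mathbf{x}:M\to\mathbb{R}^3$, let $\mathbf{e}_3$ be the unit normal field along $\mathbf{x}$ that induces the given orientation of $M$ from the standard orientation of $\mathbb{R}^3$. Let $I=d\mathbf{x}\cdot d\mathbf{x}$ be the induced metric and $II=-d\mathbf{e}_3\cdot d\mathbf{x}$ the second fundamental form. The metric $I$ and the orientation determine a complex structure on $M$, with respect to which $II=II^{2,0}+H\,I+II^{0,2}$, where $H$ is the mean curvature of $\mathbf{x}$ relative to $\mathbf{e}_3$ and $II^{2,0}=\overline{II^{0,2}}$ is the Hopf quadratic differential. In a complex coordinate chart $(U,z)$ of $M$ write $I=e^{2u}\,dz\,d\bar z$ and $II^{2,0}=\tfrac12 h e^{2u}\,dz\,dz$,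 with $u:U\to\mathbb{R}$ and $h:U\to\mathbb{C}$ smooth ($h$ is the Hopf invariant relative to $z$). The umbilic points of $\mathbf{x}$ are exactly the zeros of $II^{2,0}$, i.e. the zeros of $h$; $\mathcal{D}$ denotes the set of umbilic points. The function $\Delta g$. If $(U,z)$ is a complex chart in $M\setminus\mathcal{D}$, then $e^{2u}h$ is nowhere zero on $U$ and can be written $e^{2u}h=e^{G+ig}$ with $G:U\to\mathbb{R}$ smooth and $e^{ig}:U\to\mathbf{S}^1$ smooth; $g$ is a real-valued smooth function defined locally up to adding an integer multiple of $2\pi$. Let $\Delta=4e^{-2u}\frac{\partial^2}{\partial z\,\partial\bar z}$ be the Laplace–Beltrami operator of $(M,I)$. The function $\Delta g$ does not depend on the choice of local complex coordinate $z$ nor on the local choice of $g$, hence is a globally defined smooth function on $M\setminus\mathcal{D}$. Isothermic / totally nonisothermic. An umbilic free immersion of an oriented connected surface $N$ into $\mathbb{R}^3$ is isothermic if $\Delta g=0$ identically on $N$ (equivalently, $N$ has an atlas of charts $(U,(x,y))$ in each of which $I=e^{2u}(dx^2+dy^2)$ and $II=e^{u}(a\,dx^2+c\,dy^2)$ for some functions $a,c$). It is totally nonisothermic if $\Delta g\neq 0$ on a connected, open, dense subset of $N$. Here these are applied with $N=M\setminus\mathcal{D}$. Bonnet mate. Two immersions $\mathbf{x},\tilde{\mathbf{x}}:M\to\mathbb{R}^3$ are congruent if $\tilde{\mathbf{x}}=\mathbf{y}+A\mathbf{x}$ for some rigid motion $(\mathbf{y},A)$ of $\mathbb{R}^3$.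 A Bonnet mate of $\mathbf{x}$ is a smooth immersion $\tilde{\mathbf{x}}:M\to\mathbb{R}^3$ that is not congruent to $\mathbf{x}$ and has the same induced metric, $\tilde I=I$, and the same mean curvature, $\tilde H=H$, on $M$ (the mean curvatures being taken with respect to the unit normals inducing the fixed orientation of $M$). *)

theory Defs
  imports "HOL-Analysis.Analysis"
begin

section \<open>Smooth functions\<close>

text \<open>Meant for open \<open>S\<close> and a finite-dimensional domain.\<close>

primrec Ck_on ::
  "nat \<Rightarrow> 'a::real_normed_vector set \<Rightarrow> ('a \<Rightarrow> 'b::real_normed_vector) \<Rightarrow> bool" where
  "Ck_on 0 S f \<longleftrightarrow> continuous_on S f"
| "Ck_on (Suc k) S f \<longleftrightarrow>
     f differentiable_on S \<and> (\<forall>v. Ck_on k S (\<lambda>x. frechet_derivative f (at x) v))"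

definition smooth_on :: "'a::real_normed_vector set \<Rightarrow> ('a \<Rightarrow> 'b::real_normed_vector) \<Rightarrow> bool" where
  "smooth_on S f \<longleftrightarrow> (\<forall>k. Ck_on k S f)"

definition pdx :: "(complex \<Rightarrow> 'b::real_normed_vector) \<Rightarrow> complex \<Rightarrow> 'b" where
  "pdx f w = frechet_derivative f (at w) 1"

definition pdy :: "(complex \<Rightarrow> 'b::real_normed_vector) \<Rightarrow> complex \<Rightarrow> 'b" where
  "pdy f w = frechet_derivative f (at w) \<i>"


section \<open>Oriented smooth surfaces\<close>

text \<open>
  The surface is the whole type \<open>'a\<close>. Coordinates take values in the complex plane, regarded as
  the oriented real plane with positive basis \<open>(1, \<i>)\<close>; no holomorphy is implied.
  A chart is a pair (domain, coordinate map); the map is arbitrary outside the domain.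
\<close>

type_synonym 'a chart = "'a set \<times> ('a \<Rightarrow> complex)"

definition coord_chart :: "'a::topological_space chart \<Rightarrow> bool" where
  "coord_chart c \<longleftrightarrow> open (fst c) \<and> open (snd c ` fst c) \<and>
     homeomorphism (fst c) (snd c ` fst c) (snd c) (inv_into (fst c) (snd c))"

definition local_rep :: "'a chart \<Rightarrow> ('a \<Rightarrow> 'b) \<Rightarrow> complex \<Rightarrow> 'b" where
  "local_rep c f = f \<circ> inv_into (fst c) (snd c)"

definition oriented_transition :: "'a chart \<Rightarrow> 'a chart \<Rightarrow> bool" where
  "oriented_transition c d \<longleftrightarrow>
     (let S = snd c ` (fst c \<inter> fst d); \<tau> = local_rep c (snd d) in
        smooth_on S \<tau> \<and>
        (\<forall>w\<in>S. 0 < Re (pdx \<tau> w) * Im (pdy \<tau> w) - Im (pdx \<tau> w) * Re (pdy \<tau> w)))"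

definition oriented_smooth_atlas :: "'a::topological_space chart set \<Rightarrow> bool" where
  "oriented_smooth_atlas A \<longleftrightarrow>
     (\<Union>c\<in>A. fst c) = UNIV \<and> (\<forall>c\<in>A. coord_chart c) \<and>
     (\<forall>c\<in>A. \<forall>d\<in>A. oriented_transition c d)"

text \<open>Charts of the maximal oriented atlas generated by \<open>A\<close>.\<close>

definition compatible_chart :: "'a::topological_space chart set \<Rightarrow> 'a chart \<Rightarrow> bool" where
  "compatible_chart A c \<longleftrightarrow>
     coord_chart c \<and> (\<forall>d\<in>A. oriented_transition c d \<and> oriented_transition d c)"

text \<open>
  An arbitrary chart of \<open>A\<close> around \<open>p\<close>; used only for quantities that do not
  depend on the chart.
\<close>

definition chart_at :: "'a chart set \<Rightarrow> 'a \<Rightarrow> 'a chart" where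
  "chart_at A p = (SOME c. c \<in> A \<and> p \<in> fst c)"

definition smooth_immersion :: "'a chart set \<Rightarrow> ('a \<Rightarrow> real^3) \<Rightarrow> bool" where
  "smooth_immersion A x \<longleftrightarrow>
     (\<forall>c\<in>A. smooth_on (snd c ` fst c) (local_rep c x) \<and>
        (\<forall>w \<in> snd c ` fst c. inj (frechet_derivative (local_rep c x) (at w))))"

definition differential_nonzero :: "'a chart set \<Rightarrow> ('a \<Rightarrow> real) \<Rightarrow> 'a \<Rightarrow> bool" where
  "differential_nonzero A f p \<longleftrightarrow>
     (let c = chart_at A p in
        frechet_derivative (local_rep c f) (at (snd c p)) \<noteq> (\<lambda>v. 0))"


section \<open>Fundamental forms, in a positively oriented parametrization \<open>X\<close>\<close>

definition unit_normal :: "(complex \<Rightarrow> real^3) \<Rightarrow> complex \<Rightarrow> real^3" where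
  "unit_normal X w = sgn (cross3 (pdx X w) (pdy X w))"

definition first_form :: "(complex \<Rightarrow> real^3) \<Rightarrow> complex \<Rightarrow> complex \<Rightarrow> complex \<Rightarrow> real" where
  "first_form X w a b = frechet_derivative X (at w) a \<bullet> frechet_derivative X (at w) b"

definition second_form :: "(complex \<Rightarrow> real^3) \<Rightarrow> complex \<Rightarrow> complex \<Rightarrow> complex \<Rightarrow> real" where
  "second_form X w a b =
     - (frechet_derivative (unit_normal X) (at w) a \<bullet> frechet_derivative X (at w) b)"

text \<open>Half the trace of the second fundamental form with respect to the first.\<close>

definition local_mean_curvature :: "(complex \<Rightarrow> real^3) \<Rightarrow> complex \<Rightarrow> real" where
  "local_mean_curvature X w =
     (let E = first_form X w 1 1; F = first_form X w 1 \<i>; G = first_form X w \<i> \<i>;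
          L = second_form X w 1 1; M = second_form X w 1 \<i>; N = second_form X w \<i> \<i>
      in (E * N - 2 * F * M + G * L) / (2 * (E * G - F\<^sup>2)))"

definition mean_curvature :: "'a chart set \<Rightarrow> ('a \<Rightarrow> real^3) \<Rightarrow> 'a \<Rightarrow> real" where
  "mean_curvature A x p =
     (let c = chart_at A p in local_mean_curvature (local_rep c x) (snd c p))"

text \<open>
  \<open>p\<close> is umbilic when \<open>II = H I\<close> at \<open>p\<close>, i.e. when the trace-free part
  \<open>II\<^sup>2\<^sup>,\<^sup>0 + II\<^sup>0\<^sup>,\<^sup>2\<close> of \<open>II\<close> vanishes there.
\<close>

definition umbilics :: "'a chart set \<Rightarrow> ('a \<Rightarrow> real^3) \<Rightarrow> 'a set" where
  "umbilics A x =
     {p. let c = chart_at A p; X = local_rep c x; w = snd c p in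
           \<forall>a b. second_form X w a b = local_mean_curvature X w * first_form X w a b}"


section \<open>Complex charts, Hopf invariant, and the function \<open>\<Delta>g\<close>\<close>

text \<open>
  \<open>I = e\<^sup>2\<^sup>u (dx\<^sup>2 + dy\<^sup>2)\<close> in the chart \<open>c\<close>. The inner product of complex numbers
  is the standard one of the real plane.
\<close>

definition complex_chart ::
  "'a::topological_space chart set \<Rightarrow> ('a \<Rightarrow> real^3) \<Rightarrow> 'a chart \<Rightarrow> (complex \<Rightarrow> real) \<Rightarrow> bool" where
  "complex_chart A x c u \<longleftrightarrow>
     compatible_chart A c \<and> smooth_on (snd c ` fst c) u \<and>
     (\<forall>w \<in> snd c ` fst c. \<forall>a b. first_form (local_rep c x) w a b = exp (2 * u w) * (a \<bullet> b))"

text \<open>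
  The coefficient of \<open>II\<^sup>2\<^sup>,\<^sup>0\<close> is the complex bilinear extension of \<open>II\<close> evaluated at
  \<open>(\<partial>\<^sub>z, \<partial>\<^sub>z)\<close> with \<open>\<partial>\<^sub>z = (\<partial>\<^sub>x - \<i> \<partial>\<^sub>y) / 2\<close>, and \<open>h\<close> is given by
  \<open>II\<^sup>2\<^sup>,\<^sup>0 = (1/2) h e\<^sup>2\<^sup>u dz dz\<close>.
\<close>

definition hopf_coeff :: "(complex \<Rightarrow> real^3) \<Rightarrow> complex \<Rightarrow> complex" where
  "hopf_coeff X w =
     (of_real (second_form X w 1 1) - of_real (second_form X w \<i> \<i>)
        - 2 * \<i> * of_real (second_form X w 1 \<i>)) / 4"

definition hopf_invariant :: "(complex \<Rightarrow> real^3) \<Rightarrow> (complex \<Rightarrow> real) \<Rightarrow> complex \<Rightarrow> complex" where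
  "hopf_invariant X u w = 2 * hopf_coeff X w / of_real (exp (2 * u w))"

text \<open>
  The operator \<open>4 e\<^sup>-\<^sup>2\<^sup>u \<partial>\<^sup>2 / (\<partial>z \<partial>z*)\<close>, where \<open>z*\<close> is the conjugate coordinate,
  using \<open>4 \<partial>\<^sup>2 / (\<partial>z \<partial>z*) = \<partial>\<^sup>2/\<partial>x\<^sup>2 + \<partial>\<^sup>2/\<partial>y\<^sup>2\<close>.
\<close>

definition laplace_beltrami :: "(complex \<Rightarrow> real) \<Rightarrow> (complex \<Rightarrow> real) \<Rightarrow> complex \<Rightarrow> real" where
  "laplace_beltrami u f w = exp (- 2 * u w) * (pdx (pdx f) w + pdy (pdy f) w)"

text \<open>
  \<open>f\<close> is the function \<open>\<Delta>g\<close> on the umbilic free open set \<open>N\<close>: its value at each point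
  is computed in some complex chart on which a smooth logarithm \<open>G + \<i> g\<close> of \<open>e\<^sup>2\<^sup>u h\<close>
  exists. The value does not depend on that choice, and such charts exist around every
  point of \<open>N\<close> (isothermal coordinates), so \<open>f\<close> exists and is unique on \<open>N\<close>.
\<close>

definition is_Delta_g ::
  "'a::topological_space chart set \<Rightarrow> ('a \<Rightarrow> real^3) \<Rightarrow> 'a set \<Rightarrow> ('a \<Rightarrow> real) \<Rightarrow> bool" where
  "is_Delta_g A x N f \<longleftrightarrow>
     (\<forall>p\<in>N. \<exists>U z u G g.
        complex_chart A x (U, z) u \<and> p \<in> U \<and> U \<subseteq> N \<and>
        smooth_on (z ` U) G \<and> smooth_on (z ` U) g \<and>
        (\<forall>w \<in> z ` U. of_real (exp (2 * u w)) * hopf_invariant (local_rep (U, z) x) u w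
                       = exp (of_real (G w) + \<i> * of_real (g w))) \<and>
        f p = laplace_beltrami u g (z p))"

definition isothermic_on ::
  "'a::topological_space chart set \<Rightarrow> ('a \<Rightarrow> real^3) \<Rightarrow> 'a set \<Rightarrow> bool" where
  "isothermic_on A x N \<longleftrightarrow> (\<exists>f. is_Delta_g A x N f \<and> (\<forall>p\<in>N. f p = 0))"

definition totally_nonisothermic_on ::
  "'a::topological_space chart set \<Rightarrow> ('a \<Rightarrow> real^3) \<Rightarrow> 'a set \<Rightarrow> bool" where
  "totally_nonisothermic_on A x N \<longleftrightarrow>
     (\<exists>f. is_Delta_g A x N f \<and>
        (\<exists>W. W \<subseteq> N \<and> connected W \<and> openin (top_of_set N) W \<and> N \<subseteq> closure W \<and>
             (\<forall>p\<in>W. f p \<noteq> 0)))"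


section \<open>Bonnet mates\<close>

text \<open>
  Rigid motions are taken orientation preserving. Admitting reflections would change nothing
  for surfaces with \<open>H\<close> not identically zero, since a reflection reverses the sign of \<open>H\<close>.
\<close>

definition congruent_immersions :: "('a \<Rightarrow> real^3) \<Rightarrow> ('a \<Rightarrow> real^3) \<Rightarrow> bool" where
  "congruent_immersions x x' \<longleftrightarrow>
     (\<exists>y (R :: real^3^3). rotation_matrix R \<and> (\<forall>p. x' p = y + R *v x p))"

definition same_induced_metric ::
  "'a chart set \<Rightarrow> ('a \<Rightarrow> real^3) \<Rightarrow> ('a \<Rightarrow> real^3) \<Rightarrow> bool" where
  "same_induced_metric A x x' \<longleftrightarrow>
     (\<forall>c\<in>A. \<forall>w \<in> snd c ` fst c. \<forall>a b.
        first_form (local_rep c x') w a b = first_form (local_rep c x) w a b)"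

definition bonnet_mate :: "'a chart set \<Rightarrow> ('a \<Rightarrow> real^3) \<Rightarrow> ('a \<Rightarrow> real^3) \<Rightarrow> bool" where
  "bonnet_mate A x x' \<longleftrightarrow>
     smooth_immersion A x' \<and> \<not> congruent_immersions x x' \<and>
     same_induced_metric A x x' \<and> (\<forall>p. mean_curvature A x' p = mean_curvature A x p)"

end

theory Submission
  imports Defs "HOL-Complex_Analysis.Complex_Analysis"
begin

text \<open>
  Let \<open>x'\<close> be a mate of \<open>x\<close>, and put \<open>k = e\<^sup>2\<^sup>u h\<close> and likewise \<open>k'\<close> for \<open>x'\<close>, in a complex chart.
  By the Gauss equation \<open>|k'| = |k|\<close>, and by the Codazzi equation \<open>F = k' - k\<close> is holomorphic.
  A zero of \<open>F\<close> where \<open>k\<close> does not vanish is not isolated, because \<open>F\<close> takes all directions near an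
  isolated zero whereas \<open>|k + F| = |k|\<close>. So on the connected set \<open>N\<close> of nonumbilic points either
  \<open>F = 0\<close> everywhere, and then the surfaces are congruent, or \<open>k' = e\<^sup>i\<^sup>r k\<close> with a smooth global \<open>r\<close>
  between \<open>0\<close> and \<open>2 \<pi>\<close>. Then \<open>\<theta> = (\<pi> - r) / 2\<close> satisfies \<open>\<Delta>\<theta> = \<Delta>g\<close>, since \<open>g - \<theta>\<close> is up to a constant
  the argument of \<open>F\<close>. In both parts of the theorem \<open>\<Delta>g\<close> does not change sign, so \<open>\<theta>\<close> or \<open>- \<theta>\<close> is a
  bounded subharmonic function on \<open>N\<close>, hence constant. But then \<open>k\<close> is a constant multiple of \<open>F\<close>,
  thus holomorphic, and the Codazzi equation gives \<open>dH = 0\<close>.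

  Existence of isothermal coordinates at umbilic points is never used: \<open>\<theta>\<close> is dominated near an
  umbilic point \<open>p\<close> by means of the barrier \<open>ln |x - x(p)|\<close>, which involves only the ambient distance.
\<close>

section \<open>Calculus on open subsets of the plane\<close>

text \<open>The relation |k + F| = |k| says exactly that k / F has real part - 1 / 2. Its imaginary
  part then carries all the information: k / F = - (1 + i T) / 2 with T = cot (r / 2). As a quotient
  of coefficients of two quadratic differentials, T is a function on the surface, so arctan T is
  global and lies between - \<pi> / 2 and \<pi> / 2 without any lifting of r.

  The obstacle is global. Complex charts are available around nonumbilic points, where the
  hypothesis that computes \<Delta>g supplies them; at an umbilic point neither \<theta> nor its
  Laplacian can be examined. Boundedness has to replace smoothness there: a small multiple of a
  function with a logarithmic pole keeps a supremum from hiding at a puncture, and compactness of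
  the whole surface then makes it attained in \<open>N\<close>. Such a pole has to be found without
  isothermal coordinates, which is why distances in the ambient space are used.

  In part (2) it is connectedness of the dense set that prevents \<Delta>g from taking both signs;
  in part (1) \<theta> is harmonic.\<close>

definition has_pd ::
  "(complex \<Rightarrow> 'b::real_normed_vector) \<Rightarrow> 'b \<Rightarrow> 'b \<Rightarrow> complex \<Rightarrow> bool" where
  "has_pd f a b w \<longleftrightarrow> (f has_derivative (\<lambda>v. Re v *\<^sub>R a + Im v *\<^sub>R b)) (at w)"

lemma has_pd_frechet:
  assumes "has_pd f a b w"
  shows "frechet_derivative f (at w) v = Re v *\<^sub>R a + Im v *\<^sub>R b"
  using frechet_derivative_at[OF assms[unfolded has_pd_def]] by metis

lemma has_pd_pdx: "has_pd f a b w \<Longrightarrow> pdx f w = a"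
  and has_pd_pdy: "has_pd f a b w \<Longrightarrow> pdy f w = b"
  by (simp_all add: pdx_def pdy_def has_pd_frechet)

lemma has_pd_differentiable: "has_pd f a b w \<Longrightarrow> f differentiable at w"
  unfolding has_pd_def differentiable_def by blast

lemma has_pd_isCont: "has_pd f a b w \<Longrightarrow> isCont f w"
  using has_pd_differentiable differentiable_imp_continuous_within by blast

abbreviation jacobian :: "(complex \<Rightarrow> complex) \<Rightarrow> complex \<Rightarrow> real" where
  "jacobian \<tau> w \<equiv> Re (pdx \<tau> w) * Im (pdy \<tau> w) - Im (pdx \<tau> w) * Re (pdy \<tau> w)"

lemma linear_complex_expand:
  assumes "linear (L :: complex \<Rightarrow> 'b::real_normed_vector)"
  shows "L v = Re v *\<^sub>R L 1 + Im v *\<^sub>R L \<i>"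
proof -
  have "v = Re v *\<^sub>R 1 + Im v *\<^sub>R \<i>"
    by (simp add: complex_eq_iff)
  then have "L v = L (Re v *\<^sub>R 1 + Im v *\<^sub>R \<i>)" by simp
  then show ?thesis by (simp add: linear_add[OF assms] linear_scale[OF assms])
qed

lemma has_derivative_has_pd:
  assumes "(f has_derivative L) (at w)"
  shows "has_pd f (L 1) (L \<i>) w"
proof -
  have "L = (\<lambda>v. Re v *\<^sub>R L 1 + Im v *\<^sub>R L \<i>)"
    by (rule ext) (rule linear_complex_expand[OF has_derivative_linear[OF assms]])
  with assms show ?thesis unfolding has_pd_def by simp
qed

lemma differentiable_has_pd:
  assumes "f differentiable at w"
  shows "has_pd f (pdx f w) (pdy f w) w"
  using has_derivative_has_pd[OF assms[unfolded frechet_derivative_works]]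
  by (simp add: pdx_def pdy_def)

lemma frechet_pd:
  assumes "f differentiable at w"
  shows "frechet_derivative f (at w) v = Re v *\<^sub>R pdx f w + Im v *\<^sub>R pdy f w"
  by (rule has_pd_frechet[OF differentiable_has_pd[OF assms]])

lemma has_pd_cong_open:
  assumes "has_pd f a b w" "open S" "w \<in> S" "\<And>z. z \<in> S \<Longrightarrow> f z = g z"
  shows "has_pd g a b w"
  using assms unfolding has_pd_def
  by (rule_tac has_derivative_transform_within_open[of f _ w UNIV S g]) auto

lemma has_pd_eq: "has_pd f a b w \<Longrightarrow> a = a' \<Longrightarrow> b = b' \<Longrightarrow> has_pd f a' b' w"
  by simp

lemma has_pd_const [intro]: "has_pd (\<lambda>z. c) 0 0 w"
  by (simp add: has_pd_def)

lemma has_pd_add: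
  "has_pd f a b w \<Longrightarrow> has_pd g c d w \<Longrightarrow> has_pd (\<lambda>z. f z + g z) (a + c) (b + d) w"
  unfolding has_pd_def
  by (drule (1) has_derivative_add) (simp add: algebra_simps)

lemma has_pd_bounded_linear:
  assumes "bounded_linear T" "has_pd f a b w"
  shows "has_pd (\<lambda>z. T (f z)) (T a) (T b) w"
  using bounded_linear.has_derivative[OF assms(1) assms(2)[unfolded has_pd_def]]
  unfolding has_pd_def
  by (simp add: linear_add[OF bounded_linear.linear[OF assms(1)]]
      linear_scale[OF bounded_linear.linear[OF assms(1)]])

lemmas has_pd_cmult = has_pd_bounded_linear[OF bounded_linear_mult_right]

lemma has_pd_minus: "has_pd f a b w \<Longrightarrow> has_pd (\<lambda>z. - f z) (- a) (- b) w"
  by (rule has_pd_bounded_linear[OF bounded_linear_minus[OF bounded_linear_ident]])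

lemma has_pd_diff:
  "has_pd f a b w \<Longrightarrow> has_pd g c d w \<Longrightarrow> has_pd (\<lambda>z. f z - g z) (a - c) (b - d) w"
  using has_pd_add[OF _ has_pd_minus, of f a b w g c d] by simp

lemma has_pd_bilinear:
  assumes "bounded_bilinear p" "has_pd f a b w" "has_pd g c d w"
  shows "has_pd (\<lambda>z. p (f z) (g z)) (p a (g w) + p (f w) c) (p b (g w) + p (f w) d) w"
proof -
  interpret bounded_bilinear p by fact
  show ?thesis
    using FDERIV[OF assms(2,3)[unfolded has_pd_def]]
    unfolding has_pd_def
    by (simp add: add_left add_right scaleR_left scaleR_right algebra_simps)
qed

lemmas has_pd_inner = has_pd_bilinear[OF bounded_bilinear_inner]
lemmas has_pd_mult = has_pd_bilinear[OF bounded_bilinear_mult]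
lemmas has_pd_scaleR = has_pd_bilinear[OF bounded_bilinear_scaleR]

lemma has_pd_DERIV:
  fixes f :: "complex \<Rightarrow> real"
  assumes "has_pd f a b w" "(\<phi> has_real_derivative D) (at (f w))"
  shows "has_pd (\<lambda>z. \<phi> (f z)) (D * a) (D * b) w"
  using has_derivative_compose[OF assms(1)[unfolded has_pd_def]
      assms(2)[unfolded has_field_derivative_def]]
  unfolding has_pd_def by (simp add: algebra_simps)

lemma has_pd_exp: "has_pd f a b w \<Longrightarrow> has_pd (\<lambda>z. exp (f z :: real)) (exp (f w) * a) (exp (f w) * b) w"
  by (rule has_pd_DERIV) (auto intro: DERIV_exp)

lemma has_pd_compose:
  assumes "has_pd \<tau> a b w" "f differentiable at (\<tau> w)"
  shows "has_pd (\<lambda>z. f (\<tau> z))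
    (Re a *\<^sub>R pdx f (\<tau> w) + Im a *\<^sub>R pdy f (\<tau> w)) (Re b *\<^sub>R pdx f (\<tau> w) + Im b *\<^sub>R pdy f (\<tau> w)) w"
  using has_derivative_has_pd[OF has_derivative_compose[OF assms(1)[unfolded has_pd_def]
      assms(2)[unfolded frechet_derivative_works]]] assms(2)
  by (simp add: frechet_pd)


subsection \<open>Functions of class \<open>C\<^sup>k\<close>\<close>

lemma Ck_on_cong:
  assumes "open S" "\<And>w. w \<in> S \<Longrightarrow> f w = g w" "Ck_on k S f"
  shows "Ck_on k S g"
  using assms(2,3)
proof (induction k arbitrary: f g)
  case 0
  then show ?case using continuous_on_cong[of S S f g] by simp
next
  case (Suc k)
  have D: "g differentiable at w \<and> frechet_derivative f (at w) = frechet_derivative g (at w)"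
    if w: "w \<in> S" for w
  proof -
    have "f differentiable at w"
      using Suc.prems(2) w \<open>open S\<close> by (simp add: differentiable_on_eq_differentiable_at)
    then have "(f has_derivative frechet_derivative f (at w)) (at w)"
      by (simp add: frechet_derivative_works)
    then have "(g has_derivative frechet_derivative f (at w)) (at w)"
      by (rule has_derivative_transform_within_open[OF _ \<open>open S\<close> w]) (use Suc.prems(1) in auto)
    then show ?thesis
      using frechet_derivative_at differentiable_def by metis
  qed
  have "Ck_on k S (\<lambda>x. frechet_derivative g (at x) v)" for v
    by (rule Suc.IH[of "\<lambda>x. frechet_derivative f (at x) v"]) (use D Suc.prems(2) in auto)
  then show ?case
    using D \<open>open S\<close> by (simp add: differentiable_on_eq_differentiable_at)
qed

lemma Ck_on_Suc_imp: "Ck_on (Suc k) S f \<Longrightarrow> Ck_on k S f"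
proof (induction k arbitrary: f)
  case 0
  then show ?case by (simp add: differentiable_imp_continuous_on)
next
  case (Suc k)
  have "f differentiable_on S" using Suc.prems by simp
  moreover have "Ck_on k S (\<lambda>x. frechet_derivative f (at x) v)" for v
    by (rule Suc.IH) (use Suc.prems in auto)
  ultimately show ?case by simp
qed

lemma Ck_on_differentiable:
  "open S \<Longrightarrow> Ck_on (Suc k) S f \<Longrightarrow> w \<in> S \<Longrightarrow> f differentiable at w"
  by (simp add: differentiable_on_eq_differentiable_at)

lemma Ck_on_bounded_linear:
  assumes "open S" "bounded_linear T" "Ck_on k S f"
  shows "Ck_on k S (\<lambda>x. T (f x))"
  using assms(3)
proof (induction k arbitrary: f)
  case 0
  then show ?case using bounded_linear.continuous_on[OF assms(2)] by simp
next
  case (Suc k)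
  have D: "((\<lambda>x. T (f x)) has_derivative (\<lambda>v. T (frechet_derivative f (at w) v))) (at w)"
    if "w \<in> S" for w
    using Ck_on_differentiable[OF assms(1) Suc.prems that]
    by (intro bounded_linear.has_derivative[OF assms(2)]) (simp add: frechet_derivative_works)
  have "Ck_on k S (\<lambda>x. frechet_derivative (\<lambda>x. T (f x)) (at x) v)" for v
  proof (rule Ck_on_cong[OF assms(1)])
    show "Ck_on k S (\<lambda>x. T (frechet_derivative f (at x) v))"
      using Suc.prems by (intro Suc.IH) auto
  qed (use frechet_derivative_at[OF D, symmetric] in auto)
  then show ?case
    using D assms(1) by (auto simp: differentiable_on_eq_differentiable_at differentiable_def)
qed

lemma Ck_on_add:
  assumes "open S" "Ck_on k S f" "Ck_on k S g"
  shows "Ck_on k S (\<lambda>x. f x + g x)"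
  using assms(2,3)
proof (induction k arbitrary: f g)
  case 0
  then show ?case by (simp add: continuous_on_add)
next
  case (Suc k)
  have D: "((\<lambda>x. f x + g x) has_derivative
      (\<lambda>v. frechet_derivative f (at w) v + frechet_derivative g (at w) v)) (at w)"
    if "w \<in> S" for w
    using Ck_on_differentiable[OF assms(1) Suc.prems(1) that]
      Ck_on_differentiable[OF assms(1) Suc.prems(2) that]
    by (intro has_derivative_add) (simp_all add: frechet_derivative_works)
  have "Ck_on k S (\<lambda>x. frechet_derivative (\<lambda>x. f x + g x) (at x) v)" for v
  proof (rule Ck_on_cong[OF assms(1)])
    show "Ck_on k S (\<lambda>x. frechet_derivative f (at x) v + frechet_derivative g (at x) v)"
      using Suc.prems by (intro Suc.IH) auto
  qed (use frechet_derivative_at[OF D, symmetric] in auto)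
  then show ?case
    using D assms(1) by (auto simp: differentiable_on_eq_differentiable_at differentiable_def)
qed

lemma Ck_on_bilinear:
  assumes "open S" "bounded_bilinear p" "Ck_on k S f" "Ck_on k S g"
  shows "Ck_on k S (\<lambda>x. p (f x) (g x))"
  using assms(3,4)
proof (induction k arbitrary: f g)
  case 0
  then show ?case using bounded_bilinear.continuous_on[OF assms(2)] by simp
next
  case (Suc k)
  have D: "((\<lambda>x. p (f x) (g x)) has_derivative
      (\<lambda>v. p (f w) (frechet_derivative g (at w) v) + p (frechet_derivative f (at w) v) (g w))) (at w)"
    if "w \<in> S" for w
    using Ck_on_differentiable[OF assms(1) Suc.prems(1) that]
      Ck_on_differentiable[OF assms(1) Suc.prems(2) that]
    by (intro bounded_bilinear.FDERIV[OF assms(2)]) (simp_all add: frechet_derivative_works)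
  have "Ck_on k S (\<lambda>x. frechet_derivative (\<lambda>x. p (f x) (g x)) (at x) v)" for v
  proof (rule Ck_on_cong[OF assms(1) _ Ck_on_add[OF assms(1)]])
    show "Ck_on k S (\<lambda>x. p (f x) (frechet_derivative g (at x) v))"
      using Suc.prems by (intro Suc.IH) (auto dest: Ck_on_Suc_imp simp del: Ck_on.simps, auto)
    show "Ck_on k S (\<lambda>x. p (frechet_derivative f (at x) v) (g x))"
      using Suc.prems by (intro Suc.IH) (auto dest: Ck_on_Suc_imp simp del: Ck_on.simps, auto)
  qed (use frechet_derivative_at[OF D, symmetric] in auto)
  then show ?case
    using D assms(1) by (auto simp: differentiable_on_eq_differentiable_at differentiable_def)
qed

text \<open>Every directional derivative is a real combination of the two partial ones, so in the
  plane the quantifier over directions in \<open>Ck_on\<close> reduces to two functions.\<close>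

lemma Ck_on_Suc_pd:
  fixes f :: "complex \<Rightarrow> 'b::real_normed_vector"
  assumes "open S"
  shows "Ck_on (Suc k) S f \<longleftrightarrow> f differentiable_on S \<and> Ck_on k S (pdx f) \<and> Ck_on k S (pdy f)"
proof
  assume "Ck_on (Suc k) S f"
  then show "f differentiable_on S \<and> Ck_on k S (pdx f) \<and> Ck_on k S (pdy f)"
    by (auto simp: pdx_def[abs_def] pdy_def[abs_def])
next
  assume R: "f differentiable_on S \<and> Ck_on k S (pdx f) \<and> Ck_on k S (pdy f)"
  have "Ck_on k S (\<lambda>x. frechet_derivative f (at x) v)" for v
    by (rule Ck_on_cong[OF assms _ Ck_on_add[OF assms
          Ck_on_bounded_linear[OF assms bounded_linear_scaleR_right, of k "pdx f" "Re v"]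
          Ck_on_bounded_linear[OF assms bounded_linear_scaleR_right, of k "pdy f" "Im v"]]])
      (use R assms in \<open>auto simp: frechet_pd differentiable_on_eq_differentiable_at\<close>)
  with R show "Ck_on (Suc k) S f" by simp
qed

text \<open>The partial derivatives of the composite are combinations of \<open>pdx f\<close> and
  \<open>pdy f\<close> composed with \<open>\<tau>\<close>, to which the induction hypothesis
  applies because \<open>f\<close> is arbitrary there; the coefficients are derivatives of
  \<open>\<tau>\<close>.\<close>

lemma Ck_on_compose:
  fixes f :: "complex \<Rightarrow> 'b::real_normed_vector" and \<tau> :: "complex \<Rightarrow> complex"
  assumes "open S" "open T" "\<tau> ` S \<subseteq> T" "Ck_on k T f" "Ck_on k S \<tau>"
  shows "Ck_on k S (\<lambda>z. f (\<tau> z))"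
  using assms(4,5)
proof (induction k arbitrary: f)
  case 0
  then show ?case
    using continuous_on_compose2[of T f S \<tau>] assms(3) by simp
next
  case (Suc k)
  have f: "f differentiable at (\<tau> w)" if "w \<in> S" for w
    using Ck_on_differentiable[OF assms(2) Suc.prems(1)] assms(3) that by blast
  have D: "has_pd (\<lambda>z. f (\<tau> z))
     (Re (pdx \<tau> w) *\<^sub>R pdx f (\<tau> w) + Im (pdx \<tau> w) *\<^sub>R pdy f (\<tau> w))
     (Re (pdy \<tau> w) *\<^sub>R pdx f (\<tau> w) + Im (pdy \<tau> w) *\<^sub>R pdy f (\<tau> w)) w" if "w \<in> S" for w
    using Ck_on_differentiable[OF assms(1) Suc.prems(2) that] f[OF that]
    by (intro has_pd_compose differentiable_has_pd)
  have fk: "Ck_on k T (pdx f)" "Ck_on k T (pdy f)"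
    using Suc.prems(1) by (auto simp: Ck_on_Suc_pd[OF assms(2)] simp del: Ck_on.simps)
  have tk: "Ck_on k S (pdx \<tau>)" "Ck_on k S (pdy \<tau>)" "Ck_on k S \<tau>"
    using Suc.prems(2) Ck_on_Suc_imp[OF Suc.prems(2)]
    by (auto simp: Ck_on_Suc_pd[OF assms(1)] simp del: Ck_on.simps)
  have gk: "Ck_on k S (\<lambda>z. Re (a z) *\<^sub>R pdx f (\<tau> z) + Im (a z) *\<^sub>R pdy f (\<tau> z))"
    if "Ck_on k S a" for a
    by (intro Ck_on_add[OF assms(1)] Ck_on_bilinear[OF assms(1) bounded_bilinear_scaleR]
        Ck_on_bounded_linear[OF assms(1) bounded_linear_Re that]
        Ck_on_bounded_linear[OF assms(1) bounded_linear_Im that] Suc.IH fk tk)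
  have "Ck_on k S (pdx (\<lambda>z. f (\<tau> z)))"
    by (rule Ck_on_cong[OF assms(1) _ gk[OF tk(1)]]) (simp add: has_pd_pdx[OF D])
  moreover have "Ck_on k S (pdy (\<lambda>z. f (\<tau> z)))"
    by (rule Ck_on_cong[OF assms(1) _ gk[OF tk(2)]]) (simp add: has_pd_pdy[OF D])
  moreover have "(\<lambda>z. f (\<tau> z)) differentiable_on S"
    using D assms(1) by (auto simp: differentiable_on_eq_differentiable_at intro: has_pd_differentiable)
  ultimately show ?case
    by (simp add: Ck_on_Suc_pd[OF assms(1)] del: Ck_on.simps)
qed

lemma smooth_on_cong:
  "open S \<Longrightarrow> (\<And>w. w \<in> S \<Longrightarrow> f w = g w) \<Longrightarrow> smooth_on S f \<Longrightarrow> smooth_on S g"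
  unfolding smooth_on_def using Ck_on_cong by blast

lemma smooth_on_compose:
  fixes f :: "complex \<Rightarrow> 'b::real_normed_vector" and \<tau> :: "complex \<Rightarrow> complex"
  shows "open S \<Longrightarrow> open T \<Longrightarrow> \<tau> ` S \<subseteq> T \<Longrightarrow> smooth_on T f \<Longrightarrow> smooth_on S \<tau>
     \<Longrightarrow> smooth_on S (\<lambda>z. f (\<tau> z))"
  unfolding smooth_on_def using Ck_on_compose by blast

lemma smooth_on_differentiable:
  "open S \<Longrightarrow> smooth_on S f \<Longrightarrow> w \<in> S \<Longrightarrow> f differentiable at w"
  unfolding smooth_on_def using Ck_on_differentiable[of S 0 f w] by blast

lemma smooth_on_has_pd:
  "open S \<Longrightarrow> smooth_on S f \<Longrightarrow> w \<in> S \<Longrightarrow> has_pd f (pdx f w) (pdy f w) w"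
  by (intro differentiable_has_pd smooth_on_differentiable)

lemma smooth_on_pdx: "smooth_on S f \<Longrightarrow> smooth_on S (pdx f)"
  and smooth_on_pdy: "smooth_on S f \<Longrightarrow> smooth_on S (pdy f)"
  unfolding smooth_on_def pdx_def[abs_def] pdy_def[abs_def] by (metis Ck_on.simps(2))+

lemma smooth_on_continuous: "smooth_on S f \<Longrightarrow> continuous_on S f"
  unfolding smooth_on_def using Ck_on.simps(1) by blast

lemma Ck_on_subset:
  assumes "open S" "open T" "T \<subseteq> S" "Ck_on k S f"
  shows "Ck_on k T f"
  using assms(4)
  by (induction k arbitrary: f)
    (use assms(3) in \<open>auto intro: continuous_on_subset differentiable_on_subset\<close>)

lemma smooth_on_subset: "open S \<Longrightarrow> open T \<Longrightarrow> T \<subseteq> S \<Longrightarrow> smooth_on S f \<Longrightarrow> smooth_on T f"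
  unfolding smooth_on_def using Ck_on_subset by blast

lemma has_pd_ident: "has_pd (\<lambda>z. z) 1 \<i> w"
proof -
  have "(\<lambda>v. Re v *\<^sub>R 1 + Im v *\<^sub>R \<i>) = (\<lambda>v. v)"
    by (auto simp: complex_eq_iff)
  then show ?thesis by (simp add: has_pd_def)
qed

section \<open>Mean values along lines and the symmetry of second partial derivatives\<close>

lemma has_pd_line:
  fixes f :: "complex \<Rightarrow> real"
  assumes "has_pd f a b (c + s *\<^sub>R d)"
  shows "((\<lambda>s. f (c + s *\<^sub>R d)) has_real_derivative (Re d * a + Im d * b)) (at s)"
proof -
  have "((\<lambda>s. c + s *\<^sub>R d) has_derivative (\<lambda>h. h *\<^sub>R d)) (at s)"
    by (auto intro!: derivative_eq_intros)
  from has_derivative_compose[OF this assms[unfolded has_pd_def]]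
  have "((\<lambda>s. f (c + s *\<^sub>R d)) has_derivative (\<lambda>h. (Re d * a + Im d * b) * h)) (at s)"
    by (simp add: algebra_simps)
  then show ?thesis
    by (simp add: has_field_derivative_def)
qed

text \<open>The mean value theorem is applied twice to the second difference over a parallelogram,
  first along \<open>d\<close>, then along \<open>e\<close>. Exchanging \<open>d\<close> and
  \<open>e\<close> leaves the difference unchanged, which is where the symmetry of mixed derivatives
  comes from.\<close>

lemma mixed_difference_mean_value:
  fixes f :: "complex \<Rightarrow> real"
  assumes "open S" "\<And>z. z \<in> S \<Longrightarrow> f differentiable at z"
    and "\<And>z. z \<in> S \<Longrightarrow> (\<lambda>z. frechet_derivative f (at z) d) differentiable at z"
    and "0 < t" "\<And>s r. 0 \<le> s \<Longrightarrow> s \<le> t \<Longrightarrow> 0 \<le> r \<Longrightarrow> r \<le> t \<Longrightarrow> w + s *\<^sub>R d + r *\<^sub>R e \<in> S"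
  obtains s r where "0 < s" "s < t" "0 < r" "r < t"
    "f (w + t *\<^sub>R d + t *\<^sub>R e) - f (w + t *\<^sub>R d) - f (w + t *\<^sub>R e) + f w =
     t\<^sup>2 * frechet_derivative (\<lambda>z. frechet_derivative f (at z) d) (at (w + s *\<^sub>R d + r *\<^sub>R e)) e"
proof -
  define g where "g z = frechet_derivative f (at z) d" for z
  have fd: "((\<lambda>s. f (c + s *\<^sub>R d)) has_real_derivative g (c + s *\<^sub>R d)) (at s)"
    if "c + s *\<^sub>R d \<in> S" for c s
    using has_pd_line[OF differentiable_has_pd[OF assms(2)[OF that]]]
    by (simp add: g_def frechet_pd[OF assms(2)[OF that]])
  have gd: "((\<lambda>s. g (c + s *\<^sub>R e)) has_real_derivative frechet_derivative g (at (c + s *\<^sub>R e)) e) (at s)"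
    if "c + s *\<^sub>R e \<in> S" for c s
    using has_pd_line[OF differentiable_has_pd[OF assms(3)[OF that]]]
    by (simp add: g_def[abs_def] frechet_pd[OF assms(3)[OF that]])
  have "\<exists>s>0. s < t \<and>
    (f ((w + t *\<^sub>R e) + t *\<^sub>R d) - f (w + t *\<^sub>R d)) - (f ((w + t *\<^sub>R e) + 0 *\<^sub>R d) - f (w + 0 *\<^sub>R d))
      = (t - 0) * (g ((w + t *\<^sub>R e) + s *\<^sub>R d) - g (w + s *\<^sub>R d))"
  proof (rule MVT2[OF assms(4)])
    fix s assume "0 \<le> s" "s \<le> t"
    then have "(w + t *\<^sub>R e) + s *\<^sub>R d \<in> S" "w + s *\<^sub>R d \<in> S"
      using assms(5)[of s t] assms(5)[of s 0] assms(4) by (simp_all add: algebra_simps)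
    then show "((\<lambda>s. f ((w + t *\<^sub>R e) + s *\<^sub>R d) - f (w + s *\<^sub>R d)) has_real_derivative
        g ((w + t *\<^sub>R e) + s *\<^sub>R d) - g (w + s *\<^sub>R d)) (at s)"
      by (intro DERIV_diff fd)
  qed
  then obtain s where s: "0 < s" "s < t"
    "(f ((w + t *\<^sub>R e) + t *\<^sub>R d) - f (w + t *\<^sub>R d)) - (f ((w + t *\<^sub>R e) + 0 *\<^sub>R d) - f (w + 0 *\<^sub>R d))
      = (t - 0) * (g ((w + t *\<^sub>R e) + s *\<^sub>R d) - g (w + s *\<^sub>R d))"
    by blast
  have "\<exists>r>0. r < t \<and>
    g ((w + s *\<^sub>R d) + t *\<^sub>R e) - g ((w + s *\<^sub>R d) + 0 *\<^sub>R e)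
      = (t - 0) * frechet_derivative g (at ((w + s *\<^sub>R d) + r *\<^sub>R e)) e"
  proof (rule MVT2[OF assms(4)])
    fix r assume "0 \<le> r" "r \<le> t"
    then show "((\<lambda>r. g ((w + s *\<^sub>R d) + r *\<^sub>R e)) has_real_derivative
        frechet_derivative g (at ((w + s *\<^sub>R d) + r *\<^sub>R e)) e) (at r)"
      using s(1,2) by (intro gd assms(5)) auto
  qed
  then obtain r where r: "0 < r" "r < t"
    "g ((w + s *\<^sub>R d) + t *\<^sub>R e) - g ((w + s *\<^sub>R d) + 0 *\<^sub>R e)
      = (t - 0) * frechet_derivative g (at ((w + s *\<^sub>R d) + r *\<^sub>R e)) e"
    by blast
  show ?thesis
    by (rule that[OF s(1,2) r(1,2)])
      (use s(3) r(3) in \<open>simp add: algebra_simps power2_eq_square g_def[abs_def]\<close>)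
qed

lemma mixed_partials_commute_real:
  fixes f :: "complex \<Rightarrow> real"
  assumes "open S" "smooth_on S f" "w \<in> S"
  shows "pdy (pdx f) w = pdx (pdy f) w"
proof (rule ccontr)
  define g h where "g = pdy (pdx f)" and "h = pdx (pdy f)"
  assume "pdy (pdx f) w \<noteq> pdx (pdy f) w"
  then have "0 < \<bar>g w - h w\<bar> / 2" (is "0 < ?\<epsilon>") by (simp add: g_def h_def)
  have sm: "smooth_on S (pdx f)" "smooth_on S (pdy f)" "smooth_on S g" "smooth_on S h"
    using assms by (auto simp: g_def h_def intro: smooth_on_pdx smooth_on_pdy)
  have "isCont g w" "isCont h w"
    using sm assms(1,3) by (auto dest!: smooth_on_continuous simp: continuous_on_eq_continuous_at)
  then have "\<exists>\<delta>>0. \<forall>z. dist z w < \<delta> \<longrightarrow> dist (g z) (g w) < ?\<epsilon>"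
    "\<exists>\<delta>>0. \<forall>z. dist z w < \<delta> \<longrightarrow> dist (h z) (h w) < ?\<epsilon>"
    unfolding continuous_at_eps_delta using \<open>0 < ?\<epsilon>\<close> by (metis (no_types))+
  then obtain \<delta>1 \<delta>2 where \<delta>: "\<delta>1 > 0" "\<delta>2 > 0"
    "\<And>z. dist z w < \<delta>1 \<Longrightarrow> dist (g z) (g w) < ?\<epsilon>"
    "\<And>z. dist z w < \<delta>2 \<Longrightarrow> dist (h z) (h w) < ?\<epsilon>"
    by blast
  obtain \<rho> where \<rho>: "\<rho> > 0" "ball w \<rho> \<subseteq> S"
    using assms by (meson openE)
  \<comment> \<open>The intermediate points lie within 2 t of \<open>w\<close>; a third of the
    smallest radius keeps 2 t below all three radii.\<close>
  define t where "t = min \<rho> (min \<delta>1 \<delta>2) / 3"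
  have t: "0 < t" "2 * t < \<rho>" "2 * t < \<delta>1" "2 * t < \<delta>2"
    using \<rho> \<delta> by (auto simp: t_def)
  have near: "dist (w + s *\<^sub>R d + r *\<^sub>R e) w \<le> 2 * t"
    if "0 \<le> s" "s \<le> t" "0 \<le> r" "r \<le> t" "norm d = 1" "norm e = 1" for s r d e
    using norm_triangle_ineq[of "s *\<^sub>R d" "r *\<^sub>R e"] that by (simp add: dist_norm add.assoc)
  have inS: "w + s *\<^sub>R d + r *\<^sub>R e \<in> S"
    if "0 \<le> s" "s \<le> t" "0 \<le> r" "r \<le> t" "norm d = 1" "norm e = 1" for s r d e
    using near[OF that] t(2) \<rho>(2) by (auto simp: dist_commute)
  have fd: "f differentiable at z" if "z \<in> S" for z
    using smooth_on_differentiable[OF assms(1,2) that] .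
  have e1: "(\<lambda>z. frechet_derivative f (at z) 1) = pdx f" "(\<lambda>z. frechet_derivative f (at z) \<i>) = pdy f"
    by (auto simp: pdx_def pdy_def)
  obtain s r where 1: "0 < s" "s < t" "0 < r" "r < t"
    "f (w + t *\<^sub>R 1 + t *\<^sub>R \<i>) - f (w + t *\<^sub>R 1) - f (w + t *\<^sub>R \<i>) + f w = t\<^sup>2 * g (w + s *\<^sub>R 1 + r *\<^sub>R \<i>)"
    by (rule mixed_difference_mean_value[OF assms(1) fd _ t(1), of 1 w \<i>, unfolded e1])
      (use inS smooth_on_differentiable[OF assms(1) sm(1)] in \<open>auto simp: g_def pdy_def\<close>)
  obtain s' r' where 2: "0 < s'" "s' < t" "0 < r'" "r' < t"
    "f (w + t *\<^sub>R \<i> + t *\<^sub>R 1) - f (w + t *\<^sub>R \<i>) - f (w + t *\<^sub>R 1) + f w = t\<^sup>2 * h (w + s' *\<^sub>R \<i> + r' *\<^sub>R 1)"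
    by (rule mixed_difference_mean_value[OF assms(1) fd _ t(1), of \<i> w 1, unfolded e1])
      (use inS smooth_on_differentiable[OF assms(1) sm(2)] in \<open>auto simp: h_def pdx_def\<close>)
  have "t\<^sup>2 * g (w + s *\<^sub>R 1 + r *\<^sub>R \<i>) = t\<^sup>2 * h (w + s' *\<^sub>R \<i> + r' *\<^sub>R 1)"
    using 1(5) 2(5) by (simp add: algebra_simps)
  then have "g (w + s *\<^sub>R 1 + r *\<^sub>R \<i>) = h (w + s' *\<^sub>R \<i> + r' *\<^sub>R 1)"
    using t(1) by simp
  moreover have "dist (g (w + s *\<^sub>R 1 + r *\<^sub>R \<i>)) (g w) < ?\<epsilon>"
    by (rule \<delta>(3)) (use near[of s r 1 \<i>] 1 t in auto)
  moreover have "dist (h (w + s' *\<^sub>R \<i> + r' *\<^sub>R 1)) (h w) < ?\<epsilon>"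
    by (rule \<delta>(4)) (use near[of s' r' \<i> 1] 2 t in auto)
  ultimately show False
    by (auto simp: dist_real_def abs_if split: if_splits)
qed

text \<open>Pairing with an arbitrary vector reduces the claim to real-valued functions, for which
  the mean value theorem is available.\<close>

lemma mixed_partials_commute:
  fixes f :: "complex \<Rightarrow> 'b::real_inner"
  assumes "open S" "smooth_on S f" "w \<in> S"
  shows "pdy (pdx f) w = pdx (pdy f) w"
proof -
  have "pdy (pdx f) w \<bullet> v = pdx (pdy f) w \<bullet> v" for v
  proof -
    have pd: "has_pd (\<lambda>z. g z \<bullet> v) (pdx g z \<bullet> v) (pdy g z \<bullet> v) z" if "smooth_on S g" "z \<in> S" for g z
      by (rule has_pd_bounded_linear[OF bounded_linear_inner_left smooth_on_has_pd[OF assms(1) that]])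
    have fv: "smooth_on S (\<lambda>z. f z \<bullet> v)"
      using assms Ck_on_bounded_linear[OF assms(1) bounded_linear_inner_left] by (auto simp: smooth_on_def)
    have x: "has_pd (pdx (\<lambda>z. f z \<bullet> v)) (pdx (pdx f) w \<bullet> v) (pdy (pdx f) w \<bullet> v) w"
      by (rule has_pd_cong_open[OF pd[OF smooth_on_pdx[OF assms(2)] assms(3)] assms(1,3)])
        (simp add: has_pd_pdx[OF pd[OF assms(2)]])
    have y: "has_pd (pdy (\<lambda>z. f z \<bullet> v)) (pdx (pdy f) w \<bullet> v) (pdy (pdy f) w \<bullet> v) w"
      by (rule has_pd_cong_open[OF pd[OF smooth_on_pdy[OF assms(2)] assms(3)] assms(1,3)])
        (simp add: has_pd_pdy[OF pd[OF assms(2)]])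
    show ?thesis
      using mixed_partials_commute_real[OF assms(1) fv assms(3)] has_pd_pdy[OF x] has_pd_pdx[OF y]
      by simp
  qed
  then show ?thesis using vector_eq_rdot by blast
qed

lemma has_pd_zero_constant:
  fixes f :: "complex \<Rightarrow> 'b::real_normed_vector"
  assumes "convex S" "open S" "\<And>z. z \<in> S \<Longrightarrow> has_pd f 0 0 z" "z \<in> S" "w \<in> S"
  shows "f z = f w"
proof (rule has_derivative_zero_unique[OF assms(1) _ assms(4,5)])
  fix z assume "z \<in> S"
  then have "(f has_derivative (\<lambda>h. 0)) (at z)"
    using assms(3)[of z] by (simp add: has_pd_def)
  then show "(f has_derivative (\<lambda>h. 0)) (at z within S)"
    by (rule has_derivative_at_withinI)
qed


section \<open>The maximum principle\<close>

definition lap :: "(complex \<Rightarrow> real) \<Rightarrow> complex \<Rightarrow> real" where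
  "lap f w = pdx (pdx f) w + pdy (pdy f) w"

text \<open>A relational Laplacian: first partials near \<open>w\<close> that are themselves
  differentiable at \<open>w\<close>. It can be asserted of functions such as
  \<open>arctan (T z)\<close> without first proving them smooth, and it composes like a derivative
  rule.\<close>

definition has_lap :: "(complex \<Rightarrow> real) \<Rightarrow> real \<Rightarrow> complex \<Rightarrow> bool" where
  "has_lap f l w \<longleftrightarrow> (\<exists>S fx fy a b c d. open S \<and> w \<in> S \<and> (\<forall>z\<in>S. has_pd f (fx z) (fy z) z) \<and>
     has_pd fx a b w \<and> has_pd fy c d w \<and> l = a + d)"

lemma has_lapI:
  assumes "open S" "w \<in> S" "\<And>z. z \<in> S \<Longrightarrow> has_pd f (fx z) (fy z) z"
    "has_pd fx a b w" "has_pd fy c d w" "l = a + d"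
  shows "has_lap f l w"
  using assms unfolding has_lap_def by blast

lemma has_lap_unique:
  assumes "has_lap f l w"
  shows "lap f w = l"
proof -
  from assms obtain S fx fy a b c d where S: "open S" "w \<in> S"
    and f: "\<And>z. z \<in> S \<Longrightarrow> has_pd f (fx z) (fy z) z"
    and x: "has_pd fx a b w" and y: "has_pd fy c d w" and l: "l = a + d"
    unfolding has_lap_def by blast
  have "has_pd (pdx f) a b w"
    by (rule has_pd_cong_open[OF x S]) (simp add: has_pd_pdx[OF f])
  moreover have "has_pd (pdy f) c d w"
    by (rule has_pd_cong_open[OF y S]) (simp add: has_pd_pdy[OF f])
  ultimately show ?thesis
    by (simp add: lap_def l has_pd_pdx[of "pdx f"] has_pd_pdy[of "pdy f"])
qed

lemma has_lap_add:
  assumes "has_lap f l w" "has_lap g m w"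
  shows "has_lap (\<lambda>z. f z + g z) (l + m) w"
proof -
  from assms(1) obtain S fx fy a b c d where 1: "open S" "w \<in> S"
    "\<And>z. z \<in> S \<Longrightarrow> has_pd f (fx z) (fy z) z" "has_pd fx a b w" "has_pd fy c d w" "l = a + d"
    unfolding has_lap_def by blast
  from assms(2) obtain S' gx gy a' b' c' d' where 2: "open S'" "w \<in> S'"
    "\<And>z. z \<in> S' \<Longrightarrow> has_pd g (gx z) (gy z) z" "has_pd gx a' b' w" "has_pd gy c' d' w" "m = a' + d'"
    unfolding has_lap_def by blast
  show ?thesis
    by (rule has_lapI[of "S \<inter> S'" w _ "\<lambda>z. fx z + gx z" "\<lambda>z. fy z + gy z" "a + a'" "b + b'" "c + c'" "d + d'"])
      (use 1 2 in \<open>auto intro: has_pd_add\<close>)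
qed

lemma has_lap_cong:
  assumes "has_lap f l w" "open S" "w \<in> S" "\<And>z. z \<in> S \<Longrightarrow> f z = g z"
  shows "has_lap g l w"
proof -
  from assms(1) obtain T fx fy a b c d where 1: "open T" "w \<in> T"
    "\<And>z. z \<in> T \<Longrightarrow> has_pd f (fx z) (fy z) z" "has_pd fx a b w" "has_pd fy c d w" "l = a + d"
    unfolding has_lap_def by blast
  have "has_pd g (fx z) (fy z) z" if "z \<in> T \<inter> S" for z
    using has_pd_cong_open[OF 1(3)] that assms(2,4) by blast
  then show ?thesis
    by (intro has_lapI[of "T \<inter> S" w g fx fy a b c d]) (use 1 assms in auto)
qed

lemma has_lap_cmult:
  assumes "has_lap f l w"
  shows "has_lap (\<lambda>z. r * f z) (r * l) w"
proof -
  from assms(1) obtain S fx fy a b c d where 1: "open S" "w \<in> S"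
    "\<And>z. z \<in> S \<Longrightarrow> has_pd f (fx z) (fy z) z" "has_pd fx a b w" "has_pd fy c d w" "l = a + d"
    unfolding has_lap_def by blast
  show ?thesis
    by (rule has_lapI[of S w _ "\<lambda>z. r * fx z" "\<lambda>z. r * fy z" "r * a" "r * b" "r * c" "r * d"])
      (use 1 in \<open>auto intro!: has_pd_cmult simp: distrib_left\<close>)
qed

lemma has_lap_const: "has_lap (\<lambda>z. c) 0 w"
  by (rule has_lapI[of UNIV w _ "\<lambda>z. 0" "\<lambda>z. 0" 0 0 0 0]) auto

lemma has_lap_smooth:
  assumes "open S" "smooth_on S f" "w \<in> S"
  shows "has_lap f (lap f w) w"
  by (rule has_lapI[OF assms(1,3) smooth_on_has_pd[OF assms(1,2)]
        smooth_on_has_pd[OF assms(1) smooth_on_pdx[OF assms(2)] assms(3)]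
        smooth_on_has_pd[OF assms(1) smooth_on_pdy[OF assms(2)] assms(3)] lap_def])

lemma has_lap_isCont: "has_lap f l w \<Longrightarrow> isCont f w"
  unfolding has_lap_def using has_pd_isCont by blast

section \<open>Second-order conditions at a maximum and the strong maximum principle in a
  disc\<close>

lemma second_derivative_at_max_nonpos:
  fixes \<phi> \<psi> :: "real \<Rightarrow> real"
  assumes "0 < \<delta>" "\<And>s. \<bar>s\<bar> < \<delta> \<Longrightarrow> (\<phi> has_real_derivative \<psi> s) (at s)"
    and "(\<psi> has_real_derivative a) (at 0)" "\<And>s. \<bar>s\<bar> < \<delta> \<Longrightarrow> \<phi> s \<le> \<phi> 0"
  shows "a \<le> 0"
proof (rule ccontr)
  assume "\<not> a \<le> 0"
  then have "a > 0" by simp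
  have 0: "\<psi> 0 = 0"
    by (rule DERIV_local_max[OF assms(2) assms(1)]) (use assms in auto)
  obtain e where e: "e > 0" "\<And>h. 0 < h \<Longrightarrow> h < e \<Longrightarrow> \<psi> 0 < \<psi> (0 + h)"
    using DERIV_pos_inc_right[OF assms(3) \<open>a > 0\<close>] by blast
  define h where "h = min e \<delta> / 2"
  have h: "0 < h" "h < e" "h < \<delta>" using e(1) assms(1) by (auto simp: h_def)
  obtain s where s: "0 < s" "s < h" "\<phi> h - \<phi> 0 = (h - 0) * \<psi> s"
    using MVT2[of 0 h \<phi> \<psi>] h assms(2) by force
  have "\<psi> s > 0" using e(2)[of s] s h 0 by simp
  then have "0 < (h - 0) * \<psi> s" using h(1) by simp
  then show False using s(3) h assms(4)[of h] by simp
qed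

lemma has_lap_local_max:
  assumes "has_lap f l w" "open T" "w \<in> T" "\<And>z. z \<in> T \<Longrightarrow> f z \<le> f w"
  shows "l \<le> 0"
proof -
  from assms(1) obtain S fx fy a b c d where 1: "open S" "w \<in> S"
    "\<And>z. z \<in> S \<Longrightarrow> has_pd f (fx z) (fy z) z" "has_pd fx a b w" "has_pd fy c d w" "l = a + d"
    unfolding has_lap_def by blast
  obtain \<delta> where \<delta>: "\<delta> > 0" "ball w \<delta> \<subseteq> S \<inter> T"
    using 1 assms by (metis IntI open_Int openE)
  have in_ST: "w + s *\<^sub>R e \<in> S" "w + s *\<^sub>R e \<in> T" if "\<bar>s\<bar> < \<delta>" "norm e = 1" for s e
    using \<delta>(2) that by (auto simp: dist_norm subset_iff)
  have "a \<le> 0"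
  proof (rule second_derivative_at_max_nonpos[OF \<delta>(1), of "\<lambda>s. f (w + s *\<^sub>R 1)" "\<lambda>s. fx (w + s *\<^sub>R 1)"])
    fix s :: real assume s: "\<bar>s\<bar> < \<delta>"
    show "((\<lambda>s. f (w + s *\<^sub>R 1)) has_real_derivative fx (w + s *\<^sub>R 1)) (at s)"
      using has_pd_line[OF 1(3)[OF in_ST(1)[OF s, of 1]]] by simp
    show "f (w + s *\<^sub>R 1) \<le> f (w + 0 *\<^sub>R 1)"
      using assms(4)[OF in_ST(2)[OF s, of 1]] by simp
  next
    show "((\<lambda>s. fx (w + s *\<^sub>R 1)) has_real_derivative a) (at 0)"
      using has_pd_line[of fx a b w 0 1] 1(4) by simp
  qed
  moreover have "d \<le> 0"
  proof (rule second_derivative_at_max_nonpos[OF \<delta>(1), of "\<lambda>s. f (w + s *\<^sub>R \<i>)" "\<lambda>s. fy (w + s *\<^sub>R \<i>)"])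
    fix s :: real assume s: "\<bar>s\<bar> < \<delta>"
    show "((\<lambda>s. f (w + s *\<^sub>R \<i>)) has_real_derivative fy (w + s *\<^sub>R \<i>)) (at s)"
      using has_pd_line[OF 1(3)[OF in_ST(1)[OF s, of \<i>]]] by simp
    show "f (w + s *\<^sub>R \<i>) \<le> f (w + 0 *\<^sub>R \<i>)"
      using assms(4)[OF in_ST(2)[OF s, of \<i>]] by simp
  next
    show "((\<lambda>s. fy (w + s *\<^sub>R \<i>)) has_real_derivative d) (at 0)"
      using has_pd_line[of fy c d w 0 \<i>] 1(5) by simp
  qed
  ultimately show ?thesis using 1 by simp
qed

text \<open>The comparison function of Hopf's argument: its Laplacian is positive as soon as
  \<open>\<alpha>\<close> times the squared distance from \<open>y\<close> exceeds 1.\<close>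

lemma has_lap_exp_dist:
  "has_lap (\<lambda>z. exp (- \<alpha> * (norm (z - y))\<^sup>2))
     (4 * \<alpha> * (\<alpha> * (norm (w - y))\<^sup>2 - 1) * exp (- \<alpha> * (norm (w - y))\<^sup>2)) w"
proof -
  have d: "has_pd (\<lambda>z. z - y) 1 \<i> w" for w
    using has_pd_diff[OF has_pd_ident has_pd_const] by simp
  have q: "has_pd (\<lambda>z. - \<alpha> * (norm (z - y))\<^sup>2) (- 2 * \<alpha> * Re (w - y)) (- 2 * \<alpha> * Im (w - y)) w" for w
    using has_pd_cmult[OF has_pd_inner[OF d d], of "- \<alpha>" w]
    unfolding power2_norm_eq_inner
    by (rule has_pd_eq) (simp_all add: inner_complex_def)
  have re: "has_pd (\<lambda>z. - 2 * \<alpha> * Re (z - y)) (- 2 * \<alpha>) 0 w"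
    "has_pd (\<lambda>z. - 2 * \<alpha> * Im (z - y)) 0 (- 2 * \<alpha>) w"
    using has_pd_cmult[OF has_pd_bounded_linear[OF bounded_linear_Re d], of "- 2 * \<alpha>"]
      has_pd_cmult[OF has_pd_bounded_linear[OF bounded_linear_Im d], of "- 2 * \<alpha>"]
    by simp_all
  show ?thesis
    by (rule has_lapI[OF open_UNIV UNIV_I has_pd_exp[OF q]
          has_pd_mult[OF has_pd_exp[OF q] re(1)] has_pd_mult[OF has_pd_exp[OF q] re(2)]])
      (unfold cmod_power2, simp add: algebra_simps power2_eq_square)
qed

text \<open>Hopf's barrier argument at a point of contact of a ball with the set where the maximum is attained.\<close>

lemma strong_maximum_principle_disc:
  assumes "0 < R" "cball w0 R \<subseteq> S"
    and lap: "\<And>z. z \<in> S \<Longrightarrow> has_lap v (l z) z" "\<And>z. z \<in> S \<Longrightarrow> 0 \<le> l z"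
    and max: "\<And>z. z \<in> S \<Longrightarrow> v z \<le> v w0"
    and y: "y \<in> ball w0 (R / 2)"
  shows "v y = v w0"
proof (rule ccontr)
  define m where "m = v w0"
  assume "v y \<noteq> v w0"
  have cont: "continuous_on (cball w0 R) v"
    using assms(2) lap(1) has_lap_isCont
    by (meson continuous_at_imp_continuous_on subset_iff)
  define K where "K = {z \<in> cball w0 R. v z = m}"
  have "closed K"
    unfolding K_def by (rule continuous_closed_preimage_constant[OF cont closed_cball])
  have w0K: "w0 \<in> K" using assms(1) by (simp add: K_def m_def)
  obtain z0 where z0: "z0 \<in> K" "infdist y K = dist y z0"
    using infdist_attains_inf[OF \<open>closed K\<close>, of y] w0K by blast
  have yK: "y \<notin> K" using \<open>v y \<noteq> v w0\<close> by (simp add: K_def m_def)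
  define \<delta> where "\<delta> = dist y z0 / 2"
  have \<delta>0: "\<delta> > 0" using z0(1) yK by (auto simp: \<delta>_def)
  \<comment> \<open>Since \<open>y\<close> is within R / 2 of \<open>w0\<close>, a point of
    \<open>K\<close>, the ball of radius 2 \<delta> about \<open>y\<close> stays inside the large
    disc.\<close>
  have "2 * \<delta> \<le> dist y w0"
    using infdist_le[OF w0K, of y] z0(2) by (simp add: \<delta>_def)
  then have \<delta>R: "2 * \<delta> < R / 2" using y by (simp add: dist_commute)
  have below: "v z < m" if "dist y z < 2 * \<delta>" for z
  proof -
    have "z \<notin> K" using infdist_le[of z K y] z0(2) that by (auto simp: \<delta>_def)
    moreover have "z \<in> cball w0 R"
      using that \<delta>R y dist_triangle[of w0 z y] by (simp add: dist_commute)
    ultimately show ?thesis using max[of z] assms(2) by (force simp: K_def m_def)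
  qed
  \<comment> \<open>The ball about \<open>y\<close> may touch \<open>K\<close> at several points.
    The ball of half the radius about the midpoint \<open>c\<close> is internally tangent to it and
    touches \<open>K\<close> at \<open>z0\<close> only.\<close>
  define c where "c = (y + z0) /\<^sub>R 2"
  have cz0: "dist c z0 = \<delta>"
  proof -
    have "c - z0 = (y - z0) /\<^sub>R 2"
      by (simp add: c_def scaleR_conv_of_real field_simps)
    then show ?thesis by (simp add: dist_norm \<delta>_def)
  qed
  have cy: "c - y = z0 - c"
    by (simp add: c_def scaleR_conv_of_real field_simps)
  have touch: "v z < m" if "dist c z \<le> \<delta>" "z \<noteq> z0" for z
  proof (rule below, rule ccontr)
    assume "\<not> dist y z < 2 * \<delta>"
    then have "norm ((z - c) + (c - y)) \<ge> 2 * \<delta>" by (simp add: dist_norm norm_minus_commute)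
    moreover have "norm (z - c) \<le> \<delta>"
      using that by (simp add: dist_norm norm_minus_commute)
    moreover have "norm (c - y) = \<delta>"
      using cz0 unfolding cy by (simp add: dist_norm norm_minus_commute)
    \<comment> \<open>Equality in the triangle inequality makes \<open>z - c\<close> and
      \<open>c - y\<close> parallel and of the same length, which leaves only
      \<open>z = z0\<close>.\<close>
    ultimately have eq: "norm ((z - c) + (c - y)) = norm (z - c) + norm (c - y)" "norm (z - c) = \<delta>"
      using norm_triangle_ineq[of "z - c" "c - y"] by linarith+
    then have "norm (z - c) *\<^sub>R (c - y) = norm (c - y) *\<^sub>R (z - c)"
      using norm_triangle_eq[of "z - c" "c - y"] by blast
    then have "c - y = z - c" using eq(2) \<open>norm (c - y) = \<delta>\<close> \<delta>0 by simp
    then show False using cy that(2) by simp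
  qed
  have z0R: "z0 \<in> ball w0 R"
    using z0 \<delta>R y dist_triangle[of w0 z0 y] by (simp add: \<delta>_def dist_commute)
  obtain s0 where s0: "s0 > 0" "cball z0 s0 \<subseteq> ball w0 R"
    using z0R open_contains_cball[of "ball w0 R"] by blast
  \<comment> \<open>The bound \<delta> / 2 keeps the small disc about \<open>z0\<close> at distance
    at least \<delta> / 2 from \<open>c\<close>, the region where the Laplacian of \<open>E\<close>
    could be negative.\<close>
  define s where "s = min s0 (\<delta> / 2)"
  have s: "s > 0" "cball z0 s \<subseteq> ball w0 R" "s \<le> \<delta> / 2"
  proof -
    have "cball z0 s \<subseteq> cball z0 s0" by (rule subset_cball) (simp add: s_def)
    then show "cball z0 s \<subseteq> ball w0 R" using s0(2) by blast
  qed (use s0 \<delta>0 in \<open>simp_all add: s_def\<close>)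
  \<comment> \<open>On the small disc the distance from \<open>c\<close> is at least \<delta> / 2,
    so this \<open>\<alpha>\<close> makes \<open>\<alpha>\<close> times its square at least
    2.\<close>
  define \<alpha> where "\<alpha> = 8 / \<delta>\<^sup>2"
  \<comment> \<open>Normalized to vanish at distance \<delta> from \<open>c\<close>. It is negative
    beyond that distance, precisely where nothing better than \<open>v z \<le> m\<close> is
    known.\<close>
  define E where "E z = exp (- \<alpha> * (norm (z - c))\<^sup>2) - exp (- \<alpha> * \<delta>\<^sup>2)" for z
  define eE where "eE z = 4 * \<alpha> * (\<alpha> * (norm (z - c))\<^sup>2 - 1) * exp (- \<alpha> * (norm (z - c))\<^sup>2)" for z
  have lE: "has_lap E (eE z) z" for z
    using has_lap_add[OF has_lap_exp_dist[of \<alpha> c z] has_lap_const[of "- exp (- \<alpha> * \<delta>\<^sup>2)" z]]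
    by (simp add: E_def[abs_def] eE_def)
  have eEpos: "0 < eE z" if "dist z0 z \<le> s" for z
  proof -
    have "\<delta> / 2 \<le> norm (z - c)"
      using dist_triangle[of c z0 z] cz0 that s(3) by (simp add: dist_norm norm_minus_commute)
    then have "(\<delta> / 2)\<^sup>2 \<le> (norm (z - c))\<^sup>2"
      using \<delta>0 by (intro power_mono) auto
    then have "2 \<le> \<alpha> * (norm (z - c))\<^sup>2"
      using \<delta>0 by (simp add: \<alpha>_def field_simps power2_eq_square)
    then show ?thesis using \<delta>0 by (simp add: eE_def \<alpha>_def)
  qed
  \<comment> \<open>On the arc of the small circle that lies in the closed ball about
    \<open>c\<close>, \<open>v\<close> stays below \<open>m\<close> by a positive margin, by
    compactness; \<open>z0\<close> itself is not on that circle.\<close>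
  obtain \<eta> where \<eta>: "\<eta> > 0" "\<And>z. dist z0 z = s \<Longrightarrow> dist c z \<le> \<delta> \<Longrightarrow> v z \<le> m - \<eta>"
  proof (cases "sphere z0 s \<inter> cball c \<delta> = {}")
    case True
    show ?thesis by (rule that[of 1]) (use True in auto)
  next
    case False
    have "sphere z0 s \<inter> cball c \<delta> \<subseteq> cball w0 R"
      using s(2) ball_subset_cball[of w0 R] sphere_cball[of z0 s] by blast
    then have "continuous_on (sphere z0 s \<inter> cball c \<delta>) v"
      using cont continuous_on_subset by blast
    then obtain z1 where z1: "z1 \<in> sphere z0 s \<inter> cball c \<delta>" "\<And>z. z \<in> sphere z0 s \<inter> cball c \<delta> \<Longrightarrow> v z \<le> v z1"
      using continuous_attains_sup[OF _ False, of v] by (meson compact_Int_closed compact_sphere closed_cball)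
    have "v z1 < m" using touch[of z1] z1(1) s(1) by auto
    then show ?thesis by (intro that[of "m - v z1"]) (use z1(2) in auto)
  qed
  \<comment> \<open>As \<open>E\<close> is less than 1 on the ball about \<open>c\<close>, adding
    \<open>\<epsilon> * E\<close> there cannot use up the margin \<open>\<eta>\<close>.\<close>
  define \<epsilon> where "\<epsilon> = \<eta> / 2"
  define W where "W z = v z + \<epsilon> * E z" for z
  have \<epsilon>: "0 < \<epsilon>" "\<epsilon> < \<eta>" using \<eta>(1) by (auto simp: \<epsilon>_def)
  have in_S: "z \<in> S" if "dist z0 z \<le> s" for z
  proof -
    have "z \<in> cball z0 s" using that by simp
    then show ?thesis using s(2) assms(2) ball_subset_cball[of w0 R] by blast
  qed
  have lW: "has_lap W (l z + \<epsilon> * eE z) z" if "dist z0 z \<le> s" for z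
    unfolding W_def by (intro has_lap_add has_lap_cmult lE lap(1) in_S that)
  have bdry: "W z < m" if "dist z0 z = s" for z
  proof (cases "dist c z \<le> \<delta>")
    case True
    have "exp (- \<alpha> * (norm (z - c))\<^sup>2) \<le> 1" using \<delta>0 by (simp add: \<alpha>_def)
    then have "E z < 1" unfolding E_def using exp_gt_zero[of "- \<alpha> * \<delta>\<^sup>2"] by linarith
    then have "\<epsilon> * E z < \<epsilon> * 1" using \<epsilon>(1) by (intro mult_strict_left_mono)
    then show ?thesis using \<eta>(2)[OF that True] \<epsilon> unfolding W_def by linarith
  next
    case False
    then have "\<delta>\<^sup>2 < (norm (z - c))\<^sup>2" using \<delta>0 by (intro power_strict_mono) (auto simp: dist_norm norm_minus_commute)
    then have "E z < 0" using \<delta>0 by (simp add: E_def \<alpha>_def field_simps)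
    then have "\<epsilon> * E z < 0" using \<epsilon>(1) by (simp add: mult_pos_neg)
    then show ?thesis using max[of z] in_S[of z] that by (simp add: W_def m_def)
  qed
  have "continuous_on (cball z0 s) W"
    by (intro continuous_at_imp_continuous_on ballI has_lap_isCont[OF lW]) simp
  then obtain z1 where z1: "z1 \<in> cball z0 s" "\<And>z. z \<in> cball z0 s \<Longrightarrow> W z \<le> W z1"
    using continuous_attains_sup[of "cball z0 s" W] s(1) by auto
  \<comment> \<open>\<open>W\<close> is below \<open>m\<close> on the circle but equals
    \<open>m\<close> at the centre, so its maximum is interior, against the strict positivity of its
    Laplacian.\<close>
  have "W z0 = m" using z0(1) cz0 by (simp add: W_def E_def K_def dist_norm norm_minus_commute)
  then have "m \<le> W z1" using z1(2)[of z0] s(1) by simp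
  then have "dist z0 z1 \<noteq> s" using bdry by force
  then have "z1 \<in> ball z0 s" using z1(1) by simp
  have "l z1 + \<epsilon> * eE z1 \<le> 0"
    by (rule has_lap_local_max[OF lW open_ball \<open>z1 \<in> ball z0 s\<close>]) (use z1 in auto)
  moreover have "0 < \<epsilon> * eE z1" "0 \<le> l z1"
    using eEpos[of z1] \<epsilon> z1(1) lap(2)[OF in_S[of z1]] by auto
  ultimately show False by simp
qed

section \<open>Immersed surfaces in coordinates\<close>

lemma bounded_bilinear_cross3: "bounded_bilinear cross3"
  using bilinear_cross bilinear_conv_bounded_bilinear by blast

lemmas has_pd_cross3 = has_pd_bilinear[OF bounded_bilinear_cross3]

locale parametrized_surface =
  fixes S :: "complex set" and X :: "complex \<Rightarrow> real^3"
  assumes open_S: "open S" and smooth_X: "smooth_on S X"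
    and regular: "\<And>w. w \<in> S \<Longrightarrow> cross3 (pdx X w) (pdy X w) \<noteq> 0"
begin

lemma pd_X: "w \<in> S \<Longrightarrow> has_pd X (pdx X w) (pdy X w) w"
  and pd_X1: "w \<in> S \<Longrightarrow> has_pd (pdx X) (pdx (pdx X) w) (pdy (pdx X) w) w"
  and pd_X2: "w \<in> S \<Longrightarrow> has_pd (pdy X) (pdx (pdy X) w) (pdy (pdy X) w) w"
  and pd_X11: "w \<in> S \<Longrightarrow> has_pd (pdx (pdx X)) (pdx (pdx (pdx X)) w) (pdy (pdx (pdx X)) w) w"
  and pd_X12: "w \<in> S \<Longrightarrow> has_pd (pdy (pdx X)) (pdx (pdy (pdx X)) w) (pdy (pdy (pdx X)) w) w"
  and pd_X21: "w \<in> S \<Longrightarrow> has_pd (pdx (pdy X)) (pdx (pdx (pdy X)) w) (pdy (pdx (pdy X)) w) w"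
  and pd_X22: "w \<in> S \<Longrightarrow> has_pd (pdy (pdy X)) (pdx (pdy (pdy X)) w) (pdy (pdy (pdy X)) w) w"
  by (rule smooth_on_has_pd[OF open_S]; simp add: smooth_on_pdx smooth_on_pdy smooth_X)+

lemma mixed_X: "w \<in> S \<Longrightarrow> pdx (pdy X) w = pdy (pdx X) w"
  and mixed_X1: "w \<in> S \<Longrightarrow> pdx (pdy (pdx X)) w = pdy (pdx (pdx X)) w"
  and mixed_X2: "w \<in> S \<Longrightarrow> pdx (pdy (pdy X)) w = pdy (pdx (pdy X)) w"
  by (rule mixed_partials_commute[OF open_S, symmetric]; simp add: smooth_on_pdx smooth_on_pdy smooth_X)+

abbreviation n where "n \<equiv> unit_normal X"

lemma normal_eq: "n w = inverse (sqrt (cross3 (pdx X w) (pdy X w) \<bullet> cross3 (pdx X w) (pdy X w)))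
    *\<^sub>R cross3 (pdx X w) (pdy X w)"
  by (simp add: unit_normal_def sgn_div_norm norm_eq_sqrt_inner)

lemma pd_n: "w \<in> S \<Longrightarrow> has_pd n (pdx n w) (pdy n w) w"
proof -
  assume w: "w \<in> S"
  let ?c = "\<lambda>w. cross3 (pdx X w) (pdy X w)"
  have c: "has_pd ?c
      (cross3 (pdx (pdx X) w) (pdy X w) + cross3 (pdx X w) (pdx (pdy X) w))
      (cross3 (pdy (pdx X) w) (pdy X w) + cross3 (pdx X w) (pdy (pdy X) w)) w"
    by (rule has_pd_cross3[OF pd_X1[OF w] pd_X2[OF w]])
  have D: "((\<lambda>t. inverse (sqrt t)) has_real_derivative - (inverse (sqrt t) * (inverse (sqrt t) / 2) * inverse (sqrt t))) (at t)"
    if "0 < t" for t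
    using that by (auto intro!: derivative_eq_intros)
  have "\<exists>a b. has_pd (\<lambda>z. inverse (sqrt (?c z \<bullet> ?c z))) a b w"
    by (intro exI, rule has_pd_DERIV[where f = "\<lambda>z. ?c z \<bullet> ?c z", OF has_pd_inner[OF c c] D])
      (use regular[OF w] in simp)
  then obtain a b where "has_pd (\<lambda>z. inverse (sqrt (?c z \<bullet> ?c z))) a b w" by blast
  from has_pd_differentiable[OF has_pd_scaleR[OF this c]]
  have "(\<lambda>w. inverse (sqrt (?c w \<bullet> ?c w)) *\<^sub>R ?c w) differentiable at w" .
  moreover have "n = (\<lambda>w. inverse (sqrt (?c w \<bullet> ?c w)) *\<^sub>R ?c w)"
    by (rule ext) (rule normal_eq)
  ultimately show ?thesis by (intro differentiable_has_pd) simp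
qed

lemma n_X: "n w \<bullet> pdx X w = 0" "n w \<bullet> pdy X w = 0" "pdx X w \<bullet> n w = 0" "pdy X w \<bullet> n w = 0"
  by (simp_all add: normal_eq dot_cross_self)

lemma n_n: "w \<in> S \<Longrightarrow> n w \<bullet> n w = 1"
  using regular by (simp add: unit_normal_def norm_sgn flip: power2_norm_eq_inner)

lemma n_dn: "w \<in> S \<Longrightarrow> pdx n w \<bullet> n w = 0" "w \<in> S \<Longrightarrow> pdy n w \<bullet> n w = 0"
proof -
  assume w: "w \<in> S"
  have "has_pd (\<lambda>z. n z \<bullet> n z) 0 0 w"
    by (rule has_pd_cong_open[OF has_pd_const open_S w]) (simp add: n_n)
  then show "pdx n w \<bullet> n w = 0" "pdy n w \<bullet> n w = 0"
    using has_pd_pdx[OF has_pd_inner[OF pd_n[OF w] pd_n[OF w]]]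
      has_pd_pdy[OF has_pd_inner[OF pd_n[OF w] pd_n[OF w]]]
      has_pd_pdx[OF \<open>has_pd _ 0 0 w\<close>] has_pd_pdy[OF \<open>has_pd _ 0 0 w\<close>]
    by (simp_all add: inner_commute)
qed

text \<open>The coefficients of II, written with second derivatives of \<open>X\<close> instead of
  derivatives of the normal. The symmetry of II is then the symmetry of second derivatives, and
  differentiating once more involves the normal only to first order.\<close>

definition L where "L w = pdx (pdx X) w \<bullet> n w"
definition M where "M w = pdy (pdx X) w \<bullet> n w"
definition N where "N w = pdy (pdy X) w \<bullet> n w"

lemma dn_X:
  assumes w: "w \<in> S"
  shows "pdx n w \<bullet> pdx X w = - L w" "pdy n w \<bullet> pdx X w = - M w"
    "pdx n w \<bullet> pdy X w = - M w" "pdy n w \<bullet> pdy X w = - N w"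
proof -
  have x: "has_pd (\<lambda>z. n z \<bullet> pdx X z) 0 0 w" and y: "has_pd (\<lambda>z. n z \<bullet> pdy X z) 0 0 w"
    by (simp_all add: n_X has_pd_const)
  note ex = has_pd_inner[OF pd_n[OF w] pd_X1[OF w]] and ey = has_pd_inner[OF pd_n[OF w] pd_X2[OF w]]
  show "pdx n w \<bullet> pdx X w = - L w"
    using has_pd_pdx[OF ex] has_pd_pdx[OF x] by (simp add: L_def inner_commute)
  show "pdy n w \<bullet> pdx X w = - M w"
    using has_pd_pdy[OF ex] has_pd_pdy[OF x] by (simp add: M_def inner_commute)
  show "pdx n w \<bullet> pdy X w = - M w"
    using has_pd_pdx[OF ey] has_pd_pdx[OF y] mixed_X[OF w] by (simp add: M_def inner_commute)
  show "pdy n w \<bullet> pdy X w = - N w"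
    using has_pd_pdy[OF ey] has_pd_pdy[OF y] by (simp add: N_def inner_commute)
qed

lemma second_form_eq:
  assumes w: "w \<in> S"
  shows "second_form X w a b =
    Re a * Re b * L w + (Re a * Im b + Im a * Re b) * M w + Im a * Im b * N w"
  unfolding second_form_def has_pd_frechet[OF pd_n[OF w]] has_pd_frechet[OF pd_X[OF w]]
  using dn_X[OF w] by (simp add: inner_add_left inner_add_right algebra_simps)

lemma first_form_eq:
  assumes w: "w \<in> S"
  shows "first_form X w a b =
    Re a * Re b * (pdx X w \<bullet> pdx X w) + (Re a * Im b + Im a * Re b) * (pdx X w \<bullet> pdy X w)
      + Im a * Im b * (pdy X w \<bullet> pdy X w)"
  unfolding first_form_def has_pd_frechet[OF pd_X[OF w]]
  by (simp add: inner_add_left inner_add_right algebra_simps inner_commute)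

lemma pd_L: "w \<in> S \<Longrightarrow> has_pd L
    (pdx (pdx (pdx X)) w \<bullet> n w + pdx (pdx X) w \<bullet> pdx n w)
    (pdy (pdx (pdx X)) w \<bullet> n w + pdx (pdx X) w \<bullet> pdy n w) w"
  unfolding L_def[abs_def] by (rule has_pd_inner[OF pd_X11 pd_n])

lemma pd_N: "w \<in> S \<Longrightarrow> has_pd N
    (pdx (pdy (pdy X)) w \<bullet> n w + pdy (pdy X) w \<bullet> pdx n w)
    (pdy (pdy (pdy X)) w \<bullet> n w + pdy (pdy X) w \<bullet> pdy n w) w"
  unfolding N_def[abs_def] by (rule has_pd_inner[OF pd_X22 pd_n])

text \<open>The third derivatives are arranged to coincide with the one in the second slot of
  \<open>pd_L\<close> and the one in the first slot of \<open>pd_N\<close>, so that they cancel in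
  the Codazzi equations.\<close>

lemma pd_M:
  assumes w: "w \<in> S"
  shows "has_pd M (pdy (pdx (pdx X)) w \<bullet> n w + pdy (pdx X) w \<bullet> pdx n w)
    (pdx (pdy (pdy X)) w \<bullet> n w + pdy (pdx X) w \<bullet> pdy n w) w"
proof -
  have a: "has_pd M (pdx (pdy (pdx X)) w \<bullet> n w + pdy (pdx X) w \<bullet> pdx n w)
    (pdy (pdy (pdx X)) w \<bullet> n w + pdy (pdx X) w \<bullet> pdy n w) w"
    unfolding M_def[abs_def] by (rule has_pd_inner[OF pd_X12[OF w] pd_n[OF w]])
  have b: "has_pd M (pdx (pdx (pdy X)) w \<bullet> n w + pdx (pdy X) w \<bullet> pdx n w)
    (pdy (pdx (pdy X)) w \<bullet> n w + pdx (pdy X) w \<bullet> pdy n w) w"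
    by (rule has_pd_cong_open[OF has_pd_inner[OF pd_X21[OF w] pd_n[OF w]] open_S w])
      (simp add: M_def mixed_X)
  show ?thesis
    using a has_pd_pdy[OF a] has_pd_pdy[OF b] mixed_X1[OF w] mixed_X2[OF w] mixed_X[OF w] by simp
qed

end

section \<open>Isothermal parameters: structure equations and the Hopf coefficient\<close>

locale conformal_surface =
  fixes S :: "complex set" and X :: "complex \<Rightarrow> real^3" and u :: "complex \<Rightarrow> real"
  assumes conf_open: "open S" and conf_smooth: "smooth_on S X" and smooth_u: "smooth_on S u"
    and conformal: "\<And>w a b. w \<in> S \<Longrightarrow> first_form X w a b = exp (2 * u w) * (a \<bullet> b)"
begin

lemma conformal_XX:
  assumes w: "w \<in> S"
  shows "pdx X w \<bullet> pdx X w = exp (2 * u w)" "pdy X w \<bullet> pdy X w = exp (2 * u w)"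
    "pdx X w \<bullet> pdy X w = 0" "pdy X w \<bullet> pdx X w = 0"
  using conformal[OF w, of 1 1] conformal[OF w, of \<i> \<i>] conformal[OF w, of 1 \<i>] conformal[OF w, of \<i> 1]
  by (simp_all add: first_form_def pdx_def pdy_def)

sublocale parametrized_surface S X
proof
  fix w assume w: "w \<in> S"
  have "(norm (cross3 (pdx X w) (pdy X w)))\<^sup>2 = exp (2 * u w) * exp (2 * u w)"
    using norm_cross[of "pdx X w" "pdy X w"] conformal_XX[OF w] by (simp add: power2_norm_eq_inner)
  then show "cross3 (pdx X w) (pdy X w) \<noteq> 0" by auto
qed (fact conf_open conf_smooth)+

lemma pd_u: "w \<in> S \<Longrightarrow> has_pd u (pdx u w) (pdy u w) w"
  and pd_u1: "w \<in> S \<Longrightarrow> has_pd (pdx u) (pdx (pdx u) w) (pdy (pdx u) w) w"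
  and pd_u2: "w \<in> S \<Longrightarrow> has_pd (pdy u) (pdx (pdy u) w) (pdy (pdy u) w) w"
  by (rule smooth_on_has_pd[OF open_S]; simp add: smooth_on_pdx smooth_on_pdy smooth_u)+

definition E where "E w = exp (2 * u w)"

lemma E_pos: "E w > 0" by (simp add: E_def)

lemma pd_E: "w \<in> S \<Longrightarrow> has_pd E (2 * pdx u w * E w) (2 * pdy u w * E w) w"
  unfolding E_def[abs_def]
  by (rule has_pd_eq[OF has_pd_exp[OF has_pd_cmult[OF pd_u]]]) auto

lemma XX_E: "w \<in> S \<Longrightarrow> pdx X w \<bullet> pdx X w = E w" "w \<in> S \<Longrightarrow> pdy X w \<bullet> pdy X w = E w"
    "w \<in> S \<Longrightarrow> pdx X w \<bullet> pdy X w = 0" "w \<in> S \<Longrightarrow> pdy X w \<bullet> pdx X w = 0"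
  by (simp_all add: conformal_XX E_def)

text \<open>The Christoffel symbols of a conformal metric, obtained by differentiating the relations
  \<open>XX_E\<close>.\<close>

lemma christoffel:
  assumes w: "w \<in> S"
  shows "pdx (pdx X) w \<bullet> pdx X w = pdx u w * E w" "pdy (pdx X) w \<bullet> pdx X w = pdy u w * E w"
    "pdy (pdx X) w \<bullet> pdy X w = pdx u w * E w" "pdy (pdy X) w \<bullet> pdy X w = pdy u w * E w"
    "pdx (pdx X) w \<bullet> pdy X w = - (pdy u w * E w)" "pdy (pdy X) w \<bullet> pdx X w = - (pdx u w * E w)"
proof -
  have 11: "has_pd (\<lambda>z. pdx X z \<bullet> pdx X z) (2 * pdx u w * E w) (2 * pdy u w * E w) w"
    by (rule has_pd_cong_open[OF pd_E[OF w] open_S w]) (simp add: XX_E)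
  have 22: "has_pd (\<lambda>z. pdy X z \<bullet> pdy X z) (2 * pdx u w * E w) (2 * pdy u w * E w) w"
    by (rule has_pd_cong_open[OF pd_E[OF w] open_S w]) (simp add: XX_E)
  have 12: "has_pd (\<lambda>z. pdx X z \<bullet> pdy X z) 0 0 w"
    by (rule has_pd_cong_open[OF has_pd_const open_S w]) (simp add: XX_E)
  note e11 = has_pd_inner[OF pd_X1[OF w] pd_X1[OF w]]
    and e22 = has_pd_inner[OF pd_X2[OF w] pd_X2[OF w]]
    and e12 = has_pd_inner[OF pd_X1[OF w] pd_X2[OF w]]
  show 1: "pdx (pdx X) w \<bullet> pdx X w = pdx u w * E w" and 2: "pdy (pdx X) w \<bullet> pdx X w = pdy u w * E w"
    using has_pd_pdx[OF e11] has_pd_pdx[OF 11] has_pd_pdy[OF e11] has_pd_pdy[OF 11]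
    by (simp_all add: inner_commute)
  show 3: "pdy (pdx X) w \<bullet> pdy X w = pdx u w * E w" and 4: "pdy (pdy X) w \<bullet> pdy X w = pdy u w * E w"
    using has_pd_pdx[OF e22] has_pd_pdx[OF 22] has_pd_pdy[OF e22] has_pd_pdy[OF 22]
    by (simp_all add: inner_commute mixed_X[OF w])
  show "pdx (pdx X) w \<bullet> pdy X w = - (pdy u w * E w)" "pdy (pdy X) w \<bullet> pdx X w = - (pdx u w * E w)"
    using has_pd_pdx[OF e12] has_pd_pdx[OF 12] has_pd_pdy[OF e12] has_pd_pdy[OF 12] 2 3
    by (simp_all add: inner_commute mixed_X[OF w])
qed

text \<open>The normal is a multiple of the cross product of the two tangent vectors, so by the
  triple product formula a vector orthogonal to both has zero cross product with it. Being also
  orthogonal to the normal, it vanishes.\<close>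

lemma frame_zero:
  assumes w: "w \<in> S" and "d \<bullet> pdx X w = 0" "d \<bullet> pdy X w = 0" "d \<bullet> n w = 0"
  shows "d = 0"
proof -
  have "cross3 d (n w) = 0"
    using assms(2,3) by (simp add: normal_eq cross_mult_right Lagrange)
  then show ?thesis
    using norm_and_cross_eq_0[of d "n w"] assms(4) n_n[OF w] by auto
qed

lemma frame_expand:
  assumes w: "w \<in> S"
  shows "v = ((v \<bullet> pdx X w) / E w) *\<^sub>R pdx X w + ((v \<bullet> pdy X w) / E w) *\<^sub>R pdy X w + (v \<bullet> n w) *\<^sub>R n w"
proof -
  have "v - (((v \<bullet> pdx X w) / E w) *\<^sub>R pdx X w + ((v \<bullet> pdy X w) / E w) *\<^sub>R pdy X w + (v \<bullet> n w) *\<^sub>R n w) = 0"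
    using E_pos[of w]
    by (intro frame_zero[OF w]) (simp_all add: inner_diff_left inner_add_left XX_E[OF w] n_X n_n[OF w])
  then show ?thesis by (simp only: right_minus_eq)
qed

lemma frame_inner:
  assumes w: "w \<in> S"
  shows "v \<bullet> v' = (v \<bullet> pdx X w) * (v' \<bullet> pdx X w) / E w + (v \<bullet> pdy X w) * (v' \<bullet> pdy X w) / E w
    + (v \<bullet> n w) * (v' \<bullet> n w)"
  using arg_cong[OF frame_expand[OF w, of v], of "\<lambda>v. v \<bullet> v'"]
  by (simp add: inner_add_right inner_commute[of _ v'])

lemma local_mean_curvature_eq:
  assumes w: "w \<in> S"
  shows "local_mean_curvature X w = (L w + N w) / (2 * E w)"
  using E_pos[of w]
  by (simp add: local_mean_curvature_def Let_def conformal[OF w] second_form_eq[OF w] E_def[symmetric]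
      power2_eq_square divide_simps) (simp add: algebra_simps)

abbreviation H where "H \<equiv> local_mean_curvature X"

lemma LN_H: "w \<in> S \<Longrightarrow> L w + N w = 2 * E w * H w"
  using E_pos[of w] by (simp add: local_mean_curvature_eq)

lemma pd_H:
  assumes w: "w \<in> S"
  shows "has_pd H (pdx H w) (pdy H w) w"
proof -
  have "has_pd (\<lambda>z. (L z + N z) / (2 * E z)) (pdx (\<lambda>z. (L z + N z) / (2 * E z)) w) (pdy (\<lambda>z. (L z + N z) / (2 * E z)) w) w"
    using E_pos[of w] has_pd_differentiable[OF pd_L[OF w]] has_pd_differentiable[OF pd_N[OF w]]
      has_pd_differentiable[OF pd_E[OF w]]
    by (intro differentiable_has_pd differentiable_divide differentiable_add differentiable_mult) auto
  from has_pd_cong_open[OF this open_S w, of H] show ?thesis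
    by (intro differentiable_has_pd has_pd_differentiable) (simp add: local_mean_curvature_eq)
qed

text \<open>This is the function \<open>exp (2 * u w) * h\<close>, in which the conformal factor of
  the Hopf invariant \<open>h\<close> has cancelled.\<close>

definition k :: "complex \<Rightarrow> complex" where "k w = 2 * hopf_coeff X w"

lemma k_eq: "w \<in> S \<Longrightarrow> k w = Complex ((L w - N w) / 2) (- M w)"
  by (simp add: k_def hopf_coeff_def second_form_eq complex_eq_iff)

lemma pd_k:
  assumes w: "w \<in> S"
  shows "has_pd k (Complex ((pdx L w - pdx N w) / 2) (- pdx M w)) (Complex ((pdy L w - pdy N w) / 2) (- pdy M w)) w"
proof -
  have pL: "has_pd L (pdx L w) (pdy L w) w" and pM: "has_pd M (pdx M w) (pdy M w) w"
    and pN: "has_pd N (pdx N w) (pdy N w) w"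
    using pd_L[OF w] pd_M[OF w] pd_N[OF w] by (auto intro: differentiable_has_pd has_pd_differentiable)
  have "has_pd (\<lambda>z. ((L z - N z) / 2) *\<^sub>R 1 + (M z) *\<^sub>R (- \<i>))
    (((pdx L w - pdx N w) / 2) *\<^sub>R 1 + (pdx M w) *\<^sub>R (- \<i>)) (((pdy L w - pdy N w) / 2) *\<^sub>R 1 + (pdy M w) *\<^sub>R (- \<i>)) w"
    by (intro has_pd_add has_pd_diff has_pd_bounded_linear[OF bounded_linear_scaleR_left]
        has_pd_bounded_linear[OF bounded_linear_divide] pL pM pN)
  then have "has_pd (\<lambda>z. Complex ((L z - N z) / 2) (- M z)) (Complex ((pdx L w - pdx N w) / 2) (- pdx M w)) (Complex ((pdy L w - pdy N w) / 2) (- pdy M w)) w"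
    by (simp add: complex_eq_iff Complex_eq scaleR_conv_of_real algebra_simps)
  from has_pd_cong_open[OF this open_S w] show ?thesis by (simp add: k_eq)
qed

lemma gauss_weingarten:
  assumes w: "w \<in> S"
  shows "pdx (pdx X) w = pdx u w *\<^sub>R pdx X w - pdy u w *\<^sub>R pdy X w + L w *\<^sub>R n w"
    "pdy (pdx X) w = pdy u w *\<^sub>R pdx X w + pdx u w *\<^sub>R pdy X w + M w *\<^sub>R n w"
    "pdy (pdy X) w = - pdx u w *\<^sub>R pdx X w + pdy u w *\<^sub>R pdy X w + N w *\<^sub>R n w"
    "pdx n w = - (L w / E w) *\<^sub>R pdx X w - (M w / E w) *\<^sub>R pdy X w"
    "pdy n w = - (M w / E w) *\<^sub>R pdx X w - (N w / E w) *\<^sub>R pdy X w"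
  using frame_expand[OF w, of "pdx (pdx X) w"] frame_expand[OF w, of "pdy (pdx X) w"]
    frame_expand[OF w, of "pdy (pdy X) w"] frame_expand[OF w, of "pdx n w"] frame_expand[OF w, of "pdy n w"]
    E_pos[of w]
  by (simp_all add: christoffel[OF w] dn_X[OF w] n_dn[OF w] L_def[symmetric] M_def[symmetric] N_def[symmetric])

text \<open>The third derivatives of \<open>X\<close> cancel. What remains pairs second derivatives
  of \<open>X\<close> with first derivatives of the normal, which the Weingarten equations and the
  Christoffel symbols evaluate.\<close>

lemma codazzi:
  assumes w: "w \<in> S"
  shows "pdy L w - pdx M w = pdy u w * (L w + N w)" "pdx N w - pdy M w = pdx u w * (L w + N w)"
proof -
  note pds = has_pd_pdx[OF pd_L[OF w]] has_pd_pdy[OF pd_L[OF w]] has_pd_pdx[OF pd_M[OF w]]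
    has_pd_pdy[OF pd_M[OF w]] has_pd_pdx[OF pd_N[OF w]] has_pd_pdy[OF pd_N[OF w]]
  show "pdy L w - pdx M w = pdy u w * (L w + N w)" "pdx N w - pdy M w = pdx u w * (L w + N w)"
    unfolding pds gauss_weingarten(4,5)[OF w]
    using E_pos[of w]
    by (simp_all add: inner_add_right inner_diff_right christoffel[OF w] field_simps)
qed

text \<open>The left side is twice the derivative of \<open>k\<close> with respect to the conjugate
  coordinate. The right side involves only the metric and dH; hence it is shared by surfaces with
  the same metric and mean curvature, and it vanishes exactly where dH does.\<close>

lemma codazzi_k:
  assumes w: "w \<in> S"
  shows "pdx k w + \<i> * pdy k w = of_real (E w) * Complex (pdx H w) (- pdy H w)"
proof -
  have pLN: "has_pd (\<lambda>z. L z + N z) (pdx L w + pdx N w) (pdy L w + pdy N w) w"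
    using pd_L[OF w] pd_N[OF w]
    by (intro has_pd_add differentiable_has_pd) (auto intro: has_pd_differentiable)
  have "has_pd (\<lambda>z. L z + N z) (2 * ((2 * pdx u w * E w) * H w + E w * pdx H w))
      (2 * ((2 * pdy u w * E w) * H w + E w * pdy H w)) w"
    by (rule has_pd_cong_open[OF has_pd_cmult[OF
          has_pd_mult[OF pd_E[OF w] pd_H[OF w]]] open_S w]) (simp add: LN_H)
  note p = has_pd_pdx[OF this] has_pd_pdy[OF this]
  have 1: "pdx L w + pdx N w = 4 * (pdx u w * E w * H w) + 2 * (E w * pdx H w)"
    "pdy L w + pdy N w = 4 * (pdy u w * E w * H w) + 2 * (E w * pdy H w)"
    using p has_pd_pdx[OF pLN] has_pd_pdy[OF pLN] by simp_all
  have 2: "pdx N w - pdy M w = 2 * (pdx u w * E w * H w)" "pdy L w - pdx M w = 2 * (pdy u w * E w * H w)"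
    using codazzi[OF w] by (simp_all add: LN_H[OF w])
  have "(pdx L w - pdx N w) / 2 + pdy M w = ((pdx L w + pdx N w) - 2 * (pdx N w - pdy M w)) / 2"
    "(pdy L w - pdy N w) / 2 - pdx M w = (2 * (pdy L w - pdx M w) - (pdy L w + pdy N w)) / 2"
    by (simp_all add: field_simps)
  then have "(pdx L w - pdx N w) / 2 + pdy M w = E w * pdx H w"
    "(pdy L w - pdy N w) / 2 - pdx M w = - (E w * pdy H w)"
    unfolding 1 2 by simp_all
  then show ?thesis
    by (simp add: has_pd_pdx[OF pd_k[OF w]] has_pd_pdy[OF pd_k[OF w]] complex_eq_iff)
qed

text \<open>Differentiating the products of \<open>pdx (pdx X)\<close> and
  \<open>pdy (pdx X)\<close> with \<open>pdy X\<close> crosswise cancels the third derivatives and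
  leaves the inner product of the two pure second derivatives minus the square of the mixed one.
  Expanding these products in the moving frame gives the same quantity in terms of \<open>L\<close>,
  \<open>M\<close>, \<open>N\<close>.\<close>

lemma gauss:
  assumes w: "w \<in> S"
  shows "L w * N w - (M w)\<^sup>2 = - lap u w * E w"
proof -
  have a: "has_pd (\<lambda>z. pdx (pdx X) z \<bullet> pdy X z)
      (- (pdx (pdy u) w * E w + pdy u w * (2 * pdx u w * E w))) (- (pdy (pdy u) w * E w + pdy u w * (2 * pdy u w * E w))) w"
    by (rule has_pd_cong_open[OF has_pd_minus[OF has_pd_mult[OF pd_u2[OF w] pd_E[OF w]]] open_S w])
      (simp add: christoffel)
  have b: "has_pd (\<lambda>z. pdy (pdx X) z \<bullet> pdy X z)
      (pdx (pdx u) w * E w + pdx u w * (2 * pdx u w * E w)) (pdy (pdx u) w * E w + pdx u w * (2 * pdy u w * E w)) w"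
    by (rule has_pd_cong_open[OF has_pd_mult[OF pd_u1[OF w] pd_E[OF w]] open_S w])
      (simp add: christoffel)
  have "pdx (pdx X) w \<bullet> pdy (pdy X) w - pdy (pdx X) w \<bullet> pdy (pdx X) w
      = - (lap u w + 2 * (pdx u w * pdx u w + pdy u w * pdy u w)) * E w"
    using has_pd_pdy[OF a] has_pd_pdy[OF has_pd_inner[OF pd_X11[OF w] pd_X2[OF w]]]
      has_pd_pdx[OF b] has_pd_pdx[OF has_pd_inner[OF pd_X12[OF w] pd_X2[OF w]]] mixed_X1[OF w] mixed_X[OF w]
    by (simp add: lap_def algebra_simps)
  moreover have "pdx (pdx X) w \<bullet> pdy (pdy X) w = - (pdx u w * pdx u w + pdy u w * pdy u w) * E w + L w * N w"
    using E_pos[of w] unfolding frame_inner[OF w, of "pdx (pdx X) w" "pdy (pdy X) w"] christoffel[OF w] L_def[symmetric] N_def[symmetric]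
    by (simp add: algebra_simps)
  moreover have "pdy (pdx X) w \<bullet> pdy (pdx X) w = (pdx u w * pdx u w + pdy u w * pdy u w) * E w + M w * M w"
    using E_pos[of w] unfolding frame_inner[OF w, of "pdy (pdx X) w" "pdy (pdx X) w"] christoffel[OF w] M_def[symmetric]
    by (simp add: algebra_simps)
  ultimately show ?thesis by (simp add: power2_eq_square algebra_simps)
qed

text \<open>The squared modulus is the square of (L + N) / 2 minus the determinant of II; the first
  is given by the mean curvature, the second by the Gauss equation.\<close>

lemma norm_k:
  assumes w: "w \<in> S"
  shows "(norm (k w))\<^sup>2 = (E w * H w)\<^sup>2 + lap u w * E w"
proof -
  have "(norm (k w))\<^sup>2 = ((L w + N w) / 2)\<^sup>2 - (L w * N w - (M w)\<^sup>2)"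
    unfolding k_eq[OF w] cmod_power2 by (simp add: field_simps power2_eq_square)
  then show ?thesis by (simp add: gauss[OF w] LN_H[OF w])
qed

text \<open>
  The ambient squared distance to a point serves as a barrier: its logarithm is almost
  subharmonic on the surface, whatever the parametrization.
\<close>

lemma has_lap_dist:
  assumes w: "w \<in> S"
  shows "has_lap (\<lambda>z. (norm (X z - P))\<^sup>2) (4 * E w * (1 + H w * ((X w - P) \<bullet> n w))) w"
proof -
  have y: "has_pd (\<lambda>z. X z - P) (pdx X z) (pdy X z) z" if "z \<in> S" for z
    using has_pd_diff[OF pd_X[OF that] has_pd_const] by simp
  have q: "has_pd (\<lambda>z. (norm (X z - P))\<^sup>2) (2 * ((X z - P) \<bullet> pdx X z)) (2 * ((X z - P) \<bullet> pdy X z)) z"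
    if "z \<in> S" for z
    unfolding power2_norm_eq_inner
    by (rule has_pd_eq[OF has_pd_inner[OF y[OF that] y[OF that]]]) (simp_all add: inner_commute)
  have "L w + N w = 2 * E w * H w" by (rule LN_H[OF w])
  then have "((X w - P) \<bullet> n w) * (L w + N w) = 2 * E w * H w * ((X w - P) \<bullet> n w)" by simp
  then show ?thesis
    by (intro has_lapI[OF open_S w q has_pd_cmult[OF has_pd_inner[OF y[OF w] pd_X1[OF w]]]
          has_pd_cmult[OF has_pd_inner[OF y[OF w] pd_X2[OF w]]]])
      (simp_all add: gauss_weingarten(1,3)[OF w] inner_add_right inner_diff_right XX_E[OF w] algebra_simps)
qed

text \<open>In the plane ln |y| is harmonic away from its pole; here only the normal component of
  the position vector \<open>y\<close> survives. It enters through a complete square, \<open>E w *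
  ((2 * (y w \<bullet> n w) / q w + H w)\<^sup>2 - (H w)\<^sup>2)\<close>, so the lower bound does
  not deteriorate at the pole.\<close>

lemma has_lap_ln_dist:
  assumes w: "w \<in> S" and "X w \<noteq> P"
  shows "\<exists>l. has_lap (\<lambda>z. ln ((norm (X z - P))\<^sup>2)) l w \<and> - (E w * (H w)\<^sup>2) \<le> l"
proof -
  define T where "T = S \<inter> {z \<in> S. X z \<noteq> P}"
  have T_eq: "T = S \<inter> X -` (- {P})" by (auto simp: T_def)
  have "open T" unfolding T_eq
    by (rule continuous_open_preimage[OF smooth_on_continuous[OF smooth_X] open_S]) auto
  moreover have "w \<in> T" using assms by (simp add: T_def)
  ultimately have T: "open T" "w \<in> T" by simp_all
  define y where "y z = X z - P" for z
  define q where "q z = (norm (y z))\<^sup>2" for z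
  have py: "has_pd y (pdx X z) (pdy X z) z" if "z \<in> S" for z
    unfolding y_def using has_pd_diff[OF pd_X[OF that] has_pd_const] by simp
  have pq: "has_pd q (2 * (y z \<bullet> pdx X z)) (2 * (y z \<bullet> pdy X z)) z" if "z \<in> S" for z
    unfolding q_def power2_norm_eq_inner
    by (rule has_pd_eq[OF has_pd_inner[OF py[OF that] py[OF that]]]) (simp_all add: inner_commute)
  have qpos: "q z > 0" if "z \<in> T" for z using that by (auto simp: T_def q_def y_def)
  have pl: "has_pd (\<lambda>z. ln (q z)) (inverse (q z) * (2 * (y z \<bullet> pdx X z))) (inverse (q z) * (2 * (y z \<bullet> pdy X z))) z"
    if "z \<in> T" for z
    using qpos[OF that] that by (intro has_pd_DERIV pq) (auto intro: DERIV_ln simp: T_def)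
  have qw: "q w > 0" by (rule qpos[OF T(2)])
  have pi: "has_pd (\<lambda>z. inverse (q z)) (- (inverse (q w))\<^sup>2 * (2 * (y w \<bullet> pdx X w))) (- (inverse (q w))\<^sup>2 * (2 * (y w \<bullet> pdy X w))) w"
    using qw by (intro has_pd_DERIV pq w) (auto intro!: derivative_eq_intros simp: power2_eq_square)
  note p1 = has_pd_mult[OF pi has_pd_cmult[OF has_pd_inner[OF py[OF w] pd_X1[OF w]], of 2]]
  note p2 = has_pd_mult[OF pi has_pd_cmult[OF has_pd_inner[OF py[OF w] pd_X2[OF w]], of 2]]
  have lap: "has_lap (\<lambda>z. ln (q z)) (4 * E w * (1 + H w * (y w \<bullet> n w)) / q w
      - 4 * ((y w \<bullet> pdx X w)\<^sup>2 + (y w \<bullet> pdy X w)\<^sup>2) / (q w)\<^sup>2) w" (is "has_lap _ ?l w")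
  proof (rule has_lapI[OF T pl p1 p2])
    have "y w \<bullet> pdx (pdx X) w + y w \<bullet> pdy (pdy X) w = 2 * E w * H w * (y w \<bullet> n w)"
      using arg_cong[OF LN_H[OF w], of "\<lambda>t. t * (y w \<bullet> n w)"]
      by (simp add: gauss_weingarten(1,3)[OF w] inner_add_right inner_diff_right algebra_simps)
    then have A: "y w \<bullet> pdy (pdy X) w = 2 * E w * H w * (y w \<bullet> n w) - y w \<bullet> pdx (pdx X) w"
      by linarith
    show "?l = (- (inverse (q w))\<^sup>2 * (2 * (y w \<bullet> pdx X w))) * (2 * (y w \<bullet> pdx X w))
        + inverse (q w) * (2 * (pdx X w \<bullet> pdx X w + y w \<bullet> pdx (pdx X) w))
        + ((- (inverse (q w))\<^sup>2 * (2 * (y w \<bullet> pdy X w))) * (2 * (y w \<bullet> pdy X w))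
        + inverse (q w) * (2 * (pdy X w \<bullet> pdy X w + y w \<bullet> pdy (pdy X) w)))"
      unfolding A XX_E(1,2)[OF w] using qw by (simp add: field_simps power2_eq_square)
  qed
  have fr: "(y w \<bullet> pdx X w)\<^sup>2 + (y w \<bullet> pdy X w)\<^sup>2 = E w * (q w - (y w \<bullet> n w)\<^sup>2)"
    using frame_inner[OF w, of "y w" "y w"] E_pos[of w]
    unfolding q_def power2_norm_eq_inner by (simp add: field_simps power2_eq_square)
  have "?l = E w * ((2 * (y w \<bullet> n w) / q w + H w)\<^sup>2 - (H w)\<^sup>2)"
    unfolding fr using qw by (simp add: field_simps power2_eq_square)
  then have "- (E w * (H w)\<^sup>2) \<le> ?l"
    using E_pos[of w] by (simp add: algebra_simps)
  with lap show ?thesis by (auto simp: q_def y_def)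
qed

end

section \<open>Two conformal immersions with the same metric and mean curvature\<close>

text \<open>The Cauchy-Riemann equation, in the form that the y-derivative is \<i> times the
  x-derivative, turns the real differential into multiplication by \<open>a\<close>.\<close>

lemma has_pd_holomorphic:
  assumes "open S" "\<And>w. w \<in> S \<Longrightarrow> \<exists>a. has_pd f a (\<i> * a) w"
  shows "f holomorphic_on S"
proof (rule holomorphic_onI)
  fix w assume w: "w \<in> S"
  obtain a where a: "has_pd f a (\<i> * a) w" using assms(2)[OF w] by blast
  have "(\<lambda>v. Re v *\<^sub>R a + Im v *\<^sub>R (\<i> * a)) = (\<lambda>v. a * v)"
    by (auto simp: complex_eq_iff algebra_simps)
  with a have "(f has_field_derivative a) (at w)"
    by (simp add: has_pd_def has_field_derivative_def)
  then show "f field_differentiable at w within S"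
    using field_differentiable_def field_differentiable_at_within by blast
qed

lemma has_pd_field_derivative:
  assumes "(f has_field_derivative a) (at w)"
  shows "has_pd f a (\<i> * a) w"
  using has_derivative_has_pd[OF assms[unfolded has_field_derivative_def]]
  by (simp add: mult.commute)

lemma harmonic_Im_holomorphic:
  assumes "f holomorphic_on S" "open S" "w \<in> S"
  shows "has_lap (\<lambda>z. Im (f z)) 0 w"
proof -
  have 1: "has_pd (\<lambda>z. Im (f z)) (Im (deriv f z)) (Re (deriv f z)) z" if "z \<in> S" for z
    using has_pd_bounded_linear[OF bounded_linear_Im
        has_pd_field_derivative[OF holomorphic_derivI[OF assms(1,2) that]]] by simp
  note 2 = has_pd_field_derivative[OF holomorphic_derivI[OF holomorphic_deriv[OF assms(1,2)] assms(2,3)]]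
  show ?thesis
    by (rule has_lapI[OF assms(2,3) 1 has_pd_bounded_linear[OF bounded_linear_Im 2]
          has_pd_bounded_linear[OF bounded_linear_Re 2]]) simp_all
qed

text \<open>
  Near a zero of order \<open>n\<close> the values of \<open>F\<close> point in all directions, in particular in the
  direction of \<open>k\<close>, where adding \<open>F\<close> increases the modulus.
\<close>

lemma zero_of_modulus_preserving_perturbation:
  fixes F k :: "complex \<Rightarrow> complex"
  assumes "F holomorphic_on S" "open S" "w0 \<in> S" "F w0 = 0" "k w0 \<noteq> 0" "isCont k w0"
    and eq: "\<And>w. w \<in> S \<Longrightarrow> norm (k w + F w) = norm (k w)"
  obtains r where "0 < r" "ball w0 r \<subseteq> S" "\<And>w. w \<in> ball w0 r \<Longrightarrow> F w = 0"
proof -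
  obtain r0 where r0: "0 < r0" "ball w0 r0 \<subseteq> S" using assms(2,3) openE by blast
  show thesis
  proof (cases "F constant_on ball w0 r0")
    case True
    then have "F w = 0" if "w \<in> ball w0 r0" for w
      using that r0(1) assms(4) unfolding constant_on_def by (metis centre_in_ball)
    then show thesis using that r0 by blast
  next
    case False
    obtain g r n where g: "0 < n" "0 < r" "ball w0 r \<subseteq> ball w0 r0" "g holomorphic_on ball w0 r"
      "\<And>w. w \<in> ball w0 r \<Longrightarrow> F w = (w - w0) ^ n * g w" "\<And>w. w \<in> ball w0 r \<Longrightarrow> g w \<noteq> 0"
    proof (rule holomorphic_factor_zero_nonconstant[OF holomorphic_on_subset[OF assms(1) r0(2)] open_ball
          connected_ball _ assms(4) False])
      show "w0 \<in> ball w0 r0" using r0(1) by simp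
    qed blast
    \<comment> \<open>Along the ray from \<open>w0\<close> in the direction of an n-th root \<zeta>
      of \<open>c\<close>, \<open>F\<close> equals t^n times \<open>c * g\<close>, and
      \<open>c * g w0\<close> is exactly \<open>k w0\<close>.\<close>
    define c where "c = k w0 / g w0"
    obtain \<zeta> where \<zeta>: "c = \<zeta> ^ n"
      using exists_complex_root[of n c] g(1) by auto
    have g0: "g w0 \<noteq> 0" using g by auto
    define z where "z t = w0 + of_real t * \<zeta>" for t :: real
    \<comment> \<open>The quotient of |k + F|^2 - |k|^2 by t^n on this ray. It is zero for small
      positive t, yet its limit is twice the squared modulus of \<open>k w0\<close>.\<close>
    define \<phi> where "\<phi> t = 2 * Re (cnj (k (z t)) * (c * g (z t))) + t ^ n * (norm (c * g (z t)))\<^sup>2" for t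
    have zlim: "(z \<longlongrightarrow> w0) (at_right 0)"
      unfolding z_def by (auto intro!: tendsto_eq_intros)
    have ev: "\<forall>\<^sub>F t in at_right 0. z t \<in> ball w0 r"
      using topological_tendstoD[OF zlim open_ball] g(2) by simp
    have zero: "\<forall>\<^sub>F t in at_right 0. \<phi> t = 0"
      using ev eventually_at_right_less[of 0]
    proof eventually_elim
      case (elim t)
      have Fz: "F (z t) = of_real (t ^ n) * (c * g (z t))"
        using g(5)[OF elim(1)] by (simp add: z_def \<zeta> power_mult_distrib)
      have "norm (k (z t) + F (z t)) = norm (k (z t))"
        using eq[of "z t"] elim(1) g(3) r0(2) by blast
      then have "(norm (k (z t) + F (z t)))\<^sup>2 = (norm (k (z t)))\<^sup>2" by simp
      moreover have "(norm (a + b))\<^sup>2 = (norm a)\<^sup>2 + 2 * Re (cnj a * b) + (norm b)\<^sup>2" for a b :: complex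
        by (simp add: cmod_power2) (simp add: power2_eq_square algebra_simps)
      ultimately have "2 * Re (cnj (k (z t)) * F (z t)) + (norm (F (z t)))\<^sup>2 = 0" by simp
      also have "2 * Re (cnj (k (z t)) * F (z t)) + (norm (F (z t)))\<^sup>2 = t ^ n * \<phi> t"
        using elim(2) unfolding Fz \<phi>_def norm_mult
        by (simp add: norm_of_real power_mult_distrib algebra_simps power2_eq_square del: of_real_power)
      finally show ?case using elim(2) by simp
    qed
    have glim: "((\<lambda>t. g (z t)) \<longlongrightarrow> g w0) (at_right 0)"
      by (rule isCont_tendsto_compose[OF _ zlim])
        (use g(2,4) holomorphic_on_imp_continuous_on continuous_on_eq_continuous_at[OF open_ball] in force)
    have klim: "((\<lambda>t. k (z t)) \<longlongrightarrow> k w0) (at_right 0)"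
      by (rule isCont_tendsto_compose[OF assms(6) zlim])
    have "(\<phi> \<longlongrightarrow> 2 * Re (cnj (k w0) * (c * g w0)) + 0 ^ n * (norm (c * g w0))\<^sup>2) (at_right 0)"
      unfolding \<phi>_def by (intro tendsto_intros glim klim)
    moreover have "(\<phi> \<longlongrightarrow> 0) (at_right 0)"
      using tendsto_cong[OF zero] by simp
    ultimately have "2 * Re (cnj (k w0) * (c * g w0)) + 0 ^ n * (norm (c * g w0))\<^sup>2 = 0"
      using tendsto_unique trivial_limit_at_right_real by blast
    then have "2 * (Re (k w0) * Re (k w0)) + 2 * (Im (k w0) * Im (k w0)) = 0"
      using g(1) g0 by (simp add: c_def zero_power)
    then have "Re (k w0) * Re (k w0) + Im (k w0) * Im (k w0) = 0" by linarith
    then have "Re (k w0) = 0 \<and> Im (k w0) = 0" by (simp only: sum_squares_eq_zero_iff)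
    then show thesis using assms(5) by (simp add: complex_eq_iff)
  qed
qed

section \<open>Comparison of the Hopf coefficients of two surfaces\<close>

locale conformal_pair =
  X: conformal_surface S X u + Y: conformal_surface S Y u for S X Y u +
  assumes same_H: "\<And>w. w \<in> S \<Longrightarrow> local_mean_curvature Y w = local_mean_curvature X w"
begin

lemma norm_k_eq: "w \<in> S \<Longrightarrow> norm (Y.k w) = norm (X.k w)"
  using X.norm_k Y.norm_k same_H by (simp flip: power2_eq_iff_nonneg)

definition F where "F w = Y.k w - X.k w"

lemma pd_H_eq:
  assumes w: "w \<in> S"
  shows "pdx Y.H w = pdx X.H w" "pdy Y.H w = pdy X.H w"
proof -
  have "has_pd Y.H (pdx X.H w) (pdy X.H w) w"
    by (rule has_pd_cong_open[OF X.pd_H[OF w] X.open_S w]) (simp add: same_H)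
  then show "pdx Y.H w = pdx X.H w" "pdy Y.H w = pdy X.H w"
    by (auto dest: has_pd_pdx has_pd_pdy)
qed

lemma pd_k:
  assumes w: "w \<in> S"
  shows "has_pd X.k (pdx X.k w) (pdy X.k w) w" "has_pd Y.k (pdx Y.k w) (pdy Y.k w) w"
  using X.pd_k[OF w] Y.pd_k[OF w] by (auto intro!: differentiable_has_pd dest: has_pd_differentiable)

text \<open>The right sides of the two Codazzi equations agree, so the derivative of the difference
  with respect to the conjugate coordinate is zero.\<close>

lemma pd_F:
  assumes w: "w \<in> S"
  shows "\<exists>a. has_pd F a (\<i> * a) w"
proof -
  have "(pdx Y.k w - pdx X.k w) + \<i> * (pdy Y.k w - pdy X.k w) = 0"
    using X.codazzi_k[OF w] Y.codazzi_k[OF w] pd_H_eq[OF w] by (simp add: algebra_simps)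
  then have "pdy Y.k w - pdy X.k w = \<i> * (pdx Y.k w - pdx X.k w)"
    by (auto simp: complex_eq_iff)
  then show ?thesis
    using has_pd_diff[OF pd_k(2)[OF w] pd_k(1)[OF w]] unfolding F_def[abs_def] by metis
qed

lemma F_holomorphic: "F holomorphic_on S"
  by (rule has_pd_holomorphic[OF X.open_S pd_F])

lemma norm_k_F: "w \<in> S \<Longrightarrow> norm (X.k w + F w) = norm (X.k w)"
  by (simp add: F_def norm_k_eq)

lemma F_zero_locally:
  assumes "w \<in> S" "F w = 0" "X.k w \<noteq> 0"
  obtains r where "0 < r" "ball w r \<subseteq> S" "\<And>z. z \<in> ball w r \<Longrightarrow> F z = 0"
  using zero_of_modulus_preserving_perturbation[OF F_holomorphic X.open_S assms(1,2,3) _ norm_k_F]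
    has_pd_isCont[OF pd_k(1)[OF assms(1)]] by blast

text \<open>With \<open>Y.k = exp (i r) X.k\<close> one has \<open>T = cot (r / 2)\<close>; hence \<open>arctan T = (\<pi> - r) / 2\<close> for \<open>0 < r < 2 \<pi>\<close>.\<close>

definition T where "T w = - 2 * Im (X.k w / F w)"

text \<open>Dividing |k + F| = |k| by |F| says that the quotient is equidistant from 0 and - 1,
  hence on the line of real part - 1 / 2.\<close>

lemma k_over_F:
  assumes w: "w \<in> S" and "F w \<noteq> 0"
  shows "X.k w / F w = - (1 + \<i> * of_real (T w)) / 2"
proof -
  define q where "q = X.k w / F w"
  have "X.k w = q * F w" using assms(2) by (simp add: q_def)
  then have "norm ((q + 1) * F w) = norm (q * F w)"
    using norm_k_F[OF w] by (simp add: algebra_simps)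
  then have "norm (q + 1) = norm q" using assms(2) by (simp add: norm_mult)
  then have "(norm (q + 1))\<^sup>2 = (norm q)\<^sup>2" by simp
  then have "Re q = - 1 / 2" by (simp add: cmod_power2) (simp add: power2_eq_square algebra_simps)
  then show ?thesis by (simp add: q_def[symmetric] T_def complex_eq_iff)
qed

text \<open>Since 1 + \<i> T has argument arctan T, dividing \<open>X.k\<close> by it gives - F / 2.
  So \<open>\<Phi>\<close> is a logarithm of a holomorphic function, and its imaginary part, the
  difference of \<open>g\<close> and arctan T, is harmonic.\<close>

lemma has_lap_arctan_T:
  assumes sm: "smooth_on S G" "smooth_on S g"
    and kG: "\<And>w. w \<in> S \<Longrightarrow> X.k w = exp (of_real (G w) + \<i> * of_real (g w))"
    and F0: "\<And>w. w \<in> S \<Longrightarrow> F w \<noteq> 0" and w: "w \<in> S"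
  shows "has_lap (\<lambda>z. arctan (T z)) (lap g w) w"
proof -
  define \<Phi> where "\<Phi> z = of_real (G z - ln (sqrt (1 + (T z)\<^sup>2))) + \<i> * of_real (g z - arctan (T z))" for z
  have exp_\<Phi>: "exp (\<Phi> z) = - F z / 2" if "z \<in> S" for z
  proof -
    define s where "s = sqrt (1 + (T z)\<^sup>2)"
    have s: "s > 0" by (simp add: s_def add_pos_nonneg)
    have "exp (of_real (ln s) + \<i> * of_real (arctan (T z))) = of_real s * exp (\<i> * of_real (arctan (T z)))"
      using s by (simp add: exp_add exp_of_real)
    also have "\<dots> = of_real s * Complex (1 / s) (T z / s)"
      by (simp add: complex_eq_iff Re_exp Im_exp cos_arctan sin_arctan flip: s_def)
    also have "\<dots> = 1 + \<i> * of_real (T z)"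
      using s by (simp add: complex_eq_iff)
    finally have e: "exp (of_real (ln s) + \<i> * of_real (arctan (T z))) = 1 + \<i> * of_real (T z)" .
    have "\<Phi> z = (of_real (G z) + \<i> * of_real (g z)) - (of_real (ln s) + \<i> * of_real (arctan (T z)))"
      by (simp add: \<Phi>_def s_def algebra_simps)
    moreover define j where "j = 1 + \<i> * of_real (T z)"
    ultimately have "exp (\<Phi> z) = X.k z / j"
      by (simp only: exp_diff e kG[OF that] j_def)
    moreover have "j \<noteq> 0" by (simp add: j_def complex_eq_iff)
    moreover have "X.k z = j * (- F z / 2)"
      using k_over_F[OF that F0[OF that], folded j_def] F0[OF that] by (simp add: field_simps)
    ultimately show ?thesis by simp
  qed
  have pd\<Phi>: "\<exists>a b. has_pd \<Phi> a b z" if "z \<in> S" for z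
  proof -
    from pd_F[OF that] obtain c where c: "has_pd F c (\<i> * c) z" by blast
    have "(\<lambda>z. X.k z / F z) differentiable at z"
      by (rule differentiable_divide[OF has_pd_differentiable[OF pd_k(1)[OF that]]
            has_pd_differentiable[OF c] F0[OF that]])
    from has_pd_cmult[OF
        has_pd_bounded_linear[OF bounded_linear_Im differentiable_has_pd[OF this]], of "- 2"]
    obtain a b where T: "has_pd T a b z"
      unfolding T_def[abs_def] by blast
    have s: "0 < 1 + t\<^sup>2" for t :: real by (simp add: add_pos_nonneg)
    have "((\<lambda>t. ln (sqrt (1 + t\<^sup>2))) has_real_derivative t / (1 + t\<^sup>2)) (at t)" for t
      using s[of t] by (auto intro!: derivative_eq_intros simp: field_simps)
    from has_pd_DERIV[OF T this] obtain a1 b1 where 1: "has_pd (\<lambda>z. ln (sqrt (1 + (T z)\<^sup>2))) a1 b1 z" by blast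
    from has_pd_DERIV[OF T DERIV_arctan] obtain a2 b2 where 2: "has_pd (\<lambda>z. arctan (T z)) a2 b2 z" by blast
    note G = smooth_on_has_pd[OF X.open_S sm(1) that] and g = smooth_on_has_pd[OF X.open_S sm(2) that]
    from has_pd_add[OF has_pd_bounded_linear[OF bounded_linear_of_real has_pd_diff[OF G 1]]
        has_pd_cmult[OF has_pd_bounded_linear[OF bounded_linear_of_real has_pd_diff[OF g 2]], of \<i>]]
    show ?thesis unfolding \<Phi>_def by blast
  qed
  \<comment> \<open>So far \<open>\<Phi>\<close> is only real differentiable. The Cauchy-Riemann
    equation of \<open>exp (\<Phi> z)\<close> passes to \<open>\<Phi>\<close> by cancelling the
    nonzero exponential.\<close>
  have "\<Phi> holomorphic_on S"
  proof (rule has_pd_holomorphic[OF X.open_S])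
    fix z assume z: "z \<in> S"
    obtain a b where ab: "has_pd \<Phi> a b z" using pd\<Phi>[OF z] by blast
    obtain c where c: "has_pd F c (\<i> * c) z" using pd_F[OF z] by blast
    have "(exp has_derivative (*) (exp (\<Phi> z))) (at (\<Phi> z))"
      using DERIV_exp[of "\<Phi> z"] by (simp add: has_field_derivative_def)
    from has_derivative_has_pd[OF has_derivative_compose[OF ab[unfolded has_pd_def] this]]
    have 1: "has_pd (\<lambda>z. exp (\<Phi> z)) (exp (\<Phi> z) * a) (exp (\<Phi> z) * b) z" by simp
    have 2: "has_pd (\<lambda>z. exp (\<Phi> z)) (- c / 2) (- (\<i> * c) / 2) z"
      by (rule has_pd_cong_open[OF has_pd_bounded_linear[OF bounded_linear_divide has_pd_minus[OF c]] X.open_S z])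
        (simp add: exp_\<Phi>)
    have "exp (\<Phi> z) * a = - c / 2" "exp (\<Phi> z) * b = - (\<i> * c) / 2"
      using has_pd_pdx[OF 1] has_pd_pdx[OF 2] has_pd_pdy[OF 1] has_pd_pdy[OF 2] by simp_all
    then have "exp (\<Phi> z) * b = exp (\<Phi> z) * (\<i> * a)" by (simp add: algebra_simps)
    then have "b = \<i> * a" by simp
    with ab show "\<exists>a. has_pd \<Phi> a (\<i> * a) z" by blast
  qed
  from has_lap_add[OF has_lap_smooth[OF X.open_S sm(2) w]
      has_lap_cmult[OF harmonic_Im_holomorphic[OF this X.open_S w], of "- 1"]]
  show ?thesis by (simp add: \<Phi>_def)
qed

text \<open>A multiple of the holomorphic \<open>F\<close> has vanishing conjugate derivative, and
  in \<open>codazzi_k\<close> the factor \<open>E\<close> is positive.\<close>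

lemma H_critical_of_proportional:
  assumes "\<And>w. w \<in> S \<Longrightarrow> X.k w = c * F w" and w: "w \<in> S"
  shows "pdx X.H w = 0" "pdy X.H w = 0"
proof -
  obtain a where a: "has_pd F a (\<i> * a) w" using pd_F[OF w] by blast
  have "has_pd X.k (c * a) (c * (\<i> * a)) w"
    by (rule has_pd_cong_open[OF has_pd_cmult[OF a] X.open_S w])
      (simp add: assms(1))
  then have "pdx X.k w + \<i> * pdy X.k w = c * a + (\<i> * \<i>) * (c * a)"
    by (simp only: has_pd_pdx has_pd_pdy ac_simps)
  then have "pdx X.k w + \<i> * pdy X.k w = 0" by simp
  then have "Complex (pdx X.H w) (- pdy X.H w) = 0"
    using X.codazzi_k[OF w] X.E_pos[of w] by simp
  then show "pdx X.H w = 0" "pdy X.H w = 0" by (simp_all add: complex_eq_iff)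
qed

end

section \<open>Moving frames and rigidity\<close>

context conformal_surface
begin

definition frame :: "complex \<Rightarrow> real^3^3" where
  "frame w = vector [inverse (sqrt (E w)) *\<^sub>R pdx X w, inverse (sqrt (E w)) *\<^sub>R pdy X w, n w]"

lemma cross_E:
  assumes w: "w \<in> S"
  shows "cross3 (pdx X w) (pdy X w) = E w *\<^sub>R n w"
proof -
  have "(norm (cross3 (pdx X w) (pdy X w)))\<^sup>2 = (E w)\<^sup>2"
    using norm_cross[of "pdx X w" "pdy X w"] XX_E[OF w]
    by (simp add: power2_norm_eq_inner) (simp add: power2_eq_square)
  then have "norm (cross3 (pdx X w) (pdy X w)) = E w"
    using E_pos[of w] by (simp add: power2_eq_iff_nonneg)
  then show ?thesis
    using E_pos[of w] by (simp add: unit_normal_def sgn_div_norm)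
qed

lemma frame_rotation:
  assumes w: "w \<in> S"
  shows "rotation_matrix (frame w)"
proof -
  have s: "inverse (sqrt (E w)) * (inverse (sqrt (E w)) * E w) = 1"
    using E_pos[of w] by (simp add: field_simps)
  have "orthogonal_matrix (frame w)"
    using s by (simp add: orthogonal_matrix_orthonormal_rows forall_3 row_def frame_def vector_3
        orthogonal_def XX_E[OF w] n_X n_n[OF w] norm_eq_1 del: inverse_eq_divide)
  moreover have "det (frame w) = 1"
  proof -
    have "det (frame w) = cross3 (inverse (sqrt (E w)) *\<^sub>R pdx X w) (inverse (sqrt (E w)) *\<^sub>R pdy X w) \<bullet> n w"
      unfolding frame_def dot_cross_det[symmetric]
      by (rule trans[OF inner_commute cross_triple[symmetric]])
    also have "\<dots> = 1"
      using s by (simp add: cross_mult_left cross_mult_right cross_E[OF w] n_n[OF w])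
    finally show ?thesis .
  qed
  ultimately show ?thesis by (simp add: rotation_matrix_def)
qed

lemma frame_mult:
  "(frame w *v v) \<bullet> z = inverse (sqrt (E w)) * (pdx X w \<bullet> v) * z $ 1
    + inverse (sqrt (E w)) * (pdy X w \<bullet> v) * z $ 2 + (n w \<bullet> v) * z $ 3"
  by (simp add: inner_vec_def sum_3 matrix_vector_mul_component frame_def vector_3 algebra_simps)

text \<open>Differentiation determines the rotation on the tangent plane at \<open>w\<close>.
  Rotations preserve cross products, so it is determined on the normal as well; this is where
  reflections in the tangent plane are excluded.\<close>

lemma rigid_motion_unique:
  assumes "open V" "V \<subseteq> S" "w \<in> V" "rotation_matrix R" "rotation_matrix R'"
    and eq: "\<And>z. z \<in> V \<Longrightarrow> y + R *v X z = y' + R' *v X z"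
  shows "R = R'" "y = y'"
proof -
  have w: "w \<in> S" using assms by blast
  have pd: "has_pd (\<lambda>z. y + R *v X z) (R *v pdx X w) (R *v pdy X w) w" for R :: "real^3^3" and y
    using has_pd_add[OF has_pd_const has_pd_bounded_linear[OF matrix_vector_mul_bounded_linear pd_X[OF w]]]
    by simp
  have pd': "has_pd (\<lambda>z. y' + R' *v X z) (R *v pdx X w) (R *v pdy X w) w"
    by (rule has_pd_cong_open[OF pd[of y R] assms(1,3) eq])
  have e: "R *v pdx X w = R' *v pdx X w" "R *v pdy X w = R' *v pdy X w"
    using has_pd_pdx[OF pd'] has_pd_pdx[OF pd[of y' R']] has_pd_pdy[OF pd'] has_pd_pdy[OF pd[of y' R']]
    by simp_all
  have "cross3 (Q *v pdx X w) (Q *v pdy X w) = E w *\<^sub>R (Q *v n w)" if "rotation_matrix Q" for Q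
    by (simp only: cross_rotation_matrix[OF that] cross_E[OF w] matrix_vector_mult_scaleR)
  from this[OF assms(4)] this[OF assms(5)] have "E w *\<^sub>R (R *v n w) = E w *\<^sub>R (R' *v n w)"
    unfolding e by (rule trans[OF sym])
  then have n: "R *v n w = R' *v n w" using E_pos[of w] by simp
  have ex: "Q *v v = ((v \<bullet> pdx X w) / E w) *\<^sub>R (Q *v pdx X w) + ((v \<bullet> pdy X w) / E w) *\<^sub>R (Q *v pdy X w)
      + (v \<bullet> n w) *\<^sub>R (Q *v n w)" for Q :: "real^3^3" and v
    using arg_cong[OF frame_expand[OF w, of v], of "(*v) Q"]
    by (simp only: matrix_vector_right_distrib matrix_vector_mult_scaleR)
  have "R *v v = R' *v v" for v
    unfolding ex[of R v] ex[of R' v] e n by (rule refl)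
  then show "R = R'" by (simp add: matrix_eq)
  then show "y = y'" using eq[OF assms(3)] by simp
qed

end

context conformal_pair
begin

lemma second_forms_equal:
  assumes "w \<in> S" "F w = 0"
  shows "Y.L w = X.L w" "Y.M w = X.M w" "Y.N w = X.N w"
  using assms X.k_eq[of w] Y.k_eq[of w] X.LN_H[of w] Y.LN_H[of w] same_H[of w]
  by (auto simp: F_def complex_eq_iff)

text \<open>For fixed \<open>v\<close> and \<open>v'\<close> this is a matrix entry of the rotation
  that carries the frame of \<open>X\<close> to the frame of \<open>Y\<close>. Both frames satisfy
  the Gauss and Weingarten equations with equal coefficients, so the rotation does not vary.\<close>

lemma frame_product_constant:
  assumes F0: "\<And>w. w \<in> S \<Longrightarrow> F w = 0" and w: "w \<in> S"
  shows "has_pd (\<lambda>w. inverse (X.E w) * ((pdx X w \<bullet> v) * (pdx Y w \<bullet> v') + (pdy X w \<bullet> v) * (pdy Y w \<bullet> v'))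
    + (X.n w \<bullet> v) * (Y.n w \<bullet> v')) 0 0 w"
proof -
  have "((\<lambda>t. inverse t) has_real_derivative - (inverse (X.E w) * inverse (X.E w))) (at (X.E w))"
    using X.E_pos[of w] by (auto intro!: derivative_eq_intros)
  from has_pd_DERIV[OF X.pd_E[OF w] this]
  have i: "has_pd (\<lambda>z. inverse (X.E z)) (- 2 * pdx u w * inverse (X.E w)) (- 2 * pdy u w * inverse (X.E w)) w"
    by (rule has_pd_eq) (use X.E_pos[of w] in \<open>simp_all\<close>)
  note li = has_pd_bounded_linear[OF bounded_linear_inner_left]
  note eq = second_forms_equal[OF w F0[OF w]]
  show ?thesis
    by (rule has_pd_eq[OF has_pd_add[OF has_pd_mult[OF i has_pd_add[OF
              has_pd_mult[OF li[OF X.pd_X1[OF w], of v] li[OF Y.pd_X1[OF w], of v']]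
              has_pd_mult[OF li[OF X.pd_X2[OF w], of v] li[OF Y.pd_X2[OF w], of v']]]]
            has_pd_mult[OF li[OF X.pd_n[OF w], of v] li[OF Y.pd_n[OF w], of v']]]])
      (simp_all only: X.gauss_weingarten[OF w] Y.gauss_weingarten[OF w] X.mixed_X[OF w] Y.mixed_X[OF w] eq
        inner_add_left inner_diff_left inner_scaleR_left divide_inverse, simp_all add: algebra_simps)
qed

lemma congruent_of_equal_second_forms:
  assumes F0: "\<And>w. w \<in> S \<Longrightarrow> F w = 0" and "convex S" and w0: "w0 \<in> S"
  obtains y R where "rotation_matrix R" "\<And>w. w \<in> S \<Longrightarrow> Y w = y + R *v X w"
proof -
  \<comment> \<open>The rotation carrying the frame of \<open>X\<close> at \<open>w0\<close> to that
    of \<open>Y\<close>. Its entries are the values \<open>g v v' w0\<close>, which by constancy may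
    be evaluated at any other point.\<close>
  define R where "R = transpose (Y.frame w0) ** X.frame w0"
  have rot: "rotation_matrix R"
    using X.frame_rotation[OF w0] Y.frame_rotation[OF w0]
    by (simp add: R_def rotation_matrix_def orthogonal_matrix_mul orthogonal_matrix_transpose det_mul det_transpose)
  define g where "g v v' w = inverse (X.E w) * ((pdx X w \<bullet> v) * (pdx Y w \<bullet> v') + (pdy X w \<bullet> v) * (pdy Y w \<bullet> v'))
    + (X.n w \<bullet> v) * (Y.n w \<bullet> v')" for v v' w
  have R0: "(R *v v) \<bullet> v' = g v v' w0" for v v'
  proof -
    have "(R *v v) \<bullet> v' = (X.frame w0 *v v) \<bullet> (Y.frame w0 *v v')"
      by (simp add: R_def dot_lmul_matrix flip: matrix_vector_mul_assoc)
    also have "\<dots> = g v v' w0"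
    proof -
      define s where "s = inverse (sqrt (X.E w0))"
      have ss: "s * s = inverse (X.E w0)"
        using X.E_pos[of w0] by (simp add: s_def flip: inverse_mult_distrib)
      have "(X.frame w0 *v v) \<bullet> (Y.frame w0 *v v') =
          s * (pdx X w0 \<bullet> v) * (s * (pdx Y w0 \<bullet> v')) + s * (pdy X w0 \<bullet> v) * (s * (pdy Y w0 \<bullet> v'))
          + (X.n w0 \<bullet> v) * (Y.n w0 \<bullet> v')"
        unfolding X.frame_mult by (simp add: matrix_vector_mul_component Y.frame_def vector_3 s_def)
      also have "\<dots> = g v v' w0" unfolding g_def ss[symmetric] by (simp add: algebra_simps)
      finally show ?thesis .
    qed
    finally show ?thesis .
  qed
  have R: "(R *v v) \<bullet> v' = g v v' w" if "w \<in> S" for v v' w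
    unfolding R0 g_def
    by (rule has_pd_zero_constant[OF assms(2) X.open_S frame_product_constant[OF F0] w0 that])
  have Rx: "R *v pdx X w = pdx Y w" "R *v pdy X w = pdy Y w" if w: "w \<in> S" for w
  proof -
    have "(R *v pdx X w) \<bullet> v' = pdx Y w \<bullet> v'" "(R *v pdy X w) \<bullet> v' = pdy Y w \<bullet> v'" for v'
      using X.E_pos[of w] by (simp_all add: R[OF w] g_def X.XX_E[OF w] X.n_X)
    then show "R *v pdx X w = pdx Y w" "R *v pdy X w = pdy Y w"
      using vector_eq_rdot by blast+
  qed
  have pd: "has_pd (\<lambda>z. Y z - R *v X z) 0 0 w" if w: "w \<in> S" for w
    by (rule has_pd_eq[OF has_pd_diff[OF Y.pd_X[OF w]
            has_pd_bounded_linear[OF matrix_vector_mul_bounded_linear X.pd_X[OF w]]]]) (simp_all add: Rx[OF w])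
  have "Y w = (Y w0 - R *v X w0) + R *v X w" if "w \<in> S" for w
    using has_pd_zero_constant[OF assms(2) X.open_S pd that w0] by (simp add: algebra_simps)
  then show thesis using that rot by blast
qed

end


section \<open>Change of coordinates\<close>

text \<open>The forms transform by the first derivative of \<open>\<tau>\<close> alone, which is
  what \<open>compatible_transition\<close> provides for two compatible charts; the positive
  Jacobian keeps the unit normal.\<close>

locale reparametrization = X: parametrized_surface T X
  for T X and S :: "complex set" and \<tau> :: "complex \<Rightarrow> complex" and Y :: "complex \<Rightarrow> real^3" +
  assumes open_dom: "open S" and maps: "\<And>w. w \<in> S \<Longrightarrow> \<tau> w \<in> T"
    and Y_eq: "\<And>w. w \<in> S \<Longrightarrow> Y w = X (\<tau> w)"
    and diff_\<tau>: "\<And>w. w \<in> S \<Longrightarrow> \<tau> differentiable at w"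
    and orient: "\<And>w. w \<in> S \<Longrightarrow> 0 < jacobian \<tau> w"
begin

lemma pd_Y:
  assumes w: "w \<in> S"
  shows "has_pd Y
    (Re (pdx \<tau> w) *\<^sub>R pdx X (\<tau> w) + Im (pdx \<tau> w) *\<^sub>R pdy X (\<tau> w))
    (Re (pdy \<tau> w) *\<^sub>R pdx X (\<tau> w) + Im (pdy \<tau> w) *\<^sub>R pdy X (\<tau> w)) w"
  by (rule has_pd_cong_open[OF has_pd_compose[OF differentiable_has_pd[OF diff_\<tau>[OF w]]
          has_pd_differentiable[OF X.pd_X[OF maps[OF w]]]] open_dom w]) (simp add: Y_eq)

lemma cross_Y:
  assumes w: "w \<in> S"
  shows "cross3 (pdx Y w) (pdy Y w) =
      (jacobian \<tau> w) *\<^sub>R cross3 (pdx X (\<tau> w)) (pdy X (\<tau> w))"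
  unfolding has_pd_pdx[OF pd_Y[OF w]] has_pd_pdy[OF pd_Y[OF w]]
  using cross_skew[of "pdy X (\<tau> w)" "pdx X (\<tau> w)"]
  by (simp add: cross_add_left cross_add_right cross_mult_left cross_mult_right algebra_simps)

lemma normal_Y:
  assumes w: "w \<in> S"
  shows "unit_normal Y w = unit_normal X (\<tau> w)"
  using orient[OF w] by (simp add: unit_normal_def cross_Y[OF w] sgn_scaleR)

lemma pd_normal_Y:
  assumes w: "w \<in> S"
  shows "has_pd (unit_normal Y)
    (Re (pdx \<tau> w) *\<^sub>R pdx X.n (\<tau> w) + Im (pdx \<tau> w) *\<^sub>R pdy X.n (\<tau> w))
    (Re (pdy \<tau> w) *\<^sub>R pdx X.n (\<tau> w) + Im (pdy \<tau> w) *\<^sub>R pdy X.n (\<tau> w)) w"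
  by (rule has_pd_cong_open[OF has_pd_compose[OF differentiable_has_pd[OF diff_\<tau>[OF w]]
          has_pd_differentiable[OF X.pd_n[OF maps[OF w]]]] open_dom w]) (simp add: normal_Y)

definition push where "push w v = Re v *\<^sub>R pdx \<tau> w + Im v *\<^sub>R pdy \<tau> w"

lemma frechet_Y:
  assumes w: "w \<in> S"
  shows "frechet_derivative Y (at w) v = frechet_derivative X (at (\<tau> w)) (push w v)"
    "frechet_derivative (unit_normal Y) (at w) v = frechet_derivative (unit_normal X) (at (\<tau> w)) (push w v)"
  unfolding has_pd_frechet[OF pd_Y[OF w]] has_pd_frechet[OF pd_normal_Y[OF w]]
    has_pd_frechet[OF X.pd_X[OF maps[OF w]]] has_pd_frechet[OF X.pd_n[OF maps[OF w]]] push_def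
  by (simp_all add: algebra_simps)

lemma first_form_Y: "w \<in> S \<Longrightarrow> first_form Y w a b = first_form X (\<tau> w) (push w a) (push w b)"
  and second_form_Y: "w \<in> S \<Longrightarrow> second_form Y w a b = second_form X (\<tau> w) (push w a) (push w b)"
  by (simp_all add: first_form_def second_form_def frechet_Y)

text \<open>Numerator and denominator of the trace formula are both multiplied by the squared
  Jacobian.\<close>

lemma mean_curvature_Y:
  assumes w: "w \<in> S"
  shows "local_mean_curvature Y w = local_mean_curvature X (\<tau> w)"
proof -
  define a b c d where "a = Re (pdx \<tau> w)" and "b = Im (pdx \<tau> w)" and "c = Re (pdy \<tau> w)" and "d = Im (pdy \<tau> w)"
  define J where "J = (a * d - b * c)\<^sup>2"
  have J: "J \<noteq> 0" using orient[OF w] by (simp add: J_def a_def b_def c_def d_def)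
  define E F G L M N where "E = first_form X (\<tau> w) 1 1" and "F = first_form X (\<tau> w) 1 \<i>"
    and "G = first_form X (\<tau> w) \<i> \<i>" and "L = second_form X (\<tau> w) 1 1"
    and "M = second_form X (\<tau> w) 1 \<i>" and "N = second_form X (\<tau> w) \<i> \<i>"
  have f: "first_form Y w 1 1 = a * a * E + 2 * a * b * F + b * b * G"
    "first_form Y w 1 \<i> = a * c * E + (a * d + b * c) * F + b * d * G"
    "first_form Y w \<i> \<i> = c * c * E + 2 * c * d * F + d * d * G"
    "second_form Y w 1 1 = a * a * L + 2 * a * b * M + b * b * N"
    "second_form Y w 1 \<i> = a * c * L + (a * d + b * c) * M + b * d * N"
    "second_form Y w \<i> \<i> = c * c * L + 2 * c * d * M + d * d * N"
    unfolding first_form_Y[OF w] second_form_Y[OF w] E_def F_def G_def L_def M_def N_def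
      X.first_form_eq[OF maps[OF w]] X.second_form_eq[OF maps[OF w]]
    by (simp_all add: push_def a_def b_def c_def d_def algebra_simps)
  have num: "(a * a * E + 2 * a * b * F + b * b * G) * (c * c * L + 2 * c * d * M + d * d * N)
      - 2 * (a * c * E + (a * d + b * c) * F + b * d * G) * (a * c * L + (a * d + b * c) * M + b * d * N)
      + (c * c * E + 2 * c * d * F + d * d * G) * (a * a * L + 2 * a * b * M + b * b * N)
      = J * (E * N - 2 * F * M + G * L)"
    unfolding J_def by algebra
  have den: "(a * a * E + 2 * a * b * F + b * b * G) * (c * c * E + 2 * c * d * F + d * d * G)
      - (a * c * E + (a * d + b * c) * F + b * d * G)\<^sup>2 = J * (E * G - F\<^sup>2)"
    unfolding J_def by algebra
  have "local_mean_curvature Y w = (J * (E * N - 2 * F * M + G * L)) / (2 * (J * (E * G - F\<^sup>2)))"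
    unfolding local_mean_curvature_def Let_def f num den by simp
  also have "\<dots> = local_mean_curvature X (\<tau> w)"
    using J by (simp add: local_mean_curvature_def Let_def E_def F_def G_def L_def M_def N_def)
  finally show ?thesis .
qed

text \<open>An orientation preserving conformal linear map of the plane is multiplication by a complex number.\<close>

lemma conformal_transition:
  assumes w: "w \<in> S" and "\<And>a b. first_form Y w a b = exp s * (a \<bullet> b)"
    and "\<And>a b. first_form X (\<tau> w) a b = exp t * (a \<bullet> b)"
  shows "pdy \<tau> w = \<i> * pdx \<tau> w" "pdx \<tau> w \<noteq> 0"
    and "hopf_coeff Y w = (pdx \<tau> w)\<^sup>2 * hopf_coeff X (\<tau> w)"
proof -
  define a b c d where "a = Re (pdx \<tau> w)" and "b = Im (pdx \<tau> w)" and "c = Re (pdy \<tau> w)" and "d = Im (pdy \<tau> w)"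
  have J: "0 < a * d - b * c" using orient[OF w] by (simp add: a_def b_def c_def d_def)
  have f: "exp s * (v \<bullet> v') = exp t * (push w v \<bullet> push w v')" for v v'
    using first_form_Y[OF w, of v v'] assms(2,3) by simp
  have 1: "exp t * (a * c + b * d) = 0" "exp t * (a * a + b * b) = exp t * (c * c + d * d)"
    using f[of 1 \<i>] f[of 1 1] f[of \<i> \<i>] by (simp_all add: push_def inner_complex_def a_def b_def c_def d_def)
  then have 2: "a * c + b * d = 0" "a * a + b * b = c * c + d * d" by simp_all
  \<comment> \<open>The relations \<open>2\<close> say that the two columns are orthogonal and of
    equal length, so the determinant is plus or minus \<open>a * a + b * b\<close>. The orientation
    selects the plus sign, and the sum of squares vanishes.\<close>
  have "(a - d)\<^sup>2 + (b + c)\<^sup>2 = 2 * (a * a + b * b - (a * d - b * c))"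
    using 2 by (simp add: power2_eq_square algebra_simps)
  moreover have "(a * d - b * c)\<^sup>2 = (a * a + b * b)\<^sup>2"
    using 2 by algebra
  then have "a * d - b * c = a * a + b * b"
    using J by (simp add: power2_eq_iff_nonneg)
  ultimately have "(a - d)\<^sup>2 + (b + c)\<^sup>2 = 0" by simp
  then have cd: "d = a" "c = - b" by (auto simp: sum_power2_eq_zero_iff)
  show p: "pdy \<tau> w = \<i> * pdx \<tau> w"
    using cd by (simp add: complex_eq_iff a_def b_def c_def d_def)
  show "pdx \<tau> w \<noteq> 0" using J by (auto simp: a_def b_def)
  show "hopf_coeff Y w = (pdx \<tau> w)\<^sup>2 * hopf_coeff X (\<tau> w)"
    unfolding hopf_coeff_def second_form_Y[OF w] X.second_form_eq[OF maps[OF w]]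
    by (simp add: push_def p complex_eq_iff power2_eq_square) (simp add: field_simps)
qed

end

text \<open>The second derivatives of \<open>\<tau>\<close> multiply the gradient of
  \<open>f\<close> and cancel between the two pure second derivatives by the Cauchy-Riemann
  equations.\<close>

lemma has_lap_compose_holomorphic:
  assumes f: "has_lap f l (\<tau> w)" and "\<tau> holomorphic_on S" "open S" "w \<in> S"
  shows "has_lap (\<lambda>z. f (\<tau> z)) ((norm (deriv \<tau> w))\<^sup>2 * l) w"
proof -
  from f obtain T fx fy a b c d where T: "open T" "\<tau> w \<in> T"
    and f: "\<And>z. z \<in> T \<Longrightarrow> has_pd f (fx z) (fy z) z"
    and x: "has_pd fx a b (\<tau> w)" and y: "has_pd fy c d (\<tau> w)" and l: "l = a + d"
    unfolding has_lap_def by blast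
  define V where "V = S \<inter> \<tau> -` T"
  have V: "open V" "w \<in> V"
    unfolding V_def
    using continuous_open_preimage[OF holomorphic_on_imp_continuous_on[OF assms(2)] assms(3) T(1)] assms(4) T(2)
    by auto
  define t where "t = deriv \<tau>"
  have \<tau>: "has_pd \<tau> (t z) (\<i> * t z) z" if "z \<in> V" for z
    using has_pd_field_derivative[OF holomorphic_derivI[OF assms(2,3)]] that by (auto simp: V_def t_def)
  have t: "has_pd t (deriv t w) (\<i> * deriv t w) w"
    unfolding t_def
    by (rule has_pd_field_derivative[OF holomorphic_derivI[OF holomorphic_deriv[OF assms(2,3)] assms(3,4)]])
  have comp: "has_pd (\<lambda>z. g (\<tau> z)) (Re (t z) * g1 + Im (t z) * g2) (- Im (t z) * g1 + Re (t z) * g2) z"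
    if "z \<in> V" "has_pd g g1 g2 (\<tau> z)" for g g1 g2 z
    using has_pd_compose[OF \<tau>[OF that(1)] has_pd_differentiable[OF that(2)]]
    by (simp add: has_pd_pdx[OF that(2)] has_pd_pdy[OF that(2)])
  note cf = comp[OF _ f]
  note cx = comp[OF V(2) x] and cy = comp[OF V(2) y]
  note Re = has_pd_bounded_linear[OF bounded_linear_Re t] and Im = has_pd_bounded_linear[OF bounded_linear_Im t]
  show ?thesis
    by (rule has_lapI[OF V cf has_pd_add[OF has_pd_mult[OF Re cx] has_pd_mult[OF Im cy]]
          has_pd_add[OF has_pd_mult[OF has_pd_minus[OF Im] cx] has_pd_mult[OF Re cy]]])
      (unfold l t_def[symmetric] cmod_power2, auto simp: V_def algebra_simps power2_eq_square)
qed

section \<open>Charts\<close>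

lemma Ck_on_local:
  assumes "\<And>w. w \<in> S \<Longrightarrow> \<exists>U. open U \<and> w \<in> U \<and> U \<subseteq> S \<and> Ck_on k U f"
  shows "Ck_on k S f"
  using assms
proof (induction k arbitrary: f)
  case 0
  then have "isCont f w" if "w \<in> S" for w
    using that continuous_on_eq_continuous_at by (metis Ck_on.simps(1))
  then show ?case by (simp add: continuous_at_imp_continuous_on)
next
  case (Suc k)
  have "f differentiable at w" if "w \<in> S" for w
    using Suc.prems[OF that] Ck_on_differentiable by blast
  moreover have "Ck_on k S (\<lambda>x. frechet_derivative f (at x) v)" for v
  proof (rule Suc.IH)
    fix w assume "w \<in> S"
    from Suc.prems[OF this] obtain U where "open U" "w \<in> U" "U \<subseteq> S" "Ck_on (Suc k) U f" by blast
    then show "\<exists>U. open U \<and> w \<in> U \<and> U \<subseteq> S \<and> Ck_on k U (\<lambda>x. frechet_derivative f (at x) v)"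
      by auto
  qed
  ultimately show ?case
    by (simp add: differentiable_at_imp_differentiable_on)
qed

lemma smooth_on_local:
  assumes "\<And>w. w \<in> S \<Longrightarrow> \<exists>U. open U \<and> w \<in> U \<and> U \<subseteq> S \<and> smooth_on U f"
  shows "smooth_on S f"
  unfolding smooth_on_def
proof
  show "Ck_on k S f" for k
  proof (rule Ck_on_local)
    fix w assume "w \<in> S"
    from assms[OF this] obtain U where "open U" "w \<in> U" "U \<subseteq> S" "smooth_on U f" by blast
    then show "\<exists>U. open U \<and> w \<in> U \<and> U \<subseteq> S \<and> Ck_on k U f"
      unfolding smooth_on_def by blast
  qed
qed

lemma coord_chartD:
  assumes "coord_chart c"
  shows "open (fst c)" "open (snd c ` fst c)" "inj_on (snd c) (fst c)" "continuous_on (fst c) (snd c)"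
    "continuous_on (snd c ` fst c) (inv_into (fst c) (snd c))"
  using assms unfolding coord_chart_def homeomorphism_def
  by (auto intro: inj_on_inverseI[of _ "inv_into (fst c) (snd c)"])

lemma local_rep_apply:
  "coord_chart c \<Longrightarrow> p \<in> fst c \<Longrightarrow> local_rep c f (snd c p) = f p"
  by (simp add: local_rep_def coord_chartD(3))

lemma coord_chart_open_image:
  assumes "coord_chart c" "open U" "U \<subseteq> fst c"
  shows "open (snd c ` U)"
proof -
  have "snd c ` U = snd c ` fst c \<inter> inv_into (fst c) (snd c) -` U"
    using assms(3) coord_chartD(3)[OF assms(1)] by (auto simp: image_iff)
  then show ?thesis
    using continuous_open_preimage[OF coord_chartD(5,2)[OF assms(1)] assms(2)] by simp
qed

lemma coord_chart_open_preimage: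
  assumes "coord_chart c" "open V"
  shows "open {p \<in> fst c. snd c p \<in> V}"
  using continuous_open_preimage[OF coord_chartD(4,1)[OF assms(1)] assms(2)]
  by (simp add: vimage_def Int_def)

abbreviation coord_ball :: "'a chart \<Rightarrow> 'a \<Rightarrow> real \<Rightarrow> 'a set" where
  "coord_ball c p r \<equiv> {q \<in> fst c. snd c q \<in> ball (snd c p) r}"

lemma coord_chart_disc:
  assumes c: "coord_chart c" "p \<in> fst c" and U: "open U" "p \<in> U"
  obtains r where "0 < r" "cball (snd c p) r \<subseteq> snd c ` (fst c \<inter> U)"
proof -
  have "open (snd c ` (fst c \<inter> U))"
    using coord_chart_open_image[OF c(1)] coord_chartD(1)[OF c(1)] U by auto
  moreover have "snd c p \<in> snd c ` (fst c \<inter> U)" using c U by blast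
  ultimately show thesis using that open_contains_cball by meson
qed

text \<open>A zero cross product makes the partial derivatives linearly dependent, which yields two
  different vectors with the same image.\<close>

lemma injective_imp_cross_nonzero:
  assumes "X differentiable at w" "inj (frechet_derivative X (at w))"
  shows "cross3 (pdx X w) (pdy X w) \<noteq> 0"
proof
  assume 0: "cross3 (pdx X w) (pdy X w) = 0"
  let ?a = "pdx X w" and ?b = "pdy X w"
  note D = frechet_pd[OF assms(1)]
  have "?a \<noteq> 0"
    using injD[OF assms(2), of 1 0] by (auto simp: D)
  have "cross3 ?a (cross3 ?a ?b) = 0" by (simp add: 0)
  then have "(?a \<bullet> ?a) *\<^sub>R ?b = (?a \<bullet> ?b) *\<^sub>R ?a" by (simp add: Lagrange)
  then have "frechet_derivative X (at w) (Complex 0 (?a \<bullet> ?a)) = frechet_derivative X (at w) (Complex (?a \<bullet> ?b) 0)"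
    by (simp add: D)
  from injD[OF assms(2) this] show False using \<open>?a \<noteq> 0\<close> by simp
qed

section \<open>Compatible charts and independence of the chart\<close>

locale oriented_surface =
  fixes A :: "'a::topological_space chart set"
  assumes atlas: "oriented_smooth_atlas A"
begin

lemma atlas_compatible: "c \<in> A \<Longrightarrow> compatible_chart A c"
  using atlas by (simp add: oriented_smooth_atlas_def compatible_chart_def)

lemma atlas_cover: "\<exists>c\<in>A. p \<in> fst c"
  using atlas by (auto simp: oriented_smooth_atlas_def)

lemma chart_at_atlas: "chart_at A p \<in> A" "p \<in> fst (chart_at A p)"
proof -
  have "\<exists>c. c \<in> A \<and> p \<in> fst c" using atlas_cover[of p] by blast
  from someI_ex[OF this] show "chart_at A p \<in> A" "p \<in> fst (chart_at A p)"
    by (simp_all add: chart_at_def)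
qed

lemma compatible_coord: "compatible_chart A c \<Longrightarrow> coord_chart c"
  by (simp add: compatible_chart_def)

abbreviation transition where "transition c d \<equiv> local_rep c (snd d)"

lemma open_overlap:
  assumes "compatible_chart A c" "compatible_chart A d"
  shows "open (snd c ` (fst c \<inter> fst d))"
  using assms compatible_coord coord_chartD(1) by (intro coord_chart_open_image) blast+

lemma atlas_transition:
  assumes "compatible_chart A c" "compatible_chart A d" "c \<in> A \<or> d \<in> A" and p: "p \<in> fst c" "p \<in> fst d"
  shows "smooth_on (snd c ` (fst c \<inter> fst d)) (transition c d)"
    "transition c d differentiable at (snd c p)"
    "0 < jacobian (transition c d) (snd c p)"
proof -
  have o: "oriented_transition c d"
    using assms by (auto simp: compatible_chart_def)
  then show s: "smooth_on (snd c ` (fst c \<inter> fst d)) (transition c d)"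
    by (simp add: oriented_transition_def Let_def)
  show "transition c d differentiable at (snd c p)"
    by (rule smooth_on_differentiable[OF open_overlap[OF assms(1,2)] s]) (use p in blast)
  show "0 < jacobian (transition c d) (snd c p)"
    using o p by (simp add: oriented_transition_def Let_def)
qed

text \<open>Compatibility is defined against charts of \<open>A\<close>, so near \<open>p\<close>
  the transition is factored through a chart of \<open>A\<close> containing \<open>p\<close>;
  Jacobians multiply.\<close>

lemma compatible_transition:
  assumes c: "compatible_chart A c" and d: "compatible_chart A d" and p: "p \<in> fst c" "p \<in> fst d"
  shows "transition c d differentiable at (snd c p)"
    "0 < jacobian (transition c d) (snd c p)"
proof -
  obtain e where e: "e \<in> A" "p \<in> fst e" using atlas_cover by blast
  note ec = atlas_compatible[OF e(1)]
  define w where "w = snd c p"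
  have W: "open (snd c ` (fst c \<inter> fst d \<inter> fst e))"
    using c d ec compatible_coord coord_chartD(1) by (intro coord_chart_open_image) blast+
  have wW: "w \<in> snd c ` (fst c \<inter> fst d \<inter> fst e)" using p e by (simp add: w_def)
  have tw: "transition c e w = snd e p"
    using local_rep_apply[OF compatible_coord[OF c] p(1)] by (simp add: w_def)
  define \<sigma> \<rho> where "\<sigma> = transition c e" and "\<rho> = transition e d"
  have 1: "has_pd \<sigma> (pdx \<sigma> w) (pdy \<sigma> w) w"
    unfolding \<sigma>_def w_def by (rule differentiable_has_pd[OF atlas_transition(2)[OF c ec _ p(1) e(2)]]) (use e in blast)
  have 2: "\<rho> differentiable at (\<sigma> w)"
    unfolding \<rho>_def \<sigma>_def tw by (rule atlas_transition(2)[OF ec d _ e(2) p(2)]) (use e in blast)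
  have 3: "has_pd (transition c d)
      (Re (pdx \<sigma> w) *\<^sub>R pdx \<rho> (\<sigma> w) + Im (pdx \<sigma> w) *\<^sub>R pdy \<rho> (\<sigma> w))
      (Re (pdy \<sigma> w) *\<^sub>R pdx \<rho> (\<sigma> w) + Im (pdy \<sigma> w) *\<^sub>R pdy \<rho> (\<sigma> w)) w"
  proof (rule has_pd_cong_open[OF has_pd_compose[OF 1 2] W wW])
    fix z assume "z \<in> snd c ` (fst c \<inter> fst d \<inter> fst e)"
    then obtain q where "z = snd c q" "q \<in> fst c" "q \<in> fst d" "q \<in> fst e" by blast
    then show "\<rho> (\<sigma> z) = transition c d z"
      using c ec compatible_coord by (simp add: \<rho>_def \<sigma>_def local_rep_apply)
  qed
  then show "transition c d differentiable at (snd c p)"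
    unfolding w_def by (rule has_pd_differentiable)
  have J1: "0 < jacobian \<sigma> w"
    unfolding \<sigma>_def w_def by (rule atlas_transition(3)[OF c ec _ p(1) e(2)]) (use e in blast)
  have J2: "0 < jacobian \<rho> (\<sigma> w)"
    unfolding \<rho>_def \<sigma>_def tw by (rule atlas_transition(3)[OF ec d _ e(2) p(2)]) (use e in blast)
  show "0 < jacobian (transition c d) (snd c p)"
    using mult_pos_pos[OF J1 J2] unfolding w_def[symmetric] has_pd_pdx[OF 3] has_pd_pdy[OF 3]
    by (simp add: algebra_simps)
qed

lemma reparametrization_charts:
  assumes c: "compatible_chart A c" and d: "compatible_chart A d"
    and "parametrized_surface (snd d ` fst d) (local_rep d x)"
  shows "reparametrization (snd d ` fst d) (local_rep d x) (snd c ` (fst c \<inter> fst d)) (transition c d) (local_rep c x)"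
proof -
  interpret parametrized_surface "snd d ` fst d" "local_rep d x" by fact
  show ?thesis
  proof
    fix w assume "w \<in> snd c ` (fst c \<inter> fst d)"
    then obtain p where p: "w = snd c p" "p \<in> fst c" "p \<in> fst d" by blast
    have t: "transition c d w = snd d p"
      using local_rep_apply[OF compatible_coord[OF c] p(2)] by (simp add: p)
    show "transition c d w \<in> snd d ` fst d" using t p by simp
    show "local_rep c x w = local_rep d x (transition c d w)"
      unfolding t using local_rep_apply[OF compatible_coord[OF c] p(2), of x]
        local_rep_apply[OF compatible_coord[OF d] p(3), of x] by (simp add: p)
    show "transition c d differentiable at w"
      "0 < jacobian (transition c d) w"
      using compatible_transition[OF c d p(2,3)] by (simp_all add: p)
  qed (rule open_overlap[OF c d])
qed

lemma atlas_surface: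
  assumes "smooth_immersion A x" "c \<in> A"
  shows "parametrized_surface (snd c ` fst c) (local_rep c x)"
proof
  show o: "open (snd c ` fst c)"
    using coord_chartD(2)[OF compatible_coord[OF atlas_compatible[OF assms(2)]]] .
  show s: "smooth_on (snd c ` fst c) (local_rep c x)"
    using assms by (simp add: smooth_immersion_def)
  show "cross3 (pdx (local_rep c x) w) (pdy (local_rep c x) w) \<noteq> 0" if "w \<in> snd c ` fst c" for w
    by (rule injective_imp_cross_nonzero[OF smooth_on_differentiable[OF o s that]])
      (use assms that in \<open>auto simp: smooth_immersion_def\<close>)
qed

lemma compatible_surface:
  assumes im: "smooth_immersion A x" and c: "compatible_chart A c"
  shows "parametrized_surface (snd c ` fst c) (local_rep c x)"
proof
  show "open (snd c ` fst c)"
    using coord_chartD(2)[OF compatible_coord[OF c]] .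
  have loc: "\<exists>U. open U \<and> w \<in> U \<and> U \<subseteq> snd c ` fst c \<and> smooth_on U (local_rep c x) \<and>
      cross3 (pdx (local_rep c x) w) (pdy (local_rep c x) w) \<noteq> 0" if w: "w \<in> snd c ` fst c" for w
  proof -
    obtain p where p: "w = snd c p" "p \<in> fst c" using w by blast
    obtain e where e: "e \<in> A" "p \<in> fst e" using atlas_cover by blast
    note ec = atlas_compatible[OF e(1)]
    interpret r: reparametrization "snd e ` fst e" "local_rep e x" "snd c ` (fst c \<inter> fst e)" "transition c e" "local_rep c x"
      by (rule reparametrization_charts[OF c ec atlas_surface[OF im e(1)]])
    have wU: "w \<in> snd c ` (fst c \<inter> fst e)" using p e by blast
    have "smooth_on (snd c ` (fst c \<inter> fst e)) (\<lambda>z. local_rep e x (transition c e z))"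
      by (rule smooth_on_compose[OF r.open_dom r.X.open_S _ r.X.smooth_X
            atlas_transition(1)[OF c ec _ p(2) e(2)]]) (use e r.maps in auto)
    then have "smooth_on (snd c ` (fst c \<inter> fst e)) (local_rep c x)"
      by (rule smooth_on_cong[OF r.open_dom, rotated]) (simp add: r.Y_eq)
    moreover have "cross3 (pdx (local_rep c x) w) (pdy (local_rep c x) w) \<noteq> 0"
      unfolding r.cross_Y[OF wU] using r.orient[OF wU] r.X.regular[OF r.maps[OF wU]] by simp
    ultimately show ?thesis using r.open_dom wU by blast
  qed
  show "smooth_on (snd c ` fst c) (local_rep c x)"
    by (rule smooth_on_local) (use loc in blast)
  show "cross3 (pdx (local_rep c x) w) (pdy (local_rep c x) w) \<noteq> 0" if "w \<in> snd c ` fst c" for w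
    using loc[OF that] by blast
qed

lemma reparametrization_compatible:
  assumes "smooth_immersion A x" "compatible_chart A c" "compatible_chart A d"
  shows "reparametrization (snd d ` fst d) (local_rep d x) (snd c ` (fst c \<inter> fst d)) (transition c d) (local_rep c x)"
  by (rule reparametrization_charts[OF assms(2,3) compatible_surface[OF assms(1,3)]])

lemma transition_apply:
  "compatible_chart A c \<Longrightarrow> p \<in> fst c \<Longrightarrow> transition c d (snd c p) = snd d p"
  using local_rep_apply[OF compatible_coord] by blast

text \<open>Frees the mean curvature from the arbitrary \<open>chart_at\<close>.\<close>

lemma mean_curvature_chart:
  assumes "smooth_immersion A x" "compatible_chart A c" "p \<in> fst c"
  shows "mean_curvature A x p = local_mean_curvature (local_rep c x) (snd c p)"
proof -
  define d where "d = chart_at A p"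
  have d: "compatible_chart A d" "p \<in> fst d"
    using chart_at_atlas atlas_compatible by (auto simp: d_def)
  interpret r: reparametrization "snd d ` fst d" "local_rep d x" "snd c ` (fst c \<inter> fst d)" "transition c d" "local_rep c x"
    by (rule reparametrization_compatible[OF assms(1,2) d(1)])
  show ?thesis
    using r.mean_curvature_Y[of "snd c p"] assms d transition_apply[OF assms(2,3), of d]
    by (simp add: mean_curvature_def Let_def d_def[symmetric])
qed

lemma complex_chart_compatible: "complex_chart A x c u \<Longrightarrow> compatible_chart A c"
  by (simp add: complex_chart_def)

lemma complex_chart_coord: "complex_chart A x c u \<Longrightarrow> coord_chart c"
  by (rule compatible_coord[OF complex_chart_compatible])

lemma complex_chart_surface:
  assumes "smooth_immersion A x" "complex_chart A x c u"
  shows "conformal_surface (snd c ` fst c) (local_rep c x) u"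
proof -
  interpret parametrized_surface "snd c ` fst c" "local_rep c x"
    by (rule compatible_surface[OF assms(1) complex_chart_compatible[OF assms(2)]])
  show ?thesis
    by unfold_locales (use assms(2) open_S smooth_X in \<open>auto simp: complex_chart_def\<close>)
qed

text \<open>\<open>same_induced_metric\<close> speaks of charts of \<open>A\<close> only. Pushing
  tangent vectors forward to such a chart transfers the equality to \<open>c\<close>, so complex
  charts are common to both immersions.\<close>

lemma complex_chart_mate:
  assumes im: "smooth_immersion A x" "smooth_immersion A x'" and same: "same_induced_metric A x x'"
    and c: "complex_chart A x c u"
  shows "complex_chart A x' c u"
  unfolding complex_chart_def
proof (intro conjI ballI allI)
  note cc = complex_chart_compatible[OF c]
  show "compatible_chart A c" "smooth_on (snd c ` fst c) u" using c by (simp_all add: complex_chart_def)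
  fix w a b assume "w \<in> snd c ` fst c"
  then obtain p where p: "w = snd c p" "p \<in> fst c" by blast
  obtain e where e: "e \<in> A" "p \<in> fst e" using atlas_cover by blast
  note ec = atlas_compatible[OF e(1)]
  interpret r: reparametrization "snd e ` fst e" "local_rep e x" "snd c ` (fst c \<inter> fst e)" "transition c e" "local_rep c x"
    by (rule reparametrization_compatible[OF im(1) cc ec])
  interpret r': reparametrization "snd e ` fst e" "local_rep e x'" "snd c ` (fst c \<inter> fst e)" "transition c e" "local_rep c x'"
    by (rule reparametrization_compatible[OF im(2) cc ec])
  have w: "w \<in> snd c ` (fst c \<inter> fst e)" using p e by blast
  have "first_form (local_rep c x') w a b = first_form (local_rep c x) w a b"
    unfolding r.first_form_Y[OF w] r'.first_form_Y[OF w]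
    using same e(1) r.maps[OF w] unfolding same_induced_metric_def r.push_def r'.push_def by blast
  then show "first_form (local_rep c x') w a b = exp (2 * u w) * (a \<bullet> b)"
    using c p by (simp add: complex_chart_def)
qed

lemma complex_transition:
  assumes im: "smooth_immersion A x" and c: "complex_chart A x c u" and d: "complex_chart A x d v"
    and p: "p \<in> fst c" "p \<in> fst d"
  shows "pdy (transition c d) (snd c p) = \<i> * pdx (transition c d) (snd c p)"
    "pdx (transition c d) (snd c p) \<noteq> 0"
    "hopf_coeff (local_rep c x) (snd c p)
       = (pdx (transition c d) (snd c p))\<^sup>2 * hopf_coeff (local_rep d x) (snd d p)"
proof -
  note cc = complex_chart_compatible[OF c] and dc = complex_chart_compatible[OF d]
  interpret r: reparametrization "snd d ` fst d" "local_rep d x" "snd c ` (fst c \<inter> fst d)" "transition c d" "local_rep c x"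
    by (rule reparametrization_compatible[OF im cc dc])
  have w: "snd c p \<in> snd c ` (fst c \<inter> fst d)" using p by blast
  have 1: "\<And>a b. first_form (local_rep c x) (snd c p) a b = exp (2 * u (snd c p)) * (a \<bullet> b)"
    using c p by (simp add: complex_chart_def)
  have 2: "\<And>a b. first_form (local_rep d x) (transition c d (snd c p)) a b = exp (2 * v (snd d p)) * (a \<bullet> b)"
    using d p by (simp add: complex_chart_def transition_apply[OF cc p(1)])
  show "pdy (transition c d) (snd c p) = \<i> * pdx (transition c d) (snd c p)"
    "pdx (transition c d) (snd c p) \<noteq> 0"
    "hopf_coeff (local_rep c x) (snd c p)
       = (pdx (transition c d) (snd c p))\<^sup>2 * hopf_coeff (local_rep d x) (snd d p)"
    using r.conformal_transition[OF w 1 2] transition_apply[OF cc p(1), of d] by simp_all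
qed

lemma complex_transition_holomorphic:
  assumes "smooth_immersion A x" "complex_chart A x c u" "complex_chart A x d v"
  shows "transition c d holomorphic_on (snd c ` (fst c \<inter> fst d))"
proof (rule has_pd_holomorphic)
  note cc = complex_chart_compatible[OF assms(2)] and dc = complex_chart_compatible[OF assms(3)]
  show "open (snd c ` (fst c \<inter> fst d))" by (rule open_overlap[OF cc dc])
  fix w assume "w \<in> snd c ` (fst c \<inter> fst d)"
  then obtain p where p: "w = snd c p" "p \<in> fst c" "p \<in> fst d" by blast
  show "\<exists>a. has_pd (transition c d) a (\<i> * a) w"
    using differentiable_has_pd[OF compatible_transition(1)[OF cc dc p(2,3)]] complex_transition(1)[OF assms p(2,3)]
    unfolding p(1) by metis
qed

text \<open>The factor is positive, so the sign of a Laplacian has a meaning on the surface.\<close>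

lemma has_lap_complex_chart:
  assumes im: "smooth_immersion A x" and c: "complex_chart A x c u" and d: "complex_chart A x d v"
    and p: "p \<in> fst c" "p \<in> fst d" and f: "has_lap (local_rep d f) l (snd d p)"
  shows "has_lap (local_rep c f) ((norm (pdx (transition c d) (snd c p)))\<^sup>2 * l) (snd c p)"
proof -
  note cc = complex_chart_compatible[OF c] and dc = complex_chart_compatible[OF d]
  let ?W = "snd c ` (fst c \<inter> fst d)"
  note hol = complex_transition_holomorphic[OF im c d]
  note o = open_overlap[OF cc dc]
  have w: "snd c p \<in> ?W" using p by blast
  have l1: "has_lap (\<lambda>z. local_rep d f (transition c d z)) ((norm (deriv (transition c d) (snd c p)))\<^sup>2 * l) (snd c p)"
    by (rule has_lap_compose_holomorphic[OF _ hol o w]) (use f in \<open>simp add: transition_apply[OF cc p(1)]\<close>)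
  have der: "deriv (transition c d) (snd c p) = pdx (transition c d) (snd c p)"
    using has_pd_pdx[OF has_pd_field_derivative[OF holomorphic_derivI[OF hol o w]]] by simp
  have eq: "local_rep d f (transition c d z) = local_rep c f z" if z: "z \<in> ?W" for z
  proof -
    obtain q where q: "z = snd c q" "q \<in> fst c" "q \<in> fst d" using z by blast
    have "local_rep d f (transition c d z) = f q"
      unfolding q(1) transition_apply[OF cc q(2)] by (rule local_rep_apply[OF compatible_coord[OF dc] q(3)])
    also have "f q = local_rep c f z"
      unfolding q(1) by (rule local_rep_apply[OF compatible_coord[OF cc] q(2), symmetric])
    finally show ?thesis .
  qed
  show ?thesis by (rule has_lap_cong[OF l1[unfolded der] o w eq])
qed

end

section \<open>Bounded subharmonic functions on a punctured closed surface\<close>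

text \<open>Stated for arbitrary parametrizations because a bound on H is needed near umbilic
  points, where no complex chart is at hand. The denominator is twice the squared norm of the cross
  product.\<close>

lemma (in parametrized_surface) continuous_local_mean_curvature:
  "continuous_on S (local_mean_curvature X)"
proof -
  have c: "continuous_on S (pdx X)" "continuous_on S (pdy X)"
    by (intro smooth_on_continuous smooth_on_pdx smooth_on_pdy smooth_X)+
  have LMN: "continuous_on S L" "continuous_on S M" "continuous_on S N"
    by (intro continuous_at_imp_continuous_on ballI, erule has_pd_isCont[OF pd_L] has_pd_isCont[OF pd_M] has_pd_isCont[OF pd_N])+
  have nz: "2 * ((pdx X w \<bullet> pdx X w) * (pdy X w \<bullet> pdy X w) - (pdx X w \<bullet> pdy X w)\<^sup>2) \<noteq> 0" if "w \<in> S" for w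
  proof -
    have "0 < (norm (cross3 (pdx X w) (pdy X w)))\<^sup>2" using regular[OF that] by simp
    then show ?thesis unfolding norm_cross power2_norm_eq_inner[symmetric] by auto
  qed
  have "continuous_on S (\<lambda>w. ((pdx X w \<bullet> pdx X w) * N w - 2 * (pdx X w \<bullet> pdy X w) * M w + (pdy X w \<bullet> pdy X w) * L w)
      / (2 * ((pdx X w \<bullet> pdx X w) * (pdy X w \<bullet> pdy X w) - (pdx X w \<bullet> pdy X w)\<^sup>2)))"
    by (intro continuous_intros c LMN) (use nz in blast)
  then show ?thesis
    by (rule continuous_on_eq) (simp add: local_mean_curvature_def Let_def first_form_eq second_form_eq)
qed

text \<open>The differential expands lengths by at least \<open>B\<close>, while the remainder is at
  most half of that. For an immersion this makes \<open>p\<close> the only pole of the barrier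
  nearby.\<close>

lemma injective_derivative_locally_injective:
  fixes f :: "'b::euclidean_space \<Rightarrow> 'c::euclidean_space"
  assumes "f differentiable at w" "inj (frechet_derivative f (at w))"
  obtains d where "0 < d" "\<And>z. norm (z - w) < d \<Longrightarrow> z \<noteq> w \<Longrightarrow> f z \<noteq> f w"
proof -
  define D where "D = frechet_derivative f (at w)"
  have D: "(f has_derivative D) (at w)"
    using assms(1) by (simp add: D_def frechet_derivative_works)
  obtain B where B: "B > 0" "\<And>v. B * norm v \<le> norm (D v)"
    using linear_inj_bounded_below_pos[OF has_derivative_linear[OF D] assms(2)[folded D_def]] by blast
  obtain d where d: "d > 0" "\<And>z. norm (z - w) < d \<Longrightarrow> norm (f z - f w - D (z - w)) \<le> B / 2 * norm (z - w)"
    using D[unfolded has_derivative_at_alt] half_gt_zero[OF B(1)] by blast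
  show thesis
  proof (rule that[OF d(1)])
    fix z assume z: "norm (z - w) < d" "z \<noteq> w"
    show "f z \<noteq> f w"
    proof
      assume "f z = f w"
      then have "B * norm (z - w) \<le> B / 2 * norm (z - w)"
        using d(2)[OF z(1)] B(2)[of "z - w"] by simp
      then show False using B(1) z(2) by simp
    qed
  qed
qed

section \<open>Continuity and local topology on the surface\<close>

locale hausdorff_surface = oriented_surface A for A :: "'a::t2_space chart set"
begin

lemma continuous_mean_curvature:
  assumes "smooth_immersion A x"
  shows "isCont (mean_curvature A x) p"
proof -
  obtain e where e: "e \<in> A" "p \<in> fst e" using atlas_cover by blast
  note ec = atlas_compatible[OF e(1)]
  interpret parametrized_surface "snd e ` fst e" "local_rep e x" by (rule atlas_surface[OF assms e(1)])
  have "continuous_on (fst e) (\<lambda>q. local_mean_curvature (local_rep e x) (snd e q))"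
    by (rule continuous_on_compose2[OF continuous_local_mean_curvature
          coord_chartD(4)[OF compatible_coord[OF ec]]]) blast
  then have "continuous_on (fst e) (mean_curvature A x)"
    by (rule continuous_on_eq) (simp add: mean_curvature_chart[OF assms ec])
  then show ?thesis
    using continuous_on_eq_continuous_at[OF coord_chartD(1)[OF compatible_coord[OF ec]]] e(2) by blast
qed

lemma isCont_of_local_rep:
  assumes "compatible_chart A c" "p \<in> fst c" "isCont (local_rep c f) (snd c p)"
  shows "isCont f p"
proof -
  note cc = compatible_coord[OF assms(1)]
  have "isCont (snd c) p"
    using continuous_on_eq_continuous_at[OF coord_chartD(1)[OF cc]] coord_chartD(4)[OF cc] assms(2) by blast
  then have 1: "isCont (\<lambda>q. local_rep c f (snd c q)) p"
    by (rule isCont_o2) (rule assms(3))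
  have "\<forall>\<^sub>F q in nhds p. local_rep c f (snd c q) = f q"
    using coord_chartD(1)[OF cc] assms(2) local_rep_apply[OF cc]
    by (auto simp: eventually_nhds)
  from isCont_cong[OF this] 1 show ?thesis by blast
qed

lemma isCont_immersion:
  assumes "smooth_immersion A x"
  shows "isCont x p"
proof -
  obtain e where e: "e \<in> A" "p \<in> fst e" using atlas_cover by blast
  interpret parametrized_surface "snd e ` fst e" "local_rep e x" by (rule atlas_surface[OF assms e(1)])
  show ?thesis
    by (rule isCont_of_local_rep[OF atlas_compatible[OF e(1)] e(2) has_pd_isCont[OF pd_X]]) (use e in blast)
qed

lemma immersion_locally_injective:
  assumes im: "smooth_immersion A x"
  obtains U where "open U" "p \<in> U" "\<And>q. q \<in> U \<Longrightarrow> q \<noteq> p \<Longrightarrow> x q \<noteq> x p"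
proof -
  obtain e where e: "e \<in> A" "p \<in> fst e" using atlas_cover by blast
  note ec = compatible_coord[OF atlas_compatible[OF e(1)]]
  interpret parametrized_surface "snd e ` fst e" "local_rep e x" by (rule atlas_surface[OF im e(1)])
  have w: "snd e p \<in> snd e ` fst e" using e by blast
  have i: "inj (frechet_derivative (local_rep e x) (at (snd e p)))"
    using im e w by (auto simp: smooth_immersion_def)
  obtain d where d: "0 < d" "\<And>z. norm (z - snd e p) < d \<Longrightarrow> z \<noteq> snd e p \<Longrightarrow> local_rep e x z \<noteq> local_rep e x (snd e p)"
    using injective_derivative_locally_injective[OF has_pd_differentiable[OF pd_X[OF w]] i] by blast
  show thesis
  proof (rule that)
    show "open (coord_ball e p d)"
      by (rule coord_chart_open_preimage[OF ec open_ball])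
    show "p \<in> coord_ball e p d" using e d by simp
    fix q assume q: "q \<in> coord_ball e p d" "q \<noteq> p"
    then have "snd e q \<noteq> snd e p" using coord_chartD(3)[OF ec] e(2) by (auto simp: inj_on_def)
    then have "local_rep e x (snd e q) \<noteq> local_rep e x (snd e p)"
      using q by (intro d(2)) (auto simp: dist_norm norm_minus_commute)
    then show "x q \<noteq> x p" using q e local_rep_apply[OF ec, of _ x] by auto
  qed
qed

text \<open>Coordinate discs give neighbourhoods that remain connected when punctured, a feature of
  dimension two. The compact \<open>K\<close> serves to attain maxima.\<close>

lemma compact_disc_around:
  fixes p :: 'a
  assumes "open U" "p \<in> U"
  obtains B K where "open B" "compact K" "p \<in> B" "B \<subseteq> K" "K \<subseteq> U" "connected (B - {p})"
proof -
  obtain e where e: "e \<in> A" "p \<in> fst e" using atlas_cover by blast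
  note ec = compatible_coord[OF atlas_compatible[OF e(1)]]
  define g where "g = inv_into (fst e) (snd e)"
  have g: "g (snd e q) = q" if "q \<in> fst e" for q
    using that coord_chartD(3)[OF ec] by (simp add: g_def)
  obtain r where r: "0 < r" "cball (snd e p) r \<subseteq> snd e ` (fst e \<inter> U)"
    using coord_chart_disc[OF ec e(2) assms] by blast
  have gc: "continuous_on (cball (snd e p) r) g"
    unfolding g_def by (rule continuous_on_subset[OF coord_chartD(5)[OF ec]]) (use r in blast)
  define B where "B = coord_ball e p r"
  have BK: "B = g ` ball (snd e p) r"
  proof
    show "B \<subseteq> g ` ball (snd e p) r" using g by (force simp: B_def)
    show "g ` ball (snd e p) r \<subseteq> B"
    proof
      fix q assume "q \<in> g ` ball (snd e p) r"
      then obtain z where z: "z \<in> ball (snd e p) r" "q = g z" by blast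
      then obtain q' where q': "z = snd e q'" "q' \<in> fst e" using r(2) ball_subset_cball by blast
      then show "q \<in> B" using z g[OF q'(2)] by (simp add: B_def)
    qed
  qed
  have "B - {p} = g ` (ball (snd e p) r - {snd e p})"
  proof -
    have "inj_on g (ball (snd e p) r)"
      by (rule inj_on_inverseI[of _ "snd e"])
        (use r(2) ball_subset_cball g in \<open>force simp: subset_iff\<close>)
    then show ?thesis
      unfolding BK using inj_on_image_set_diff[of g "ball (snd e p) r" "ball (snd e p) r" "{snd e p}"] r(1) g[OF e(2)] by simp
  qed
  moreover have "connected (g ` (ball (snd e p) r - {snd e p}))"
    by (intro connected_continuous_image continuous_on_subset[OF gc] connected_open_delete) auto
  ultimately have "connected (B - {p})" by simp
  moreover have "open B" unfolding B_def by (rule coord_chart_open_preimage[OF ec open_ball])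
  moreover have "compact (g ` cball (snd e p) r)"
    by (rule compact_continuous_image[OF gc compact_cball])
  moreover have "p \<in> B" using e r by (simp add: B_def)
  moreover have "B \<subseteq> g ` cball (snd e p) r" using BK by auto
  moreover have "g ` cball (snd e p) r \<subseteq> U" using r(2) g by (force simp: subset_iff image_iff)
  ultimately show thesis using that by blast
qed

lemma singleton_not_open: "\<not> open {p :: 'a}"
proof
  assume o: "open {p}"
  obtain e where e: "e \<in> A" "p \<in> fst e" using atlas_cover by blast
  have "open (snd e ` {p})"
    by (rule coord_chart_open_image[OF compatible_coord[OF atlas_compatible[OF e(1)]] o]) (use e in simp)
  then show False using not_open_singleton[of "snd e p"] by simp
qed

end

section \<open>The closed surface without a discrete set\<close>

locale punctured_closed_surface = hausdorff_surface A
  for A :: "'a::t2_space chart set" +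
  fixes D N :: "'a set"
  assumes compact_surface: "compact (UNIV :: 'a set)" and connected_surface: "connected (UNIV :: 'a set)"
    and N_eq: "N = - D" and open_N: "open N" and discrete_D: "discrete D"
begin

lemma isolated_D:
  assumes "p \<in> D"
  obtains U where "open U" "p \<in> U" "U - {p} \<subseteq> N"
  using discreteD[OF discrete_D assms] unfolding isolated_in_def N_eq by blast

lemma N_nonempty_in:
  assumes "open V" "V \<noteq> {}"
  shows "V \<inter> N \<noteq> {}"
proof
  assume e: "V \<inter> N = {}"
  obtain p where p: "p \<in> V" using assms by blast
  then have "p \<in> D" using e by (auto simp: N_eq)
  then obtain U where "open U" "p \<in> U" "U - {p} \<subseteq> N" using isolated_D by blast
  then have "V \<inter> U = {p}" "open (V \<inter> U)" using p e assms(1) by auto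
  then show False using singleton_not_open by metis
qed

text \<open>Connectedness of \<open>N\<close>. A punctured disc about a point of \<open>D\<close> is
  connected and so lies on one side of the splitting; the point can be assigned to that side, which
  would split the whole surface.\<close>

lemma clopen_in_N:
  assumes S: "S \<subseteq> N" "open S" "open (N - S)" "S \<noteq> {}"
  shows "S = N"
proof -
  \<comment> \<open>\<open>P R\<close> fills in the punctures that are surrounded by
    \<open>R\<close>.\<close>
  define P where "P R = R \<union> {p \<in> D. \<exists>U. open U \<and> p \<in> U \<and> U - {p} \<subseteq> R}" for R
  have oP: "open (P R)" if "open R" for R
  proof (subst open_subopen, intro ballI)
    fix p assume "p \<in> P R"
    then consider "p \<in> R" | U where "p \<in> D" "open U" "p \<in> U" "U - {p} \<subseteq> R" by (auto simp: P_def)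
    then show "\<exists>T. open T \<and> p \<in> T \<and> T \<subseteq> P R"
    proof cases
      case 1
      then show ?thesis using that by (auto simp: P_def)
    next
      case 2
      then have "U \<subseteq> P R" by (auto simp: P_def)
      then show ?thesis using 2 by blast
    qed
  qed
  have cover: "P S \<union> P (N - S) = UNIV"
  proof (intro set_eqI iffI UNIV_I)
    fix p
    show "p \<in> P S \<union> P (N - S)"
    proof (cases "p \<in> D")
      case False
      then show ?thesis by (auto simp: P_def N_eq)
    next
      case True
      obtain U where U: "open U" "p \<in> U" "U - {p} \<subseteq> N" using isolated_D[OF True] by blast
      obtain B K where B: "open B" "compact K" "p \<in> B" "B \<subseteq> K" "K \<subseteq> U" "connected (B - {p})"
        by (rule compact_disc_around[OF U(1,2)])
      have "B - {p} \<subseteq> S \<union> (N - S)" using B U by blast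
      moreover have "S \<inter> (N - S) \<inter> (B - {p}) = {}" by blast
      ultimately have "S \<inter> (B - {p}) = {} \<or> (N - S) \<inter> (B - {p}) = {}"
        using connectedD[OF B(6) S(2,3)] by simp
      then have "B - {p} \<subseteq> S \<or> B - {p} \<subseteq> N - S"
        using \<open>B - {p} \<subseteq> S \<union> (N - S)\<close> by blast
      then show ?thesis using True B by (auto simp: P_def)
    qed
  qed
  have disj: "P S \<inter> P (N - S) = {}"
  proof (rule ccontr)
    assume "P S \<inter> P (N - S) \<noteq> {}"
    then obtain p where p: "p \<in> P S" "p \<in> P (N - S)" by blast
    then have "p \<in> D" using S(1) by (auto simp: P_def N_eq)
    then have "p \<notin> S" "p \<notin> N - S" using S(1) by (auto simp: N_eq)
    then have "\<exists>U. open U \<and> p \<in> U \<and> U - {p} \<subseteq> S" "\<exists>V. open V \<and> p \<in> V \<and> V - {p} \<subseteq> N - S"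
      using p unfolding P_def by blast+
    then obtain U V where "open U" "p \<in> U" "U - {p} \<subseteq> S" "open V" "p \<in> V" "V - {p} \<subseteq> N - S"
      by blast
    then have "open (U \<inter> V)" "U \<inter> V = {p}" by auto
    then show False using singleton_not_open by metis
  qed
  have "P S = {} \<or> P (N - S) = {}"
    using connectedD[OF connected_surface oP[OF S(2)] oP[OF S(3)]] disj cover by auto
  then have "P (N - S) = {}" using S(4) by (auto simp: P_def)
  then show ?thesis using S(1) by (auto simp: P_def)
qed

text \<open>
  The barrier \<open>ln \<rho>\<^sup>2 + C (\<rho>\<^sup>2 - 1)\<close>, with \<open>\<rho>\<close> the distance to \<open>x p\<close> in the ambient space,
  is subharmonic near \<open>p\<close> and tends to minus infinity at \<open>p\<close>.
\<close>

lemma barrier_has_lap: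
  assumes im: "smooth_immersion A x" and c: "complex_chart A x c u" and q: "q \<in> fst c"
    and "x q \<noteq> P" "\<bar>mean_curvature A x q\<bar> \<le> h" "h * norm (x q - P) \<le> 1 / 2" "h\<^sup>2 < 2 * C"
  shows "\<exists>l>0. has_lap (local_rep c (\<lambda>q. ln ((norm (x q - P))\<^sup>2) + C * ((norm (x q - P))\<^sup>2 - 1))) l (snd c q)"
proof -
  interpret conformal_surface "snd c ` fst c" "local_rep c x" u
    by (rule complex_chart_surface[OF im c])
  define w where "w = snd c q"
  have w: "w \<in> snd c ` fst c" using q by (simp add: w_def)
  note cc = complex_chart_compatible[OF c]
  have xw: "local_rep c x w = x q" using local_rep_apply[OF compatible_coord[OF cc] q] by (simp add: w_def)
  have Hw: "H w = mean_curvature A x q" using mean_curvature_chart[OF im cc q] by (simp add: w_def)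
  obtain l where l: "has_lap (\<lambda>z. ln ((norm (local_rep c x z - P))\<^sup>2)) l w" "- (E w * (H w)\<^sup>2) \<le> l"
    using has_lap_ln_dist[OF w, of P] assms(4) by (auto simp: xw)
  have "\<bar>H w * ((x q - P) \<bullet> n w)\<bar> \<le> h * norm (x q - P)"
  proof -
    have "\<bar>(x q - P) \<bullet> n w\<bar> \<le> norm (x q - P) * norm (n w)" by (rule Cauchy_Schwarz_ineq2)
    moreover have "norm (n w) = 1" using n_n[OF w] by (simp add: norm_eq_1)
    ultimately show ?thesis
      unfolding abs_mult using assms(5) by (intro mult_mono) (auto simp: Hw)
  qed
  \<comment> \<open>Near the pole the Laplacian of the squared distance is thus at least 2 E, and
    \<open>C\<close> times it outweighs the possible loss \<open>E w * (H w)\<^sup>2\<close> of the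
    logarithm.\<close>
  then have s: "1 / 2 \<le> 1 + H w * ((x q - P) \<bullet> n w)" using assms(6) by linarith
  have "(H w)\<^sup>2 \<le> h\<^sup>2" using power_mono[OF assms(5), of 2] by (simp add: Hw)
  then have C: "(H w)\<^sup>2 < 2 * C" using assms(7) by linarith
  have "C > 0" using C zero_le_power2[of "H w"] by linarith
  have "2 * (C * E w) = C * (4 * E w * (1 / 2))" by simp
  also have "\<dots> \<le> C * (4 * E w * (1 + H w * ((x q - P) \<bullet> n w)))"
    using s E_pos[of w] \<open>C > 0\<close> by (intro mult_left_mono) auto
  finally have "2 * (C * E w) \<le> C * (4 * E w * (1 + H w * ((x q - P) \<bullet> n w)))" .
  moreover have "E w * (H w)\<^sup>2 < E w * (2 * C)" using C E_pos[of w] by (rule mult_strict_left_mono)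
  then have "E w * (H w)\<^sup>2 < 2 * (C * E w)" by (simp only: ac_simps)
  ultimately have "0 < l + C * (4 * E w * (1 + H w * ((x q - P) \<bullet> n w)))" using l(2) by linarith
  then have "0 < l + C * (4 * E w * (1 + H w * ((x q - P) \<bullet> n w)) + 0)" by simp
  moreover have "has_lap (\<lambda>z. ln ((norm (local_rep c x z - P))\<^sup>2) + C * ((norm (local_rep c x z - P))\<^sup>2 + - 1))
      (l + C * (4 * E w * (1 + H w * ((x q - P) \<bullet> n w)) + 0)) w"
    using has_lap_dist[OF w, of P] unfolding xw
    by (intro has_lap_add[OF l(1)] has_lap_cmult has_lap_add has_lap_const)
  moreover have "local_rep c (\<lambda>q. ln ((norm (x q - P))\<^sup>2) + C * ((norm (x q - P))\<^sup>2 - 1))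
      = (\<lambda>z. ln ((norm (local_rep c x z - P))\<^sup>2) + C * ((norm (local_rep c x z - P))\<^sup>2 + - 1))"
    by (simp add: local_rep_def fun_eq_iff)
  ultimately show ?thesis by (auto simp: w_def)
qed

text \<open>A small multiple of the barrier pushes the maximum away from the puncture and makes the
  Laplacian strictly positive, so no maximum above \<open>m\<close> can occur in the interior
  either. Only the rim \<open>K - B\<close> remains.\<close>

lemma punctured_disc_maximum_principle:
  assumes im: "smooth_immersion A x"
    and p: "open B" "compact K" "p \<in> B" "B \<subseteq> K" "K - {p} \<subseteq> N"
    and inj: "\<And>q. q \<in> K \<Longrightarrow> q \<noteq> p \<Longrightarrow> x q \<noteq> x p"
    and h: "\<And>q. q \<in> K \<Longrightarrow> \<bar>mean_curvature A x q\<bar> \<le> h" "\<And>q. q \<in> K \<Longrightarrow> h * norm (x q - x p) \<le> 1 / 2"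
      "\<And>q. q \<in> K \<Longrightarrow> norm (x q - x p) \<le> 1"
    and v: "\<And>q. q \<in> N \<Longrightarrow> v q \<le> s" "\<And>q. q \<in> N \<Longrightarrow> isCont v q"
    and lap: "\<And>q. q \<in> N \<Longrightarrow> \<exists>c u l. complex_chart A x c u \<and> q \<in> fst c \<and> 0 \<le> l \<and> has_lap (local_rep c v) l (snd c q)"
    and m: "\<And>q. q \<in> K - B \<Longrightarrow> v q \<le> m" and q: "q \<in> B" "q \<noteq> p"
  shows "v q \<le> m"
proof (rule ccontr)
  assume "\<not> v q \<le> m"
  \<comment> \<open>Any constant above half of the squared bound on the mean curvature would satisfy
    \<open>barrier_has_lap\<close>.\<close>
  define C where "C = h\<^sup>2 + 1"
  have "C > 0" using zero_le_power2[of h] unfolding C_def by linarith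
  moreover have "h\<^sup>2 < C" by (simp add: C_def)
  ultimately have C: "C > 0" "h\<^sup>2 < 2 * C" by auto
  define b where "b q = ln ((norm (x q - x p))\<^sup>2) + C * ((norm (x q - x p))\<^sup>2 - 1)" for q
  have norm2: "0 < (norm (x q - x p))\<^sup>2" "(norm (x q - x p))\<^sup>2 \<le> 1" if "q \<in> K" "q \<noteq> p" for q
    using inj[OF that] h(3)[OF that(1)] by (auto simp: power_le_one)
  have second: "C * ((norm (x q - x p))\<^sup>2 - 1) \<le> 0" if "q \<in> K" "q \<noteq> p" for q
    using norm2[OF that] C by (simp add: mult_nonneg_nonpos)
  have b_neg: "b q \<le> 0" if "q \<in> K" "q \<noteq> p" for q
    using norm2[OF that] second[OF that] by (simp add: b_def add_nonpos_nonpos)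
  \<comment> \<open>So small that the barrier costs less than the excess of \<open>v q\<close> over
    \<open>m\<close>; \<open>V\<close> still exceeds \<open>m\<close> at \<open>q\<close>.\<close>
  define \<epsilon> where "\<epsilon> = (v q - m) / (2 * (1 + \<bar>b q\<bar>))"
  have \<epsilon>: "\<epsilon> > 0" using \<open>\<not> v q \<le> m\<close> by (simp add: \<epsilon>_def add_pos_nonneg)
  define V where "V q = v q + \<epsilon> * b q" for q
  have Vq: "m < V q"
  proof -
    have "\<epsilon> * \<bar>b q\<bar> < \<epsilon> * (2 * (1 + \<bar>b q\<bar>))" using \<epsilon> by (intro mult_strict_left_mono) auto
    also have "\<dots> = v q - m" by (simp add: \<epsilon>_def add_nonneg_eq_0_iff)
    finally have "\<epsilon> * \<bar>b q\<bar> < v q - m" .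
    moreover have "- (\<epsilon> * \<bar>b q\<bar>) \<le> \<epsilon> * b q"
      using \<epsilon> by (simp add: abs_if)
    ultimately show ?thesis by (simp add: V_def)
  qed
  \<comment> \<open>Solves \<epsilon> ln t + s = V q. Where the squared distance is below
    \<open>t\<close>, the global bound \<open>s\<close> on \<open>v\<close> gives a value of
    \<open>V\<close> smaller than \<open>V q\<close>.\<close>
  define t where "t = exp ((V q - s) / \<epsilon>)"
  define U where "U = {q. (norm (x q - x p))\<^sup>2 < t}"
  have contx: "isCont x q" for q by (rule isCont_immersion[OF im])
  have cont_norm: "continuous_on UNIV (\<lambda>q. (norm (x q - x p))\<^sup>2)"
    using contx by (intro continuous_intros continuous_at_imp_continuous_on) auto
  have "open U"
    unfolding U_def by (rule open_Collect_less[OF cont_norm]) simp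
  have inU: "V q' < V q" if "q' \<in> K" "q' \<noteq> p" "q' \<in> U" for q'
  proof -
    have "t > 0" by (simp add: t_def)
    moreover have "(norm (x q' - x p))\<^sup>2 < t" using that(3) by (simp add: U_def)
    ultimately have "ln ((norm (x q' - x p))\<^sup>2) < ln t"
      using norm2(1)[OF that(1,2)] by (simp only: ln_less_cancel_iff)
    then have "b q' < (V q - s) / \<epsilon>"
      using second[OF that(1,2)] by (simp add: b_def t_def)
    then have "\<epsilon> * b q' < V q - s"
      using \<epsilon> by (simp add: pos_less_divide_eq mult.commute)
    moreover have "v q' \<le> s" using v(1) that p(5) by blast
    ultimately show ?thesis by (simp add: V_def)
  qed
  have pU: "p \<in> U" by (simp add: U_def t_def)
  have KU: "compact (K - U)" using p(2) \<open>open U\<close> by (simp add: compact_diff)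
  have qK: "q \<in> K - U" using inU[of q] q p(4) by blast
  have "isCont V q'" if "q' \<in> K" "q' \<noteq> p" for q'
    unfolding V_def b_def using norm2[OF that] v(2)[of q'] that p(5) contx
    by (intro continuous_intros) auto
  then have "continuous_on (K - U) V"
    using pU by (intro continuous_at_imp_continuous_on) blast
  then obtain q2 where q2: "q2 \<in> K - U" "\<And>q'. q' \<in> K - U \<Longrightarrow> V q' \<le> V q2"
    using continuous_attains_sup[OF KU] qK by blast
  have q2p: "q2 \<noteq> p" using q2 pU by blast
  have Vq2: "V q \<le> V q2" using q2(2)[OF qK] .
  have "q2 \<in> B"
  proof (rule ccontr)
    assume "q2 \<notin> B"
    then have "v q2 \<le> m" using m q2 by blast
    moreover have "\<epsilon> * b q2 \<le> 0" using b_neg[of q2] q2 q2p \<epsilon> by (simp add: mult_nonneg_nonpos)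
    ultimately show False using Vq Vq2 by (simp add: V_def)
  qed
  have max: "V q' \<le> V q2" if "q' \<in> B" "q' \<noteq> p" for q'
    using inU[of q'] q2(2)[of q'] Vq2 that p(4) by (cases "q' \<in> U") force+
  have "q2 \<in> N" using q2 q2p p(5) by blast
  then obtain c u l where c: "complex_chart A x c u" "q2 \<in> fst c" "0 \<le> l" "has_lap (local_rep c v) l (snd c q2)"
    using lap by blast
  note cc = complex_chart_coord[OF c(1)]
  have "\<exists>l>0. has_lap (local_rep c b) l (snd c q2)"
    unfolding b_def
    by (rule barrier_has_lap[OF im c(1,2) inj h(1,2) C(2)]) (use q2 q2p in auto)
  then obtain l' where l': "l' > 0" "has_lap (local_rep c b) l' (snd c q2)" by blast
  have lV: "has_lap (local_rep c V) (l + \<epsilon> * l') (snd c q2)"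
    using has_lap_add[OF c(4) has_lap_cmult[OF l'(2), of \<epsilon>]]
    by (simp add: local_rep_def comp_def V_def[abs_def])
  have "open (B - {p})" using p(1) by (simp add: open_delete)
  then have "open (snd c ` (fst c \<inter> (B - {p})))"
    using coord_chartD(1)[OF cc] by (intro coord_chart_open_image[OF cc]) auto
  then have "l + \<epsilon> * l' \<le> 0"
  proof (rule has_lap_local_max[OF lV])
    show "snd c q2 \<in> snd c ` (fst c \<inter> (B - {p}))" using \<open>q2 \<in> B\<close> q2p c(2) by blast
    fix z assume "z \<in> snd c ` (fst c \<inter> (B - {p}))"
    then obtain q' where "z = snd c q'" "q' \<in> fst c" "q' \<in> B" "q' \<noteq> p" by blast
    then show "local_rep c V z \<le> local_rep c V (snd c q2)"
      using local_rep_apply[OF cc] max c(2) by metis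
  qed
  moreover have "0 < \<epsilon> * l'" using \<epsilon> l'(1) by simp
  ultimately show False using c(3) by linarith
qed

text \<open>Once the supremum is attained, the strong maximum principle makes the set of maximum
  points open, and \<open>clopen_in_N\<close> spreads it over \<open>N\<close>. The issue is
  attainment, as \<open>N\<close> need not be compact.\<close>

theorem bounded_subharmonic_constant:
  assumes im: "smooth_immersion A x" and bdd: "\<And>q. q \<in> N \<Longrightarrow> v q \<le> b"
    and lap: "\<And>p. p \<in> N \<Longrightarrow> \<exists>c u. complex_chart A x c u \<and> p \<in> fst c \<and> fst c \<subseteq> N \<and>
       (\<forall>q\<in>fst c. \<exists>l\<ge>0. has_lap (local_rep c v) l (snd c q))"
  obtains k where "\<And>p. p \<in> N \<Longrightarrow> v p = k"
proof -
  have cont: "isCont v q" if "q \<in> N" for q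
    using lap[OF that] isCont_of_local_rep has_lap_isCont complex_chart_compatible by meson
  have contN: "continuous_on N v" using cont by (simp add: continuous_at_imp_continuous_on)
  have attained: "\<exists>k. \<forall>p\<in>N. v p = k" if p0: "p0 \<in> N" "\<And>q. q \<in> N \<Longrightarrow> v q \<le> v p0" for p0
  proof -
    define S where "S = {p \<in> N. v p = v p0}"
    have "open S"
    proof (subst open_subopen, intro ballI)
      fix p assume "p \<in> S"
      then have p: "p \<in> N" "v p = v p0" by (auto simp: S_def)
      obtain c u where c: "complex_chart A x c u" "p \<in> fst c" "fst c \<subseteq> N"
        "\<And>q. q \<in> fst c \<Longrightarrow> \<exists>l\<ge>0. has_lap (local_rep c v) l (snd c q)"
        using lap[OF p(1)] by blast
      note cc = complex_chart_coord[OF c(1)]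
      obtain R where R: "0 < R" "cball (snd c p) R \<subseteq> snd c ` (fst c \<inter> UNIV)"
        using coord_chart_disc[OF cc c(2) open_UNIV UNIV_I] by blast
      have "\<forall>z\<in>snd c ` fst c. \<exists>l\<ge>0. has_lap (local_rep c v) l z" using c(4) by blast
      then obtain l where l: "\<And>z. z \<in> snd c ` fst c \<Longrightarrow> 0 \<le> l z \<and> has_lap (local_rep c v) (l z) z"
        by metis
      have le: "local_rep c v z \<le> local_rep c v (snd c p)" if z: "z \<in> snd c ` fst c" for z
      proof -
        obtain q where q: "z = snd c q" "q \<in> fst c" using z by blast
        then have "v q \<le> v p" using p0(2)[of q] c(3) p(2) by auto
        then show ?thesis using q c(2) by (simp add: local_rep_apply[OF cc])
      qed
      have "v q = v p0" if "q \<in> fst c" "snd c q \<in> ball (snd c p) (R / 2)" for q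
      proof -
        have "local_rep c v (snd c q) = local_rep c v (snd c p)"
          by (rule strong_maximum_principle_disc[where v = "local_rep c v" and S = "snd c ` fst c" and l = l,
                OF R(1) _ _ _ le that(2)]) (use R l in auto)
        then show ?thesis using local_rep_apply[OF cc, of _ v] that(1) c(2) p(2) by simp
      qed
      then have "coord_ball c p (R / 2) \<subseteq> S" using c(3) by (auto simp: S_def)
      moreover have "open (coord_ball c p (R / 2))"
        by (rule coord_chart_open_preimage[OF cc open_ball])
      ultimately show "\<exists>T. open T \<and> p \<in> T \<and> T \<subseteq> S" using c(2) R(1)
        by (intro exI[of _ "coord_ball c p (R / 2)"]) auto
    qed
    moreover have "open (N - S)"
    proof -
      have "N - S = N \<inter> v -` (- {v p0})" by (auto simp: S_def)
      then show ?thesis using continuous_open_preimage[OF contN open_N, of "- {v p0}"] by auto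
    qed
    ultimately have "S = N"
      using p0(1) by (intro clopen_in_N) (auto simp: S_def)
    then show ?thesis by (auto simp: S_def)
  qed
  show thesis
  proof (cases "N = {}")
    case True
    then show thesis using that by blast
  next
    case False
    define s where "s = Sup (v ` N)"
    have bdd': "bdd_above (v ` N)" using bdd by (auto intro!: bdd_aboveI2)
    have le_s: "v q \<le> s" if "q \<in> N" for q
      unfolding s_def using that bdd' by (intro cSup_upper) auto
    have "\<exists>p0\<in>N. v p0 = s"
    proof (rule ccontr)
      assume "\<not> (\<exists>p0\<in>N. v p0 = s)"
      then have less: "v q < s" if "q \<in> N" for q using le_s[OF that] that by force
      \<comment> \<open>If the supremum is not attained, every point of the surface, umbilic or not,
        has a neighbourhood where \<open>v\<close> is bounded by a constant below it. A finite
        subcover then lowers the supremum.\<close>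
      have "\<exists>W m. open W \<and> p \<in> W \<and> m < s \<and> (\<forall>q\<in>W \<inter> N. v q \<le> m)" for p
      proof (cases "p \<in> N")
        case True
        define W where "W = N \<inter> v -` {..<(v p + s) / 2}"
        have "open W" unfolding W_def by (rule continuous_open_preimage[OF contN open_N open_lessThan])
        then show ?thesis using True less[OF True]
          by (intro exI[of _ W] exI[of _ "(v p + s) / 2"]) (auto simp: W_def)
      next
        case False
        then have "p \<in> D" by (simp add: N_eq)
        \<comment> \<open>By continuity a bound for the absolute mean curvature near
          \<open>p\<close>; the added 1 also makes it positive, as needed for the radius 1 / (2
          h).\<close>
        define h where "h = \<bar>mean_curvature A x p\<bar> + 1"
        have h: "h > 0" by (simp add: h_def)
        obtain U0 where U0: "open U0" "p \<in> U0" "U0 - {p} \<subseteq> N" using isolated_D[OF \<open>p \<in> D\<close>] by blast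
        obtain U1 where U1: "open U1" "p \<in> U1" "\<And>q. q \<in> U1 \<Longrightarrow> q \<noteq> p \<Longrightarrow> x q \<noteq> x p"
          using immersion_locally_injective[OF im] by blast
        have "isCont (\<lambda>q. \<bar>mean_curvature A x q\<bar>) p"
          by (intro continuous_intros continuous_mean_curvature[OF im])
        then have "\<forall>\<^sub>F q in nhds p. \<bar>mean_curvature A x q\<bar> < h"
          by (intro order_tendstoD(2)) (auto simp: isCont_def continuous_at h_def tendsto_nhds_iff)
        then obtain U2 where U2: "open U2" "p \<in> U2" "\<And>q. q \<in> U2 \<Longrightarrow> \<bar>mean_curvature A x q\<bar> < h"
          unfolding eventually_nhds by blast
        have "isCont (\<lambda>q. norm (x q - x p)) p"
          by (intro continuous_intros isCont_immersion[OF im])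
        then have "\<forall>\<^sub>F q in nhds p. norm (x q - x p) < min 1 (1 / (2 * h))"
          using h by (intro order_tendstoD(2)) (auto simp: isCont_def continuous_at tendsto_nhds_iff)
        then obtain U3 where U3: "open U3" "p \<in> U3" "\<And>q. q \<in> U3 \<Longrightarrow> norm (x q - x p) < min 1 (1 / (2 * h))"
          unfolding eventually_nhds by blast
        obtain B K where B: "open B" "compact K" "p \<in> B" "B \<subseteq> K" "K \<subseteq> U0 \<inter> U1 \<inter> U2 \<inter> U3"
        proof (rule compact_disc_around[of "U0 \<inter> U1 \<inter> U2 \<inter> U3" p])
          show "open (U0 \<inter> U1 \<inter> U2 \<inter> U3)" using U0 U1 U2 U3 by blast
          show "p \<in> U0 \<inter> U1 \<inter> U2 \<inter> U3" using U0 U1 U2 U3 by blast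
        qed
        have KN: "K - B \<subseteq> N" "K - {p} \<subseteq> N" using B U0 by auto
        obtain m where m: "m < s" "\<And>q. q \<in> K - B \<Longrightarrow> v q \<le> m"
        proof (cases "K - B = {}")
          case True
          \<comment> \<open>With no rim there is nothing to bound, and any number below
            \<open>s\<close> serves.\<close>
          then show thesis by (intro that[of "s - 1"]) auto
        next
          case False
          have "compact (K - B)" using B by (simp add: compact_diff)
          then obtain q1 where "q1 \<in> K - B" "\<And>q. q \<in> K - B \<Longrightarrow> v q \<le> v q1"
            using continuous_attains_sup[OF _ False continuous_on_subset[OF contN KN(1)]] by blast
          then show thesis using less KN by (intro that[of "v q1"]) auto
        qed
        have "v q \<le> m" if q: "q \<in> B \<inter> N" for q
        proof (rule punctured_disc_maximum_principle[OF im B(1-4) KN(2) _ _ _ _ le_s cont _ m(2)])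
          show "x q \<noteq> x p" if "q \<in> K" "q \<noteq> p" for q using that B(5) U1(3) by blast
          show "\<bar>mean_curvature A x q\<bar> \<le> h" if "q \<in> K" for q using that B(5) U2(3)[of q] by auto
          show "h * norm (x q - x p) \<le> 1 / 2" if "q \<in> K" for q
          proof -
            have "norm (x q - x p) \<le> 1 / (2 * h)" using that B(5) U3(3)[of q] by auto
            then show ?thesis using h by (simp add: field_simps)
          qed
          show "norm (x q - x p) \<le> 1" if "q \<in> K" for q using that B(5) U3(3)[of q] by auto
          show "\<exists>c u l. complex_chart A x c u \<and> q \<in> fst c \<and> 0 \<le> l \<and> has_lap (local_rep c v) l (snd c q)"
            if "q \<in> N" for q using lap[OF that] by blast
          show "q \<in> B" "q \<noteq> p" using q False by auto
        qed auto
        then show ?thesis using B m(1) by blast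
      qed
      then have "\<forall>p. \<exists>W. \<exists>m. open W \<and> p \<in> W \<and> m < s \<and> (\<forall>q\<in>W \<inter> N. v q \<le> m)" by blast
      from choice[OF this] obtain W where
        "\<forall>p. \<exists>m. open (W p) \<and> p \<in> W p \<and> m < s \<and> (\<forall>q\<in>W p \<inter> N. v q \<le> m)" by blast
      from choice[OF this] obtain m where
        W: "\<And>p. open (W p)" "\<And>p. p \<in> W p" "\<And>p. m p < s" "\<And>p q. q \<in> W p \<inter> N \<Longrightarrow> v q \<le> m p"
        by blast
      obtain I where I: "finite I" "UNIV \<subseteq> (\<Union>p\<in>I. W p)"
      proof (rule compactE_image[OF compact_surface, of UNIV W])
        show "open (W p)" for p by (rule W(1))
        show "UNIV \<subseteq> (\<Union>p\<in>UNIV. W p)" using W(2) by blast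
      qed blast
      have "I \<noteq> {}" using I(2) by auto
      have "v q \<le> Max (m ` I)" if "q \<in> N" for q
      proof -
        obtain p where p: "p \<in> I" "q \<in> W p" using I(2) by blast
        then have "v q \<le> m p" using W(4) that by blast
        also have "\<dots> \<le> Max (m ` I)" using p I by (intro Max_ge) auto
        finally show ?thesis .
      qed
      then have "s \<le> Max (m ` I)" unfolding s_def using False by (intro cSup_least) auto
      moreover have "Max (m ` I) < s" using I(1) \<open>I \<noteq> {}\<close> W(3) by auto
      ultimately show False by simp
    qed
    then obtain p0 where "p0 \<in> N" "v p0 = s" by blast
    then have "\<exists>k. \<forall>p\<in>N. v p = k" using le_s by (intro attained[of p0]) auto
    then show thesis using that by blast
  qed
qed

end

section \<open>Immersions with a Bonnet mate\<close>

lemma conformal_pair_subset: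
  assumes "conformal_pair S X Y u" "open S'" "S' \<subseteq> S"
  shows "conformal_pair S' X Y u"
proof -
  interpret conformal_pair S X Y u by fact
  show ?thesis
    by unfold_locales
      (use assms(2,3) X.conformal Y.conformal same_H
          smooth_on_subset[OF X.open_S assms(2,3)] X.smooth_X Y.smooth_X X.smooth_u in auto)
qed

text \<open>The chart data of \<open>is_Delta_g\<close> in a form without the conformal factor:
  \<open>2 * hopf_coeff\<close> is what \<open>exp (2 * u w)\<close> times the Hopf invariant
  simplifies to.\<close>

definition log_chart where
  "log_chart A N x c u G g \<longleftrightarrow> complex_chart A x c u \<and> fst c \<subseteq> N \<and> smooth_on (snd c ` fst c) G \<and>
     smooth_on (snd c ` fst c) g \<and>
     (\<forall>w\<in>snd c ` fst c. 2 * hopf_coeff (local_rep c x) w = exp (of_real (G w) + \<i> * of_real (g w)))"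

locale bonnet_pair = punctured_closed_surface A D N
  for A :: "'a::t2_space chart set" and D N +
  fixes x x' :: "'a \<Rightarrow> real^3"
  assumes im: "smooth_immersion A x" and im': "smooth_immersion A x'"
    and same_metric: "same_induced_metric A x x'"
    and same_mean_curvature: "\<And>p. mean_curvature A x' p = mean_curvature A x p"
begin

lemma complex_chart': "complex_chart A x c u \<Longrightarrow> complex_chart A x' c u"
  by (rule complex_chart_mate[OF im im' same_metric])

lemma pair:
  assumes c: "complex_chart A x c u"
  shows "conformal_pair (snd c ` fst c) (local_rep c x) (local_rep c x') u"
proof -
  interpret X: conformal_surface "snd c ` fst c" "local_rep c x" u
    by (rule complex_chart_surface[OF im c])
  interpret Y: conformal_surface "snd c ` fst c" "local_rep c x'" u
    by (rule complex_chart_surface[OF im' complex_chart'[OF c]])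
  note cc = complex_chart_compatible[OF c]
  show ?thesis
  proof
    fix w assume "w \<in> snd c ` fst c"
    then obtain p where p: "w = snd c p" "p \<in> fst c" by blast
    show "local_mean_curvature (local_rep c x') w = local_mean_curvature (local_rep c x) w"
      unfolding p(1) using same_mean_curvature[of p] mean_curvature_chart[OF im cc p(2)]
        mean_curvature_chart[OF im' cc p(2)] by simp
  qed
qed

abbreviation Fc where "Fc c \<equiv> conformal_pair.F (local_rep c x) (local_rep c x')"
abbreviation Tc where "Tc c \<equiv> conformal_pair.T (local_rep c x) (local_rep c x')"
abbreviation kc where "kc c \<equiv> conformal_surface.k (local_rep c x)"

text \<open>Both are coefficients of quadratic differentials and acquire the squared derivative of
  the transition. Hence their quotient, and with it \<open>T\<close>, does not depend on the
  chart.\<close>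

lemma F_transition:
  assumes c: "complex_chart A x c u" and d: "complex_chart A x d v" and p: "p \<in> fst c" "p \<in> fst d"
  obtains a where "a \<noteq> 0" "Fc c (snd c p) = a * Fc d (snd d p)" "kc c (snd c p) = a * kc d (snd d p)"
proof -
  interpret c: conformal_pair "snd c ` fst c" "local_rep c x" "local_rep c x'" u by (rule pair[OF c])
  interpret d: conformal_pair "snd d ` fst d" "local_rep d x" "local_rep d x'" v by (rule pair[OF d])
  show thesis
  proof (rule that)
    show "(pdx (transition c d) (snd c p))\<^sup>2 \<noteq> 0" using complex_transition(2)[OF im c d p] by simp
  qed (simp_all add: c.F_def d.F_def c.X.k_def d.X.k_def c.Y.k_def d.Y.k_def complex_transition(3)[OF im c d p]
      complex_transition(3)[OF im' complex_chart'[OF c] complex_chart'[OF d] p] algebra_simps)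
qed

lemma T_transition:
  assumes c: "complex_chart A x c u" and d: "complex_chart A x d v" and p: "p \<in> fst c" "p \<in> fst d"
  shows "Tc c (snd c p) = Tc d (snd d p)"
proof -
  interpret c: conformal_pair "snd c ` fst c" "local_rep c x" "local_rep c x'" u by (rule pair[OF c])
  interpret d: conformal_pair "snd d ` fst d" "local_rep d x" "local_rep d x'" v by (rule pair[OF d])
  obtain a where "a \<noteq> 0" "Fc c (snd c p) = a * Fc d (snd d p)" "kc c (snd c p) = a * kc d (snd d p)"
    using F_transition[OF c d p] .
  then show ?thesis by (simp add: c.T_def d.T_def)
qed

lemma complex_chart_open_set:
  assumes c: "complex_chart A x c u" and f: "continuous_on (snd c ` fst c) f" and V: "open V"
  shows "open {q \<in> fst c. f (snd c q) \<in> V}"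
proof -
  note cc = complex_chart_coord[OF c]
  have "open (snd c ` fst c \<inter> f -` V)"
    by (rule continuous_open_preimage[OF f coord_chartD(2)[OF cc] V])
  from coord_chart_open_preimage[OF cc this]
  moreover have "{q \<in> fst c. f (snd c q) \<in> V} = {q \<in> fst c. snd c q \<in> snd c ` fst c \<inter> f -` V}"
    by auto
  ultimately show ?thesis by simp
qed

text \<open>The nonumbilic points at which the two second fundamental forms agree.\<close>

definition coincide where
  "coincide = {p \<in> N. \<exists>c u. complex_chart A x c u \<and> p \<in> fst c \<and> Fc c (snd c p) = 0}"

lemma coincide_iff:
  assumes c: "complex_chart A x c u" and p: "p \<in> fst c" "p \<in> N"
  shows "p \<in> coincide \<longleftrightarrow> Fc c (snd c p) = 0"
proof
  assume "p \<in> coincide"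
  then obtain d v where d: "complex_chart A x d v" "p \<in> fst d" "Fc d (snd d p) = 0"
    by (auto simp: coincide_def)
  obtain a where "Fc c (snd c p) = a * Fc d (snd d p)"
    using F_transition[OF c d(1) p(1) d(2)] by metis
  then show "Fc c (snd c p) = 0" using d(3) by simp
next
  assume "Fc c (snd c p) = 0"
  then show "p \<in> coincide" using assms unfolding coincide_def by blast
qed

end

section \<open>Congruence or a global angle function\<close>

locale bonnet_pair_log = bonnet_pair A D N x x'
  for A :: "'a::t2_space chart set" and D N x x' +
  assumes log_charts: "\<And>p. p \<in> N \<Longrightarrow> \<exists>c u G g. log_chart A N x c u G g \<and> p \<in> fst c"
begin

text \<open>In a log chart \<open>k\<close> is an exponential, hence nowhere zero, and
  \<open>F_zero_locally\<close> applies at every zero of \<open>F\<close>. The complement is open by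
  continuity of \<open>F\<close>.\<close>

lemma coincide_clopen: "open coincide" "open (N - coincide)"
proof -
  show "open coincide"
  proof (subst open_subopen, intro ballI)
    fix p assume p: "p \<in> coincide"
    then have pN: "p \<in> N" by (simp add: coincide_def)
    obtain c u G g where lc: "log_chart A N x c u G g" and pc: "p \<in> fst c" using log_charts[OF pN] by blast
    then have c: "complex_chart A x c u" "fst c \<subseteq> N" by (auto simp: log_chart_def)
    interpret conformal_pair "snd c ` fst c" "local_rep c x" "local_rep c x'" u by (rule pair[OF c(1)])
    have w: "snd c p \<in> snd c ` fst c" using pc by blast
    have "X.k (snd c p) = exp (of_real (G (snd c p)) + \<i> * of_real (g (snd c p)))"
      using lc w unfolding log_chart_def X.k_def by blast
    then have "X.k (snd c p) \<noteq> 0" by simp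
    moreover have "F (snd c p) = 0" using coincide_iff[OF c(1) pc pN] p by simp
    ultimately obtain r where r: "0 < r" "ball (snd c p) r \<subseteq> snd c ` fst c"
      "\<And>z. z \<in> ball (snd c p) r \<Longrightarrow> F z = 0"
      using F_zero_locally[OF w] by blast
    have "coord_ball c p r \<subseteq> coincide"
    proof
      fix q assume q: "q \<in> coord_ball c p r"
      then show "q \<in> coincide" using coincide_iff[OF c(1), of q] c(2) r(3)[of "snd c q"] by blast
    qed
    moreover have "open (coord_ball c p r)"
      by (rule coord_chart_open_preimage[OF complex_chart_coord[OF c(1)] open_ball])
    ultimately show "\<exists>T. open T \<and> p \<in> T \<and> T \<subseteq> coincide"
      using pc r(1) by (intro exI[of _ "coord_ball c p r"]) auto
  qed
  show "open (N - coincide)"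
  proof (subst open_subopen, intro ballI)
    fix p assume p: "p \<in> N - coincide"
    obtain c u G g where lc: "log_chart A N x c u G g" and pc: "p \<in> fst c" using log_charts[of p] p by blast
    then have c: "complex_chart A x c u" "fst c \<subseteq> N" by (auto simp: log_chart_def)
    interpret conformal_pair "snd c ` fst c" "local_rep c x" "local_rep c x'" u by (rule pair[OF c(1)])
    have "open {q \<in> fst c. F (snd c q) \<in> - {0}}"
      by (rule complex_chart_open_set[OF c(1) holomorphic_on_imp_continuous_on[OF F_holomorphic]]) auto
    moreover have "{q \<in> fst c. F (snd c q) \<in> - {0}} \<subseteq> N - coincide"
      using coincide_iff[OF c(1)] c(2) by auto
    moreover have "p \<in> {q \<in> fst c. F (snd c q) \<in> - {0}}"
      using coincide_iff[OF c(1) pc] p pc by auto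
    ultimately show "\<exists>T. open T \<and> p \<in> T \<and> T \<subseteq> N - coincide" by blast
  qed
qed

lemma coincide_cases: "coincide = {} \<or> coincide = N"
  using clopen_in_N[OF _ coincide_clopen] by (auto simp: coincide_def)

lemma rigid_motion_unique_surface:
  assumes q: "open V" "q \<in> V" "q \<in> N" and R: "rotation_matrix R" "rotation_matrix R'"
    and eq: "\<And>p. p \<in> V \<Longrightarrow> y + R *v x p = y' + R' *v x p"
  shows "R = R' \<and> y = y'"
proof -
  obtain c u G g where "log_chart A N x c u G g" and qc: "q \<in> fst c" using log_charts[OF q(3)] by blast
  then have c: "complex_chart A x c u" by (simp add: log_chart_def)
  note cc = complex_chart_coord[OF c]
  interpret conformal_surface "snd c ` fst c" "local_rep c x" u by (rule complex_chart_surface[OF im c])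
  have o: "open (snd c ` (fst c \<inter> V))"
    using coord_chartD(1)[OF cc] q(1) by (intro coord_chart_open_image[OF cc]) auto
  have sub: "snd c ` (fst c \<inter> V) \<subseteq> snd c ` fst c" by blast
  have w: "snd c q \<in> snd c ` (fst c \<inter> V)" using qc q by blast
  have "y + R *v local_rep c x z = y' + R' *v local_rep c x z" if z: "z \<in> snd c ` (fst c \<inter> V)" for z
  proof -
    obtain p where "z = snd c p" "p \<in> fst c" "p \<in> V" using z by blast
    then show ?thesis using eq by (simp add: local_rep_apply[OF cc])
  qed
  from rigid_motion_unique[OF o sub w R this] show ?thesis by blast
qed

text \<open>On coordinate discs the immersions differ by a rigid motion. The points near which it is
  one fixed motion form an open set; its complement is open as well, because overlapping motions
  agree by \<open>rigid_motion_unique_surface\<close>.\<close>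

lemma congruent_of_coincide:
  assumes co: "coincide = N"
  shows "congruent_immersions x x'"
proof -
  have local: "\<exists>B y R. open B \<and> p \<in> B \<and> B \<subseteq> N \<and> rotation_matrix R \<and> (\<forall>q\<in>B. x' q = y + R *v x q)"
    if pN: "p \<in> N" for p
  proof -
    obtain c u G g where "log_chart A N x c u G g" and pc: "p \<in> fst c" using log_charts[OF pN] by blast
    then have c: "complex_chart A x c u" "fst c \<subseteq> N" by (auto simp: log_chart_def)
    note cc = complex_chart_coord[OF c(1)]
    obtain r where r: "0 < r" "cball (snd c p) r \<subseteq> snd c ` (fst c \<inter> UNIV)"
      using coord_chart_disc[OF cc pc open_UNIV UNIV_I] .
    then have sub: "ball (snd c p) r \<subseteq> snd c ` fst c" using ball_subset_cball by blast
    interpret conformal_pair "ball (snd c p) r" "local_rep c x" "local_rep c x'" u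
      by (rule conformal_pair_subset[OF pair[OF c(1)] open_ball sub])
    have F0: "F w = 0" if w: "w \<in> ball (snd c p) r" for w
    proof -
      obtain q where q: "w = snd c q" "q \<in> fst c" using w sub by blast
      then show ?thesis using coincide_iff[OF c(1) q(2)] c(2) co by auto
    qed
    have "\<exists>y R. rotation_matrix R \<and> (\<forall>w\<in>ball (snd c p) r. local_rep c x' w = y + R *v local_rep c x w)"
    proof (rule congruent_of_equal_second_forms)
      show "F w = 0" if "w \<in> ball (snd c p) r" for w by (rule F0[OF that])
      show "snd c p \<in> ball (snd c p) r" using r(1) by simp
    qed (rule convex_ball, blast)
    then obtain y R where R: "rotation_matrix R" "\<And>w. w \<in> ball (snd c p) r \<Longrightarrow> local_rep c x' w = y + R *v local_rep c x w"
      by blast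
    define B where "B = coord_ball c p r"
    have "open B" unfolding B_def by (rule coord_chart_open_preimage[OF cc open_ball])
    moreover have "p \<in> B" "B \<subseteq> N" using pc r(1) c(2) by (auto simp: B_def)
    moreover have "\<forall>q\<in>B. x' q = y + R *v x q"
    proof
      fix q assume "q \<in> B"
      then show "x' q = y + R *v x q"
        using R(2)[of "snd c q"] local_rep_apply[OF cc, of q x] local_rep_apply[OF cc, of q x']
        by (simp add: B_def)
    qed
    ultimately show ?thesis using R(1) by (intro exI[of _ B] exI[of _ y] exI[of _ R]) blast
  qed
  have "N \<noteq> {}" using N_nonempty_in[OF open_UNIV] by auto
  then obtain p0 where p0: "p0 \<in> N" by blast
  obtain B0 y R where B0: "open B0" "p0 \<in> B0" "B0 \<subseteq> N" "rotation_matrix R" "\<forall>q\<in>B0. x' q = y + R *v x q"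
    using local[OF p0] by blast
  define S where "S = {p \<in> N. \<exists>B. open B \<and> p \<in> B \<and> B \<subseteq> N \<and> (\<forall>q\<in>B. x' q = y + R *v x q)}"
  have "open S"
  proof (subst open_subopen, intro ballI)
    fix p assume "p \<in> S"
    then obtain B where B: "open B" "p \<in> B" "B \<subseteq> N" "\<forall>q\<in>B. x' q = y + R *v x q" by (auto simp: S_def)
    then have "B \<subseteq> S" unfolding S_def by blast
    then show "\<exists>T. open T \<and> p \<in> T \<and> T \<subseteq> S" using B by blast
  qed
  moreover have "open (N - S)"
  proof (subst open_subopen, intro ballI)
    fix p assume p: "p \<in> N - S"
    then have pN: "p \<in> N" by blast
    obtain B y' R' where B: "open B" "p \<in> B" "B \<subseteq> N" "rotation_matrix R'" "\<forall>q\<in>B. x' q = y' + R' *v x q"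
      using local[OF pN] by blast
    have "B \<subseteq> N - S"
    proof (rule ccontr)
      assume "\<not> B \<subseteq> N - S"
      then obtain q where q: "q \<in> B" "q \<in> S" using B(3) by blast
      then obtain B' where B': "open B'" "q \<in> B'" "\<forall>q\<in>B'. x' q = y + R *v x q" by (auto simp: S_def)
      have eq: "y + R *v x p = y' + R' *v x p" if "p \<in> B \<inter> B'" for p
        using that B(5) B'(3) by force
      have "R = R' \<and> y = y'"
      proof (rule rigid_motion_unique_surface[OF _ _ _ B0(4) B(4)])
        show "open (B \<inter> B')" "q \<in> B \<inter> B'" "q \<in> N" using q B B' by auto
      qed (rule eq)
      then have "\<forall>q\<in>B. x' q = y + R *v x q" using B(5) by simp
      then have "p \<in> S" using B(1-3) pN unfolding S_def by blast
      then show False using p by blast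
    qed
    then show "\<exists>T. open T \<and> p \<in> T \<and> T \<subseteq> N - S" using B by blast
  qed
  moreover have "p0 \<in> S" using p0 B0 unfolding S_def by blast
  ultimately have SN: "S = N" by (intro clopen_in_N) (auto simp: S_def)
  \<comment> \<open>The umbilic points are reached by continuity, as \<open>N\<close> is
    dense.\<close>
  have "x' p = y + R *v x p" for p
  proof (rule ccontr)
    assume ne: "x' p \<noteq> y + R *v x p"
    have c: "continuous_on UNIV (\<lambda>p. x' p - (y + R *v x p))"
      by (intro continuous_at_imp_continuous_on ballI continuous_intros isCont_immersion[OF im']
          bounded_linear.isCont[OF matrix_vector_mul_bounded_linear isCont_immersion[OF im]])
    define V where "V = UNIV \<inter> (\<lambda>p. x' p - (y + R *v x p)) -` (- {0})"
    have "open V"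
      unfolding V_def by (rule continuous_open_preimage[OF c open_UNIV]) auto
    moreover have "p \<in> V" using ne by (simp add: V_def)
    ultimately obtain q where q: "q \<in> V" "q \<in> N" using N_nonempty_in[of V] by blast
    then have "q \<in> S" by (simp add: SN)
    then have "x' q = y + R *v x q" unfolding S_def by blast
    then show False using q(1) by (simp add: V_def)
  qed
  then show ?thesis using B0(4) unfolding congruent_immersions_def by blast
qed

text \<open>By \<open>T_transition\<close> the selected chart is immaterial wherever a complex chart
  exists. The bound by \<pi> / 2 holds for any value of the arctangent.\<close>

definition \<theta> where
  "\<theta> p = arctan (Tc (SOME c. \<exists>u. complex_chart A x c u \<and> p \<in> fst c) (snd (SOME c. \<exists>u. complex_chart A x c u \<and> p \<in> fst c) p))"

lemma \<theta>_chart: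
  assumes c: "complex_chart A x c u" and p: "p \<in> fst c"
  shows "\<theta> p = arctan (Tc c (snd c p))"
proof -
  define d where "d = (SOME c. \<exists>u. complex_chart A x c u \<and> p \<in> fst c)"
  have "\<exists>c u. complex_chart A x c u \<and> p \<in> fst c" using assms by blast
  from someI_ex[OF this] obtain v where d: "complex_chart A x d v" "p \<in> fst d" unfolding d_def by blast
  show ?thesis using T_transition[OF d(1) c d(2) p] unfolding \<theta>_def d_def[symmetric] by simp
qed

lemma \<theta>_has_lap:
  assumes co: "coincide = {}" and lc: "log_chart A N x c u G g" and q: "q \<in> fst c"
  shows "has_lap (local_rep c \<theta>) (lap g (snd c q)) (snd c q)"
proof -
  have c: "complex_chart A x c u" "fst c \<subseteq> N" "smooth_on (snd c ` fst c) G" "smooth_on (snd c ` fst c) g"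
    "\<And>w. w \<in> snd c ` fst c \<Longrightarrow> 2 * hopf_coeff (local_rep c x) w = exp (of_real (G w) + \<i> * of_real (g w))"
    using lc by (auto simp: log_chart_def)
  interpret conformal_pair "snd c ` fst c" "local_rep c x" "local_rep c x'" u by (rule pair[OF c(1)])
  have F0: "F w \<noteq> 0" if w: "w \<in> snd c ` fst c" for w
  proof -
    obtain p where p: "w = snd c p" "p \<in> fst c" using w by blast
    then show ?thesis using coincide_iff[OF c(1) p(2)] c(2) co by auto
  qed
  have w: "snd c q \<in> snd c ` fst c" using q by blast
  show ?thesis
  proof (rule has_lap_cong[OF has_lap_arctan_T[OF c(3,4) c(5)[folded X.k_def] F0 w] X.open_S w])
    fix z assume "z \<in> snd c ` fst c"
    then obtain p where p: "z = snd c p" "p \<in> fst c" by blast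
    then show "arctan (T z) = local_rep c \<theta> z"
      using \<theta>_chart[OF c(1) p(2)]
      by (simp add: local_rep_apply[OF complex_chart_coord[OF c(1)]])
  qed
qed

text \<open>Both Laplacians are those of the one function \<open>\<theta>\<close>, so they scale
  like the Laplacian of a function. This spares following the argument of the squared transition
  derivative, by which the two logarithms differ.\<close>

lemma lap_g_transition:
  assumes co: "coincide = {}" and lc: "log_chart A N x c u G g" "log_chart A N x d u' G' g'" and q: "q \<in> fst c" "q \<in> fst d"
  obtains a where "0 < a" "lap g (snd c q) = a * lap g' (snd d q)"
proof
  have c: "complex_chart A x c u" "complex_chart A x d u'" using lc by (auto simp: log_chart_def)
  let ?a = "(norm (pdx (transition c d) (snd c q)))\<^sup>2"
  show "0 < ?a" using complex_transition(2)[OF im c q] by simp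
  show "lap g (snd c q) = ?a * lap g' (snd d q)"
    using has_lap_unique[OF \<theta>_has_lap[OF co lc(1) q(1)]]
      has_lap_unique[OF has_lap_complex_chart[OF im c q \<theta>_has_lap[OF co lc(2) q(2)]]] by simp
qed

lemma mean_curvature_locally_constant:
  assumes co: "coincide = {}" and \<sigma>: "\<sigma> \<noteq> 0"
    and sign: "\<And>c u G g q. log_chart A N x c u G g \<Longrightarrow> q \<in> fst c \<Longrightarrow> 0 \<le> \<sigma> * lap g (snd c q)"
    and pN: "p \<in> N"
  obtains B where "open B" "p \<in> B" "\<And>q. q \<in> B \<Longrightarrow> mean_curvature A x q = mean_curvature A x p"
proof -
  obtain k where k: "\<And>p. p \<in> N \<Longrightarrow> \<sigma> * \<theta> p = k"
  proof (rule bounded_subharmonic_constant[OF im, of "\<lambda>p. \<sigma> * \<theta> p" "\<bar>\<sigma>\<bar> * (pi / 2)"])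
    fix q assume "q \<in> N"
    have "\<bar>arctan y\<bar> \<le> pi / 2" for y
      using arctan_lbound[of y] arctan_ubound[of y] by arith
    then have "\<bar>\<theta> q\<bar> \<le> pi / 2" unfolding \<theta>_def by blast
    then have "\<bar>\<sigma> * \<theta> q\<bar> \<le> \<bar>\<sigma>\<bar> * (pi / 2)" unfolding abs_mult by (intro mult_left_mono) auto
    then show "\<sigma> * \<theta> q \<le> \<bar>\<sigma>\<bar> * (pi / 2)" by linarith
  next
    fix p assume "p \<in> N"
    then obtain c u G g where lc: "log_chart A N x c u G g" "p \<in> fst c" using log_charts by blast
    have "\<exists>l\<ge>0. has_lap (local_rep c (\<lambda>p. \<sigma> * \<theta> p)) l (snd c q)" if q: "q \<in> fst c" for q
      using has_lap_cmult[OF \<theta>_has_lap[OF co lc(1) q], of \<sigma>] sign[OF lc(1) q]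
      by (auto simp: local_rep_def comp_def)
    then show "\<exists>c u. complex_chart A x c u \<and> p \<in> fst c \<and> fst c \<subseteq> N \<and>
        (\<forall>q\<in>fst c. \<exists>l\<ge>0. has_lap (local_rep c (\<lambda>p. \<sigma> * \<theta> p)) l (snd c q))"
      using lc unfolding log_chart_def by blast
  qed blast
  \<comment> \<open>A constant \<theta> fixes T = tan \<theta>, and \<open>k_over_F\<close> then
    gives one constant ratio of \<open>X.k\<close> to \<open>F\<close>.\<close>
  define t where "t = tan (k / \<sigma>)"
  obtain c u G g where lc: "log_chart A N x c u G g" and pc: "p \<in> fst c" using log_charts[OF pN] by blast
  then have c: "complex_chart A x c u" "fst c \<subseteq> N" by (auto simp: log_chart_def)
  note cc = complex_chart_compatible[OF c(1)]
  interpret conformal_pair "snd c ` fst c" "local_rep c x" "local_rep c x'" u by (rule pair[OF c(1)])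
  have kF: "X.k w = - (1 + \<i> * of_real t) / 2 * F w" if w: "w \<in> snd c ` fst c" for w
  proof -
    obtain q where q: "w = snd c q" "q \<in> fst c" using w by blast
    have qN: "q \<in> N" using q c by blast
    have F0: "F w \<noteq> 0" using coincide_iff[OF c(1) q(2) qN] co by (simp add: q(1))
    have "arctan (T w) = k / \<sigma>"
      using k[OF qN] \<theta>_chart[OF c(1) q(2)] \<sigma> by (simp add: q(1) field_simps)
    then have "T w = t" unfolding t_def by (metis tan_arctan)
    then show ?thesis using k_over_F[OF w F0] F0 by (simp add: field_simps)
  qed
  have pdH: "has_pd X.H 0 0 w" if w: "w \<in> snd c ` fst c" for w
    using X.pd_H[OF w] H_critical_of_proportional[OF kF w] by simp
  obtain r where r: "0 < r" "cball (snd c p) r \<subseteq> snd c ` (fst c \<inter> UNIV)"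
    using coord_chart_disc[OF compatible_coord[OF cc] pc open_UNIV UNIV_I] .
  then have sub: "ball (snd c p) r \<subseteq> snd c ` fst c" using ball_subset_cball by blast
  define B where "B = coord_ball c p r"
  have "open B" unfolding B_def by (rule coord_chart_open_preimage[OF compatible_coord[OF cc] open_ball])
  moreover have "p \<in> B" using pc r(1) by (simp add: B_def)
  moreover have "mean_curvature A x q = mean_curvature A x p" if q: "q \<in> B" for q
  proof -
    have "X.H (snd c q) = X.H (snd c p)"
      by (rule has_pd_zero_constant[OF convex_ball open_ball, of "snd c p" r]) (use q r(1) sub pdH in \<open>auto simp: B_def\<close>)
    then show ?thesis
      using q pc by (simp add: B_def mean_curvature_chart[OF im cc])
  qed
  ultimately show thesis using that by blast
qed

lemma not_differential_nonzero:
  assumes "open B" "p \<in> B" "\<And>q. q \<in> B \<Longrightarrow> f q = f p"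
  shows "\<not> differential_nonzero A f p"
proof -
  define c where "c = chart_at A p"
  have pc: "p \<in> fst c" and cc: "coord_chart c"
    using chart_at_atlas atlas_compatible compatible_coord by (auto simp: c_def)
  have o: "open (snd c ` (fst c \<inter> B))"
    using coord_chartD(1)[OF cc] assms(1) by (intro coord_chart_open_image[OF cc]) auto
  have "(local_rep c f has_derivative (\<lambda>v. 0)) (at (snd c p))"
  proof (rule has_derivative_transform_within_open[OF has_derivative_const o])
    show "snd c p \<in> snd c ` (fst c \<inter> B)" using pc assms(2) by blast
    fix z assume "z \<in> snd c ` (fst c \<inter> B)"
    then obtain q where "z = snd c q" "q \<in> fst c" "q \<in> B" by blast
    then show "f p = local_rep c f z" using assms(3) by (simp add: local_rep_apply[OF cc])
  qed
  then have "frechet_derivative (local_rep c f) (at (snd c p)) = (\<lambda>v. 0)"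
    by (metis frechet_derivative_at)
  then show ?thesis by (simp add: differential_nonzero_def Let_def c_def[symmetric])
qed

text \<open>The open set where dH is nonzero meets the dense set \<open>N\<close>, around whose
  points the mean curvature would be constant.\<close>

lemma constant_sign_contradiction:
  assumes "\<not> congruent_immersions x x'" "\<sigma> \<noteq> 0"
    and V: "open V" "V \<noteq> {}" "\<And>p. p \<in> V \<Longrightarrow> differential_nonzero A (mean_curvature A x) p"
    and sign: "\<And>c u G g q. log_chart A N x c u G g \<Longrightarrow> q \<in> fst c \<Longrightarrow> 0 \<le> \<sigma> * lap g (snd c q)"
  shows False
proof -
  have co: "coincide = {}" using coincide_cases congruent_of_coincide assms(1) by blast
  obtain p where p: "p \<in> V" "p \<in> N" using N_nonempty_in[OF V(1,2)] by blast
  show False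
  proof (rule mean_curvature_locally_constant[OF co assms(2) _ p(2)])
    show "0 \<le> \<sigma> * lap g (snd c q)" if "log_chart A N x c u G g" "q \<in> fst c" for c u G g q
      by (rule sign[OF that])
    fix B assume B: "open B" "p \<in> B" "\<And>q. q \<in> B \<Longrightarrow> mean_curvature A x q = mean_curvature A x p"
    show False
      using not_differential_nonzero[of B p "mean_curvature A x", OF B] V(3)[OF p(1)] by blast
  qed
qed

text \<open>
  Only the sign of \<open>\<Delta>g\<close> matters, so \<open>f\<close> need only agree with it up to a positive factor, which may
  depend on the chart.
\<close>

context
  fixes f :: "'a \<Rightarrow> real"
  assumes f: "\<And>p. p \<in> N \<Longrightarrow> \<exists>c u G g a. log_chart A N x c u G g \<and> p \<in> fst c \<and> 0 < a \<and> f p = a * lap g (snd c p)"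
    and co: "coincide = {}"
begin

lemma lap_g_eq:
  assumes lc: "log_chart A N x c u G g" and q: "q \<in> fst c"
  obtains a where "0 < a" "lap g (snd c q) = a * f q"
proof -
  have "q \<in> N" using lc q by (auto simp: log_chart_def)
  then obtain d u' G' g' b where d: "log_chart A N x d u' G' g'" "q \<in> fst d" "0 < b" "f q = b * lap g' (snd d q)"
    using f by blast
  obtain a where a: "0 < a" "lap g (snd c q) = a * lap g' (snd d q)"
    using lap_g_transition[OF co lc d(1) q d(2)] .
  show thesis
    by (rule that[of "a / b"]) (use a d in auto)
qed

text \<open>Continuity of \<open>f\<close> is not among the hypotheses; its sign is read off from
  \<open>lap g\<close>, which is continuous in each chart.\<close>

lemma open_sign_set: "open {p \<in> N. 0 < \<sigma> * f p}"
proof (subst open_subopen, intro ballI)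
  fix p assume "p \<in> {p \<in> N. 0 < \<sigma> * f p}"
  then have p: "p \<in> N" "0 < \<sigma> * f p" by auto
  obtain c u G g where lc: "log_chart A N x c u G g" and pc: "p \<in> fst c" using log_charts[OF p(1)] by blast
  then have c: "complex_chart A x c u" "fst c \<subseteq> N" "smooth_on (snd c ` fst c) g" by (auto simp: log_chart_def)
  have iff: "0 < \<sigma> * lap g (snd c q) \<longleftrightarrow> 0 < \<sigma> * f q" if q: "q \<in> fst c" for q
  proof -
    obtain a where a: "0 < a" "lap g (snd c q) = a * f q" using lap_g_eq[OF lc q] .
    then have "\<sigma> * lap g (snd c q) = a * (\<sigma> * f q)" by simp
    then show ?thesis using a(1) by (simp only: zero_less_mult_iff) auto
  qed
  have "continuous_on (snd c ` fst c) (\<lambda>w. \<sigma> * lap g w)"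
    unfolding lap_def
    by (intro continuous_intros smooth_on_continuous smooth_on_pdx smooth_on_pdy c(3))
  from complex_chart_open_set[OF c(1) this open_greaterThan, of 0]
  have "open {q \<in> fst c. 0 < \<sigma> * lap g (snd c q)}" by simp
  moreover have "{q \<in> fst c. 0 < \<sigma> * lap g (snd c q)} \<subseteq> {p \<in> N. 0 < \<sigma> * f p}"
    using iff c(2) by auto
  moreover have "p \<in> {q \<in> fst c. 0 < \<sigma> * lap g (snd c q)}" using iff[OF pc] p pc by simp
  ultimately show "\<exists>T. open T \<and> p \<in> T \<and> T \<subseteq> {p \<in> N. 0 < \<sigma> * f p}" by blast
qed

text \<open>The two strict sign sets are open and disjoint and cover the connected \<open>W\<close>,
  so one of them misses \<open>W\<close>. Being open it also misses the closure of \<open>W\<close>,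
  which contains \<open>N\<close>.\<close>

lemma constant_sign:
  assumes W: "W \<subseteq> N" "connected W" "N \<subseteq> closure W" and nz: "\<And>p. p \<in> W \<Longrightarrow> f p \<noteq> 0"
  obtains \<sigma> :: real where "\<sigma> \<noteq> 0" "\<And>p. p \<in> N \<Longrightarrow> 0 \<le> \<sigma> * f p"
proof -
  define P where "P \<sigma> = {p \<in> N. 0 < \<sigma> * f p}" for \<sigma> :: real
  have o: "open (P \<sigma>)" for \<sigma> unfolding P_def by (rule open_sign_set)
  have "W \<subseteq> P 1 \<union> P (- 1)" using W(1) nz by (force simp: P_def)
  moreover have "P 1 \<inter> P (- 1) \<inter> W = {}" by (auto simp: P_def)
  ultimately have "P 1 \<inter> W = {} \<or> P (- 1) \<inter> W = {}"
    using connectedD[OF W(2) o o] by blast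
  then obtain \<sigma> :: real where \<sigma>: "\<sigma> = 1 \<or> \<sigma> = - 1" "P \<sigma> \<inter> W = {}" by blast
  have "P \<sigma> \<inter> closure W = {}" using open_Int_closure_eq_empty[OF o] \<sigma>(2) by blast
  then have "P \<sigma> = {}" using W(3) by (auto simp: P_def)
  then have "0 \<le> - \<sigma> * f p" if "p \<in> N" for p using that by (force simp: P_def)
  then show thesis using that[of "- \<sigma>"] \<sigma>(1) by auto
qed

end

lemma no_mate_of_constant_sign:
  assumes "\<not> congruent_immersions x x'"
    and V: "open V" "V \<noteq> {}" "\<And>p. p \<in> V \<Longrightarrow> differential_nonzero A (mean_curvature A x) p"
    and f: "\<And>p. p \<in> N \<Longrightarrow> \<exists>c u G g a. log_chart A N x c u G g \<and> p \<in> fst c \<and> 0 < a \<and> f p = a * lap g (snd c p)"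
    and W: "(\<forall>p\<in>N. f p = 0) \<or> (\<exists>W. W \<subseteq> N \<and> connected W \<and> N \<subseteq> closure W \<and> (\<forall>p\<in>W. f p \<noteq> 0))"
  shows False
proof -
  have co: "coincide = {}" using coincide_cases congruent_of_coincide assms(1) by blast
  have "\<exists>\<sigma>. \<sigma> \<noteq> 0 \<and> (\<forall>p\<in>N. 0 \<le> \<sigma> * f p)"
    using W
  proof
    assume "\<forall>p\<in>N. f p = 0"
    then show ?thesis by (intro exI[of _ 1]) simp
  next
    assume "\<exists>W. W \<subseteq> N \<and> connected W \<and> N \<subseteq> closure W \<and> (\<forall>p\<in>W. f p \<noteq> 0)"
    then obtain W where W: "W \<subseteq> N" "connected W" "N \<subseteq> closure W" "\<And>p. p \<in> W \<Longrightarrow> f p \<noteq> 0" by blast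
    show ?thesis using constant_sign[OF f co W] by metis
  qed
  then obtain \<sigma> where \<sigma>: "\<sigma> \<noteq> 0" "\<And>p. p \<in> N \<Longrightarrow> 0 \<le> \<sigma> * f p" by blast
  show False
  proof (rule constant_sign_contradiction[OF assms(1) \<sigma>(1) V])
    fix c u G g q assume lc: "log_chart A N x c u G g" and q: "q \<in> fst c"
    obtain a where a: "0 < a" "lap g (snd c q) = a * f q" using lap_g_eq[OF f co lc q] .
    have "q \<in> N" using lc q by (auto simp: log_chart_def)
    then have "0 \<le> a * (\<sigma> * f q)" using a(1) \<sigma>(2) by simp
    then show "0 \<le> \<sigma> * lap g (snd c q)" unfolding a(2) by (simp only: ac_simps)
  qed
qed

end

section \<open>From the hypotheses on \<Delta>g to the theorem\<close>

lemma is_Delta_g_log_chart: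
  assumes "is_Delta_g A x N f" "p \<in> N"
  shows "\<exists>c u G g a. log_chart A N x c u G g \<and> p \<in> fst c \<and> 0 < a \<and> f p = a * lap g (snd c p)"
proof -
  obtain U z u G g where c: "complex_chart A x (U, z) u" "p \<in> U" "U \<subseteq> N" "smooth_on (z ` U) G" "smooth_on (z ` U) g"
    "\<forall>w \<in> z ` U. of_real (exp (2 * u w)) * hopf_invariant (local_rep (U, z) x) u w = exp (of_real (G w) + \<i> * of_real (g w))"
    "f p = laplace_beltrami u g (z p)"
    using assms unfolding is_Delta_g_def by blast
  have "of_real (exp (2 * u w)) * hopf_invariant (local_rep (U, z) x) u w = 2 * hopf_coeff (local_rep (U, z) x) w" for w
    by (simp add: hopf_invariant_def)
  then have "log_chart A N x (U, z) u G g" using c by (simp add: log_chart_def)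
  moreover have "f p = exp (- 2 * u (z p)) * lap g (z p)"
    using c(7) by (simp add: laplace_beltrami_def lap_def)
  moreover have "0 < exp (- 2 * u (z p))" by simp
  ultimately show ?thesis using c(2) by (metis fst_conv snd_conv)
qed

lemma no_bonnet_mate:
  fixes A :: "'a::t2_space chart set" and x :: "'a \<Rightarrow> real^3"
  assumes "oriented_smooth_atlas A"
    and "compact (UNIV :: 'a set)" and "connected (UNIV :: 'a set)"
    and "smooth_immersion A x"
    and "\<exists>V. open V \<and> closure V = UNIV \<and>
           (\<forall>p\<in>V. differential_nonzero A (mean_curvature A x) p)"
    and "discrete (umbilics A x)"
    and f: "is_Delta_g A x (- umbilics A x) f"
    and W: "(\<forall>p\<in>- umbilics A x. f p = 0) \<or> (\<exists>W. W \<subseteq> - umbilics A x \<and> connected W \<and>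
      - umbilics A x \<subseteq> closure W \<and> (\<forall>p\<in>W. f p \<noteq> 0))"
  shows "\<not> bonnet_mate A x x'"
proof
  assume mate: "bonnet_mate A x x'"
  define N where "N = - umbilics A x"
  note f' = is_Delta_g_log_chart[OF f[folded N_def]]
  interpret o: oriented_surface A by unfold_locales (rule assms(1))
  \<comment> \<open>Openness of \<open>N\<close> is read off from the charts that compute \<Delta>g:
    their open domains cover \<open>N\<close> and stay inside it.\<close>
  have "open N"
  proof (subst open_subopen, intro ballI)
    fix p assume "p \<in> N"
    then obtain c u G g where c: "log_chart A N x c u G g" "p \<in> fst c" using f' by blast
    then have "open (fst c)" "fst c \<subseteq> N"
      by (auto simp: log_chart_def complex_chart_def compatible_chart_def coord_chart_def)
    then show "\<exists>T. open T \<and> p \<in> T \<and> T \<subseteq> N" using c(2) by blast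
  qed
  have pair: "bonnet_pair_log A (umbilics A x) N x x'"
  proof unfold_locales
    show "\<exists>c u G g. log_chart A N x c u G g \<and> p \<in> fst c" if "p \<in> N" for p
      using f'[OF that] by blast
    show "N = - umbilics A x" by (rule N_def)
  qed (use assms(2-4,6) mate \<open>open N\<close> in \<open>simp_all add: bonnet_mate_def\<close>)
  obtain V where V: "open V" "closure V = UNIV" "\<And>p. p \<in> V \<Longrightarrow> differential_nonzero A (mean_curvature A x) p"
    using assms(5) by blast
  have "V \<noteq> {}" using V(2) by auto
  have "\<not> congruent_immersions x x'" using mate by (simp add: bonnet_mate_def)
  from bonnet_pair_log.no_mate_of_constant_sign[OF pair this V(1) \<open>V \<noteq> {}\<close> V(3) f' W[folded N_def]]
  show False .
qed

theorem mainTheorem1: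
  fixes A :: "'a::t2_space chart set" and x :: "'a \<Rightarrow> real^3"
  assumes "oriented_smooth_atlas A"
    and "compact (UNIV :: 'a set)" and "connected (UNIV :: 'a set)"
    and "smooth_immersion A x"
    and "\<exists>V. open V \<and> closure V = UNIV \<and>
           (\<forall>p\<in>V. differential_nonzero A (mean_curvature A x) p)"
    and "discrete (umbilics A x)"
  shows "(isothermic_on A x (- umbilics A x) \<longrightarrow> \<not> (\<exists>x'. bonnet_mate A x x')) \<and>
         (totally_nonisothermic_on A x (- umbilics A x) \<longrightarrow> \<not> (\<exists>x'. bonnet_mate A x x'))"
proof (intro conjI impI notI)
  assume "isothermic_on A x (- umbilics A x)"
  then obtain f where "is_Delta_g A x (- umbilics A x) f" "\<forall>p\<in>- umbilics A x. f p = 0"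
    unfolding isothermic_on_def by blast
  then have "\<not> bonnet_mate A x x'" for x' using no_bonnet_mate[OF assms] by blast
  moreover assume "\<exists>x'. bonnet_mate A x x'"
  ultimately show False by blast
next
  assume "totally_nonisothermic_on A x (- umbilics A x)"
  then obtain f W where "is_Delta_g A x (- umbilics A x) f" "W \<subseteq> - umbilics A x" "connected W"
    "- umbilics A x \<subseteq> closure W" "\<forall>p\<in>W. f p \<noteq> 0"
    unfolding totally_nonisothermic_on_def by blast
  then have "\<not> bonnet_mate A x x'" for x' using no_bonnet_mate[OF assms] by blast
  moreover assume "\<exists>x'. bonnet_mate A x x'"
  ultimately show False by blast
qed

end
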